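(* Let $0<\alpha\le1$ and $\frac n4<\beta\le1$. Let $G(u)=E_{\alpha}(-A)u=v(1,\cdot)$, where $A=(-\Delta)^{\beta}$ on $\mathbb{T}^{n}$ and $v$ solves $\partial_{t}^{\alpha}v+Av=0$, $v(0)=u$, and let $\ell(G(u))=(G(u)(x_{1}),\dots,G(u)(x_{K}))^{T}$ for fixed points $x_{1},\dots,x_{K}\in\mathbb{T}^{n}$. Consider the inverse problem of finding $u$ from noisy observations $$y=\ell(G(u))+\eta,$$ where $\eta\in\mathbb{R}^{K}$ is mean zero Gaussian with covariance $\Gamma$. Let $X=L^{2}(\mathbb{T}^{n})$ and let $\mu_{0}$ be a variable index Besov prior, i.e. a $(\delta,B^{s(\cdot)}_{q(\cdot)})$ measure, with $s\in C^{\log}_{loc}(\mathbb{T}^{n})\cap L^{\infty}(\mathbb{T}^{n})$, $q\in\mathcal{P}^{\log}(\mathbb{T}^{n})$, $\inf_{x\in\mathbb{T}^{n}}s(x)>\frac{n}{q^{+}}$ and $\delta>4$. Assume $t\in C^{\log}_{loc}(\mathbb{T}^{n})\cap L^{\infty}(\mathbb{T}^{n})$ and $$\frac{n}{q^{-}}-\frac n2<t^{-}\le t^{+}<s^{-}-\frac{n}{q^{+}}.$$ Then the measure $\mu^{y}(du)$ is absolutely continuous with respect to $\mu_{0}$ with Radon–Nikodym derivative $$\frac{d\mu^{y}}{d\mu_{0}}(u)=\frac{1}{Z(y)}\exp(-\Phi(u;y)),$$ where $$\Phi(u;y)=\frac12|\Gamma^{-1/2}(y-\ell(G(u)))|^{2}-\frac12|\Gamma^{-1/2}y|^{2}$$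 and $$Z(y)=\int_{X}\exp\left(-\frac12|\Gamma^{-1/2}(y-\ell(G(u)))|^{2}+\frac12|\Gamma^{-1/2}y|^{2}\right)\mu_{0}(du).$$ Furthermore, the posterior measure is continuous in the Hellinger metric with respect to the data: $$d_{Hell}(\mu^{y},\mu^{y'})\le C|y-y'|,$$ where $C=C(r)$ with $\max\{|y|,|y'|\}\le r$.
   Context: $\mathbb{T}^{n}$ is the $n$-dimensional torus, $n\le3$; $A=(-\Delta)^{\beta}$ on $L^{2}(\mathbb{T}^{n})$ with domain $H^{2\beta}(\mathbb{T}^{n})$. $\partial_{t}^{\alpha}$ is the Caputo derivative, $\partial_{t}^{\alpha}f(t)=\frac{1}{\Gamma(1-\alpha)}\int_{0}^{t}(t-\tau)^{-\alpha}f'(\tau)\,d\tau$ (the ordinary derivative when $\alpha=1$; here $\Gamma(\cdot)$ is the Gamma function), and $E_{\alpha}(z)=\sum_{k\ge0}\frac{z^{k}}{\Gamma(\alpha k+1)}$ is the Mittag-Leffler function; $E_\alpha(-A)$ is defined by functional calculus (Fourier multiplier). The noise $\eta$ is independent of $u\sim\mu_{0}$, and $\mu^{y}$ is the posterior measure, i.e. the conditional distribution of $u$ given $y$. The Hellinger metric is $d_{Hell}(\mu,\mu')=\sqrt{\frac12\int\left(\sqrt{\frac{d\mu}{d\nu}}-\sqrt{\frac{d\mu'}{d\nu}}\right)^{2}d\nu}$ for any reference measure $\nu$ with respect to which both are absolutely continuous. $\mathcal{P}$ is the set of measurable $q:\mathbb{T}^{n}\to[1,\infty)$; for a function $g$,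 $g^{-},g^{+}$ are its essential infimum and supremum. $g\in C^{\log}_{loc}(\mathbb{T}^{n})$ means $|g(x)-g(y)|\le c/\log(e+1/|x-y|)$ for all $x,y$ and some $c>0$; $g\in C^{\log}$ if moreover $|g(x)-g_\infty|\le c/\log(e+|x|)$ for some $g_\infty$. $\mathcal{P}^{\log}$: those $q\in\mathcal{P}$ with $1/q\in C^{\log}$ and $1\le q^{-}\le q^{+}<\infty$. Wavelets: $\psi^{F},\psi^{M}$ are the scaling function and wavelet of an orthonormal Meyer system on $\mathbb{R}$, or of a Daubechies system of regularity $k$ (compactly supported, in $C^k$, with $k$ vanishing moments of $\psi^M$) with $k>\max(-g^{-},g^{+})$ for $g\in\{s,t\}$. $G^{0}=\{F,M\}^{n}$; for $j\ge1$, $G^{j}$ is the set of $G\in\{F,M\}^{n}$ with at least one entry $M$; $\mathbb{M}_{j}=\{0,\dots,2^{j}-1\}^{n}$; $\tilde\Psi^{j}_{Gm}(x)=\prod_{r=1}^{n}\sum_{\ell\in\mathbb{Z}}2^{j/2}\psi^{G_{r}}(2^{j}(x_{r}+\ell)-m_{r})$. A $(\delta,B^{s(\cdot)}_{q(\cdot)})$ measure is the law of $u=\sum_{j\ge0}\sum_{G\in G^{j}}\sum_{m\in\mathbb{M}_{j}}\gamma^{j}_{Gm}\xi^{j}_{Gm}\tilde\Psi^{j}_{Gm}$ with $\gamma^{j}_{Gm}=2^{-j(s(2^{-j}m)+n/2-n/q^{+})}(1/\delta)^{1/q^{+}}$ and $\xi^{j}_{Gm}$ i.i.d. on $\mathbb{R}$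 with density proportional to $x\mapsto\exp\left(-\frac12\int_{\mathbb{T}^{n}}|x|^{q(y)}dy\right)$. *)

theory Defs
  imports "HOL-Analysis.Analysis" "HOL-Probability.Probability"
begin

subsection \<open>The torus and its Lebesgue space\<close>

text \<open>The torus is \<open>\<real>\<^sup>n / \<int>\<^sup>n\<close> (side length 1, as the dyadic grid \<open>2\<^sup>-\<^sup>j m\<close>,
  \<open>0 \<le> m < 2\<^sup>j\<close> requires).  Functions on it are 1-periodic functions on \<open>\<real>\<^sup>n\<close>; integration is
  over the fundamental cell \<open>[0,1)\<^sup>n\<close>.\<close>

definition torus_measure :: "(real ^ 'n::finite) measure" where
  "torus_measure = restrict_space lborel {x. \<forall>i. 0 \<le> x $ i \<and> x $ i < 1}"

definition int_vec :: "int ^ 'n \<Rightarrow> real ^ 'n::finite" where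
  "int_vec k = (\<chi> i. of_int (k $ i))"

definition periodic :: "(real ^ 'n::finite \<Rightarrow> 'b) \<Rightarrow> bool" where
  "periodic g \<longleftrightarrow> (\<forall>x k. g (x + int_vec k) = g x)"

definition torus_dist :: "real ^ 'n::finite \<Rightarrow> real ^ 'n \<Rightarrow> real" where
  "torus_dist x y = (INF k. norm (x - y + int_vec k))"

definition torus_L2_rel :: "(real ^ 'n::finite \<Rightarrow> real) \<Rightarrow> (real ^ 'n \<Rightarrow> real) \<Rightarrow> bool" where
  "torus_L2_rel f g \<longleftrightarrow>
     f \<in> borel_measurable torus_measure \<and> g \<in> borel_measurable torus_measure \<and>
     integrable torus_measure (\<lambda>x. (f x)\<^sup>2) \<and> integrable torus_measure (\<lambda>x. (g x)\<^sup>2) \<and>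
     (AE x in torus_measure. f x = g x)"

text \<open>\<open>'n torus_L2\<close> is the real Hilbert space \<open>L\<^sup>2\<close> of the torus, i.e. square-integrable functions
  modulo almost everywhere equality; \<open>abs_torus_L2 f\<close> is the class of \<open>f\<close>.\<close>

quotient_type 'n torus_L2 = "real ^ 'n::finite \<Rightarrow> real" / partial: torus_L2_rel
proof (rule part_equivpI)
  show "\<exists>x. torus_L2_rel x x"
    by (rule exI[of _ "\<lambda>_. 0"]) (simp add: torus_L2_rel_def)
  show "symp torus_L2_rel"
    by (auto simp: symp_def torus_L2_rel_def eq_commute)
  show "transp torus_L2_rel"
    unfolding transp_def torus_L2_rel_def by (auto elim: AE_mp)
qed

lemma torus_L2_mult_integrable:
  assumes "f \<in> borel_measurable M" "g \<in> borel_measurable M"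
    and "integrable M (\<lambda>x. (f x)\<^sup>2)" "integrable M (\<lambda>x. (g x)\<^sup>2)"
  shows "integrable M (\<lambda>x. f x * g x :: real)"
proof (rule Bochner_Integration.integrable_bound)
  show "integrable M (\<lambda>x. (f x)\<^sup>2 + (g x)\<^sup>2)" using assms by simp
  show "(\<lambda>x. f x * g x) \<in> borel_measurable M" using assms by measurable
  have "\<bar>a * b\<bar> \<le> a\<^sup>2 + b\<^sup>2" for a b :: real
  proof -
    have "2 * (\<bar>a\<bar> * \<bar>b\<bar>) \<le> a\<^sup>2 + b\<^sup>2" using sum_squares_bound[of "\<bar>a\<bar>" "\<bar>b\<bar>"] by simp
    moreover have "0 \<le> \<bar>a\<bar> * \<bar>b\<bar>" by simp
    ultimately show ?thesis unfolding abs_mult by linarith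
  qed
  then show "AE x in M. norm (f x * g x) \<le> norm ((f x)\<^sup>2 + (g x)\<^sup>2)" by simp
qed

lemma torus_L2_add_integrable:
  assumes "f \<in> borel_measurable M" "g \<in> borel_measurable M"
    and "integrable M (\<lambda>x. (f x)\<^sup>2)" "integrable M (\<lambda>x. (g x)\<^sup>2)"
  shows "integrable M (\<lambda>x. (f x + g x :: real)\<^sup>2)"
  unfolding power2_sum using assms torus_L2_mult_integrable[OF assms]
  by (auto simp: mult.assoc)

instantiation torus_L2 :: (finite) real_vector
begin

lift_definition zero_torus_L2 :: "'a torus_L2" is "\<lambda>_. 0"
  by (simp add: torus_L2_rel_def)

lift_definition plus_torus_L2 :: "'a torus_L2 \<Rightarrow> 'a torus_L2 \<Rightarrow> 'a torus_L2" is
  "\<lambda>f g x. f x + g x"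
  unfolding torus_L2_rel_def by (auto intro!: torus_L2_add_integrable)

lift_definition uminus_torus_L2 :: "'a torus_L2 \<Rightarrow> 'a torus_L2" is "\<lambda>f x. - f x"
  unfolding torus_L2_rel_def by auto

definition minus_torus_L2 :: "'a torus_L2 \<Rightarrow> 'a torus_L2 \<Rightarrow> 'a torus_L2" where
  "minus_torus_L2 u v = u + - v"

lift_definition scaleR_torus_L2 :: "real \<Rightarrow> 'a torus_L2 \<Rightarrow> 'a torus_L2" is "\<lambda>c f x. c * f x"
  unfolding torus_L2_rel_def by (auto simp: power_mult_distrib)

instance
proof
  fix u v w :: "'a torus_L2" and a b :: real
  show "u + v + w = u + (v + w)"
    by transfer (auto simp: torus_L2_rel_def add.assoc intro!: torus_L2_add_integrable)
  show "u + v = v + u"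
    by transfer (auto simp: torus_L2_rel_def add.commute intro!: torus_L2_add_integrable)
  show "0 + u = u"
    by transfer (auto simp: torus_L2_rel_def)
  show "- u + u = 0"
    by transfer (auto simp: torus_L2_rel_def)
  show "u - v = u + - v"
    by (rule minus_torus_L2_def)
  show "a *\<^sub>R (u + v) = a *\<^sub>R u + a *\<^sub>R v"
    by transfer (auto simp: torus_L2_rel_def power_mult_distrib distrib_left
        intro!: torus_L2_add_integrable)
  show "(a + b) *\<^sub>R u = a *\<^sub>R u + b *\<^sub>R u"
    by transfer (auto simp: torus_L2_rel_def power_mult_distrib distrib_right
        intro!: torus_L2_add_integrable)
  show "a *\<^sub>R b *\<^sub>R u = (a * b) *\<^sub>R u"
    by transfer (auto simp: torus_L2_rel_def power_mult_distrib mult.assoc)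
  show "1 *\<^sub>R u = u"
    by transfer (auto simp: torus_L2_rel_def)
qed

end

instantiation torus_L2 :: (finite) real_inner
begin

lift_definition inner_torus_L2 :: "'a torus_L2 \<Rightarrow> 'a torus_L2 \<Rightarrow> real" is
  "\<lambda>f g. LINT x|torus_measure. f x * g x"
  unfolding torus_L2_rel_def by (auto intro!: integral_cong_AE)

definition norm_torus_L2 :: "'a torus_L2 \<Rightarrow> real" where
  "norm_torus_L2 u = sqrt (u \<bullet> u)"

definition dist_torus_L2 :: "'a torus_L2 \<Rightarrow> 'a torus_L2 \<Rightarrow> real" where
  "dist_torus_L2 u v = norm (u - v)"

definition sgn_torus_L2 :: "'a torus_L2 \<Rightarrow> 'a torus_L2" where
  "sgn_torus_L2 u = u /\<^sub>R norm u"

definition uniformity_torus_L2 :: "('a torus_L2 \<times> 'a torus_L2) filter" where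
  "uniformity_torus_L2 = (INF e\<in>{0 <..}. principal {(x, y). dist x y < e})"

definition open_torus_L2 :: "'a torus_L2 set \<Rightarrow> bool" where
  "open_torus_L2 U \<longleftrightarrow> (\<forall>x\<in>U. eventually (\<lambda>(x', y). x' = x \<longrightarrow> y \<in> U) uniformity)"

instance
proof
  fix u v w :: "'a torus_L2" and a :: real and U :: "'a torus_L2 set"
  show "dist u v = norm (u - v)"
    by (rule dist_torus_L2_def)
  show "sgn u = u /\<^sub>R norm u"
    by (rule sgn_torus_L2_def)
  show "uniformity = (INF e\<in>{0 <..}. principal {(x :: 'a torus_L2, y). dist x y < e})"
    by (rule uniformity_torus_L2_def)
  show "open U \<longleftrightarrow> (\<forall>x\<in>U. eventually (\<lambda>(x', y). x' = x \<longrightarrow> y \<in> U) uniformity)"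
    by (rule open_torus_L2_def)
  show "u \<bullet> v = v \<bullet> u"
    by transfer (simp add: mult.commute)
  show "(u + v) \<bullet> w = u \<bullet> w + v \<bullet> w"
    by transfer (auto simp: torus_L2_rel_def distrib_right torus_L2_mult_integrable)
  show "(a *\<^sub>R u) \<bullet> v = a * (u \<bullet> v)"
    by transfer (simp add: mult.assoc)
  show "0 \<le> u \<bullet> u"
    by transfer simp
  show "u \<bullet> u = 0 \<longleftrightarrow> u = 0"
    by transfer
      (auto simp: torus_L2_rel_def power2_eq_square integral_nonneg_eq_0_iff_AE)
  show "norm u = sqrt (u \<bullet> u)"
    by (rule norm_torus_L2_def)
qed

end

subsection \<open>Fourier multipliers, the fractional Laplacian and the forward map\<close>

lift_definition fourier_coeff :: "('n::finite) torus_L2 \<Rightarrow> int ^ 'n \<Rightarrow> complex" is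
  "\<lambda>f k. LINT x|torus_measure. complex_of_real (f x) * cis (- 2 * pi * (int_vec k \<bullet> x))"
proof -
  have char: "(\<lambda>x. cis (- 2 * pi * (int_vec k \<bullet> x))) \<in> borel_measurable torus_measure"
    for k :: "int ^ 'n"
  proof -
    have "(\<lambda>x. cis (- 2 * pi * (int_vec k \<bullet> x))) \<in> borel_measurable borel"
      unfolding cis_conv_exp by (intro borel_measurable_continuous_onI continuous_intros)
    then show ?thesis
      unfolding torus_measure_def by (intro measurable_restrict_space1) simp
  qed
  show "\<And>f g :: real ^ 'n \<Rightarrow> real. torus_L2_rel f g \<Longrightarrow>
      (\<lambda>k. LINT x|torus_measure. complex_of_real (f x) * cis (- 2 * pi * (int_vec k \<bullet> x))) =
      (\<lambda>k. LINT x|torus_measure. complex_of_real (g x) * cis (- 2 * pi * (int_vec k \<bullet> x)))"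
    unfolding torus_L2_rel_def
    by (intro ext integral_cong_AE borel_measurable_times char borel_measurable_of_real) auto
qed

definition is_fourier_multiplier ::
  "(int ^ 'n \<Rightarrow> real) \<Rightarrow> 'n::finite torus_L2 \<Rightarrow> 'n torus_L2 \<Rightarrow> bool" where
  "is_fourier_multiplier a u w \<longleftrightarrow>
     (\<forall>k. fourier_coeff w k = complex_of_real (a k) * fourier_coeff u k)"

definition fourier_multiplier :: "(int ^ 'n \<Rightarrow> real) \<Rightarrow> 'n::finite torus_L2 \<Rightarrow> 'n torus_L2" where
  "fourier_multiplier a u = (THE w. is_fourier_multiplier a u w)"

text \<open>The character \<open>x \<mapsto> exp (2 \<pi> i k \<bullet> x)\<close> is an eigenfunction of \<open>-\<Delta>\<close> with
  eigenvalue \<open>4 \<pi>\<^sup>2 \<bar>k\<bar>\<^sup>2\<close>.\<close>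

definition frac_laplacian_symbol :: "real \<Rightarrow> int ^ 'n::finite \<Rightarrow> real" where
  "frac_laplacian_symbol \<beta> k = (4 * pi\<^sup>2 * (norm (int_vec k))\<^sup>2) powr \<beta>"

definition in_sobolev :: "real \<Rightarrow> 'n::finite torus_L2 \<Rightarrow> bool" where
  "in_sobolev r u \<longleftrightarrow>
     (\<lambda>k. (1 + 4 * pi\<^sup>2 * (norm (int_vec k))\<^sup>2) powr r * (norm (fourier_coeff u k))\<^sup>2)
       summable_on UNIV"

text \<open>The graph of the operator \<open>A = (-\<Delta>)\<^sup>\<beta>\<close> with domain \<open>H\<^sup>2\<^sup>\<beta>\<close>.\<close>

definition frac_laplacian_graph :: "real \<Rightarrow> 'n::finite torus_L2 \<Rightarrow> 'n torus_L2 \<Rightarrow> bool" where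
  "frac_laplacian_graph \<beta> u w \<longleftrightarrow>
     in_sobolev (2 * \<beta>) u \<and> is_fourier_multiplier (frac_laplacian_symbol \<beta>) u w"

definition mittag_leffler :: "real \<Rightarrow> real \<Rightarrow> real" where
  "mittag_leffler \<alpha> z = (\<Sum>k. z ^ k / Gamma (\<alpha> * real k + 1))"

definition forward_map :: "real \<Rightarrow> real \<Rightarrow> 'n::finite torus_L2 \<Rightarrow> 'n torus_L2" where
  "forward_map \<alpha> \<beta> = fourier_multiplier (\<lambda>k. mittag_leffler \<alpha> (- frac_laplacian_symbol \<beta> k))"

definition has_caputo_derivative ::
  "real \<Rightarrow> (real \<Rightarrow> 'b::{banach, second_countable_topology}) \<Rightarrow> 'b \<Rightarrow> real \<Rightarrow> bool" where
  "has_caputo_derivative \<alpha> f D t \<longleftrightarrow>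
     (if \<alpha> = 1 then (f has_vector_derivative D) (at t)
      else (\<forall>\<tau>\<in>{0<..<t}. f differentiable at \<tau>) \<and>
        set_integrable lborel {0<..<t}
          (\<lambda>\<tau>. (t - \<tau>) powr (- \<alpha>) *\<^sub>R vector_derivative f (at \<tau>)) \<and>
        D = (1 / Gamma (1 - \<alpha>)) *\<^sub>R
          (LINT \<tau>:{0<..<t}|lborel. (t - \<tau>) powr (- \<alpha>) *\<^sub>R vector_derivative f (at \<tau>)))"

text \<open>For initial data that are merely in \<open>L\<^sup>2\<close>, \<open>\<tau> \<mapsto> \<partial>\<^sub>t v(\<tau>)\<close> need not be Bochner
  integrable in \<open>L\<^sup>2\<close> near \<open>\<tau> = 0\<close>.  The Caputo derivative is therefore taken
  weakly, after pairing with the eigenfunctions of \<open>A\<close>.\<close>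

definition frac_diffusion_solution ::
  "real \<Rightarrow> real \<Rightarrow> 'n::finite torus_L2 \<Rightarrow> (real \<Rightarrow> 'n torus_L2) \<Rightarrow> bool" where
  "frac_diffusion_solution \<alpha> \<beta> u v \<longleftrightarrow>
     v 0 = u \<and> continuous_on {0..} v \<and>
     (\<forall>t>0. \<exists>w. frac_laplacian_graph \<beta> (v t) w \<and>
        (\<forall>k. has_caputo_derivative \<alpha> (\<lambda>\<tau>. fourier_coeff (v \<tau>) k) (- fourier_coeff w k) t))"

definition continuous_representative :: "'n::finite torus_L2 \<Rightarrow> real ^ 'n \<Rightarrow> real" where
  "continuous_representative w =
     (THE g. continuous_on UNIV g \<and> periodic g \<and> abs_torus_L2 g = w)"

definition point_values :: "('k::finite \<Rightarrow> real ^ 'n::finite) \<Rightarrow> 'n torus_L2 \<Rightarrow> real ^ 'k" where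
  "point_values x w = (\<chi> i. continuous_representative w (x i))"

subsection \<open>Variable exponents\<close>

definition ess_sup :: "(real ^ 'n::finite \<Rightarrow> real) \<Rightarrow> real" where
  "ess_sup g = real_of_ereal (esssup torus_measure (\<lambda>x. ereal (g x)))"

definition ess_inf :: "(real ^ 'n::finite \<Rightarrow> real) \<Rightarrow> real" where
  "ess_inf g = - ess_sup (\<lambda>x. - g x)"

definition torus_Linf :: "(real ^ 'n::finite \<Rightarrow> real) \<Rightarrow> bool" where
  "torus_Linf g \<longleftrightarrow> periodic g \<and> g \<in> borel_measurable torus_measure \<and>
     esssup torus_measure (\<lambda>x. ereal \<bar>g x\<bar>) < \<infinity>"

definition C_log_loc :: "(real ^ 'n::finite \<Rightarrow> real) \<Rightarrow> bool" where
  "C_log_loc g \<longleftrightarrow> periodic g \<and>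
     (\<exists>c>0. \<forall>x y. \<bar>g x - g y\<bar> \<le> c / ln (exp 1 + 1 / torus_dist x y))"

definition C_log :: "(real ^ 'n::finite \<Rightarrow> real) \<Rightarrow> bool" where
  "C_log g \<longleftrightarrow> C_log_loc g \<and>
     (\<exists>g_inf. \<exists>c>0. \<forall>x. \<bar>g x - g_inf\<bar> \<le> c / ln (exp 1 + torus_dist x 0))"

definition P_exponent :: "(real ^ 'n::finite \<Rightarrow> real) \<Rightarrow> bool" where
  "P_exponent q \<longleftrightarrow> periodic q \<and> q \<in> borel_measurable torus_measure \<and> (\<forall>x. 1 \<le> q x)"

definition P_log :: "(real ^ 'n::finite \<Rightarrow> real) \<Rightarrow> bool" where
  "P_log q \<longleftrightarrow> P_exponent q \<and> C_log (\<lambda>x. 1 / q x) \<and> 1 \<le> ess_inf q \<and>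
     esssup torus_measure (\<lambda>x. ereal (q x)) < \<infinity>"

subsection \<open>Wavelets\<close>

definition C_k :: "nat \<Rightarrow> (real \<Rightarrow> real) \<Rightarrow> bool" where
  "C_k k f \<longleftrightarrow> (\<forall>i<k. (deriv ^^ i) f differentiable_on UNIV) \<and> continuous_on UNIV ((deriv ^^ k) f)"

text \<open>Meyer systems, with frequencies \<open>\<xi>\<close> in cycles.  The Fourier transform of \<open>\<psi>F\<close> is \<open>\<theta>\<close> and
  that of \<open>\<psi>M\<close> is \<open>\<epsilon> exp (-\<pi> i (2 p + 1) \<xi>) sqrt (\<theta>(\<xi>/2)\<^sup>2 - \<theta>(\<xi>)\<^sup>2)\<close>; as these profiles
  are even, the inversion integrals are cosine integrals.  The integer \<open>p\<close> and the sign \<open>\<epsilon>\<close> cover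
  the different normalisations of the wavelet in the literature.\<close>

definition meyer_system :: "(real \<Rightarrow> real) \<Rightarrow> (real \<Rightarrow> real) \<Rightarrow> bool" where
  "meyer_system \<psi>F \<psi>M \<longleftrightarrow>
     (\<exists>\<theta> :: real \<Rightarrow> real. \<exists>p :: int. \<exists>\<epsilon>\<in>{-1, 1}.
        (\<forall>k. C_k k \<theta>) \<and> (\<forall>\<xi>. \<theta> (- \<xi>) = \<theta> \<xi>) \<and> (\<forall>\<xi>. 0 \<le> \<theta> \<xi> \<and> \<theta> \<xi> \<le> 1) \<and>
        (\<forall>\<xi>. \<bar>\<xi>\<bar> \<le> 1/3 \<longrightarrow> \<theta> \<xi> = 1) \<and> (\<forall>\<xi>. 2/3 \<le> \<bar>\<xi>\<bar> \<longrightarrow> \<theta> \<xi> = 0) \<and>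
        (\<forall>\<xi>\<in>{0..1}. (\<theta> \<xi>)\<^sup>2 + (\<theta> (1 - \<xi>))\<^sup>2 = 1) \<and>
        (\<forall>x. \<psi>F x = (LINT \<xi>|lborel. \<theta> \<xi> * cos (2 * pi * \<xi> * x))) \<and>
        (\<forall>x. \<psi>M x = \<epsilon> * (LINT \<xi>|lborel. sqrt ((\<theta> (\<xi> / 2))\<^sup>2 - (\<theta> \<xi>)\<^sup>2) *
                           cos (2 * pi * \<xi> * (x - of_int p - 1/2)))))"

definition line_inner :: "(real \<Rightarrow> real) \<Rightarrow> (real \<Rightarrow> real) \<Rightarrow> real" where
  "line_inner f g = (LINT x|lborel. f x * g x)"

definition line_L2 :: "(real \<Rightarrow> real) \<Rightarrow> bool" where
  "line_L2 f \<longleftrightarrow> f \<in> borel_measurable lborel \<and> integrable lborel (\<lambda>x. (f x)\<^sup>2)"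

definition dyadic :: "nat \<Rightarrow> int \<Rightarrow> (real \<Rightarrow> real) \<Rightarrow> real \<Rightarrow> real" where
  "dyadic j m f x = 2 powr (real j / 2) * f (2 ^ j * x - of_int m)"

text \<open>The two-scale relation: \<open>f\<close> lies in the closed span in \<open>L\<^sup>2(\<real>)\<close> of the half-integer
  translates of \<open>x \<mapsto> \<psi>F (2 x)\<close>.\<close>

definition two_scale :: "(real \<Rightarrow> real) \<Rightarrow> (real \<Rightarrow> real) \<Rightarrow> bool" where
  "two_scale \<psi>F f \<longleftrightarrow>
     (\<exists>h :: int \<Rightarrow> real.
        ((\<lambda>S. LINT x|lborel. (f x - (\<Sum>m\<in>S. h m * dyadic 1 m \<psi>F x))\<^sup>2) \<longlongrightarrow> 0)
          (finite_subsets_at_top UNIV))"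

text \<open>\<open>\<psi>F\<close> and \<open>\<psi>M\<close> are the scaling function and wavelet of an orthonormal multiresolution
  analysis: the inhomogeneous system (translates of \<open>\<psi>F\<close> at level 0, and of \<open>\<psi>M\<close> at all levels)
  is an orthonormal basis of \<open>L\<^sup>2(\<real>)\<close> and both functions satisfy a two-scale relation.\<close>

definition orthonormal_wavelets :: "(real \<Rightarrow> real) \<Rightarrow> (real \<Rightarrow> real) \<Rightarrow> bool" where
  "orthonormal_wavelets \<psi>F \<psi>M \<longleftrightarrow>
     line_L2 \<psi>F \<and> line_L2 \<psi>M \<and>
     (\<forall>m m'. line_inner (dyadic 0 m \<psi>F) (dyadic 0 m' \<psi>F) = (if m = m' then 1 else 0)) \<and>
     (\<forall>j m m'. line_inner (dyadic 0 m \<psi>F) (dyadic j m' \<psi>M) = 0) \<and>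
     (\<forall>j j' m m'. line_inner (dyadic j m \<psi>M) (dyadic j' m' \<psi>M) =
        (if j = j' \<and> m = m' then 1 else 0)) \<and>
     (\<forall>f. line_L2 f \<longrightarrow> (\<forall>m. line_inner f (dyadic 0 m \<psi>F) = 0) \<longrightarrow>
        (\<forall>j m. line_inner f (dyadic j m \<psi>M) = 0) \<longrightarrow> (AE x in lborel. f x = 0)) \<and>
     two_scale \<psi>F \<psi>F \<and> two_scale \<psi>F \<psi>M"

definition daubechies_system :: "nat \<Rightarrow> (real \<Rightarrow> real) \<Rightarrow> (real \<Rightarrow> real) \<Rightarrow> bool" where
  "daubechies_system k \<psi>F \<psi>M \<longleftrightarrow>
     orthonormal_wavelets \<psi>F \<psi>M \<and>
     (\<exists>R. \<forall>x. R < \<bar>x\<bar> \<longrightarrow> \<psi>F x = 0 \<and> \<psi>M x = 0) \<and>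
     C_k k \<psi>F \<and> C_k k \<psi>M \<and>
     (\<forall>i<k. (LINT x|lborel. x ^ i * \<psi>M x) = 0)"

definition admissible_wavelets ::
  "(real ^ 'n::finite \<Rightarrow> real) \<Rightarrow> (real ^ 'n \<Rightarrow> real) \<Rightarrow>
   (real \<Rightarrow> real) \<Rightarrow> (real \<Rightarrow> real) \<Rightarrow> bool" where
  "admissible_wavelets s t \<psi>F \<psi>M \<longleftrightarrow>
     meyer_system \<psi>F \<psi>M \<or>
     (\<exists>k. daubechies_system k \<psi>F \<psi>M \<and>
        (\<forall>g\<in>{s, t}. real k > max (- ess_inf g) (ess_sup g)))"

datatype wavelet_kind = Father | Mother

definition wavelet_types :: "nat \<Rightarrow> ('n::finite \<Rightarrow> wavelet_kind) set" where
  "wavelet_types j = (if j = 0 then UNIV else {G. \<exists>r. G r = Mother})"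

definition wavelet_positions :: "nat \<Rightarrow> (nat ^ 'n::finite) set" where
  "wavelet_positions j = {m. \<forall>r. m $ r < 2 ^ j}"

definition periodic_wavelet ::
  "(real \<Rightarrow> real) \<Rightarrow> (real \<Rightarrow> real) \<Rightarrow> nat \<Rightarrow> ('n::finite \<Rightarrow> wavelet_kind) \<Rightarrow> nat ^ 'n \<Rightarrow>
   real ^ 'n \<Rightarrow> real" where
  "periodic_wavelet \<psi>F \<psi>M j G m x =
     (\<Prod>r\<in>UNIV. \<Sum>\<^sub>\<infinity>l::int. 2 powr (real j / 2) *
        (case G r of Father \<Rightarrow> \<psi>F | Mother \<Rightarrow> \<psi>M) (2 ^ j * (x $ r + of_int l) - real (m $ r)))"

subsection \<open>Variable index Besov measures\<close>

definition xi_weight :: "(real ^ 'n::finite \<Rightarrow> real) \<Rightarrow> real \<Rightarrow> real" where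
  "xi_weight q a = exp (- (LINT y|torus_measure. \<bar>a\<bar> powr q y) / 2)"

definition xi_law :: "(real ^ 'n::finite \<Rightarrow> real) \<Rightarrow> real measure" where
  "xi_law q = density lborel (\<lambda>a. ennreal (xi_weight q a / (LINT b|lborel. xi_weight q b)))"

definition besov_gamma ::
  "real \<Rightarrow> (real ^ 'n::finite \<Rightarrow> real) \<Rightarrow> (real ^ 'n \<Rightarrow> real) \<Rightarrow> nat \<Rightarrow> nat ^ 'n \<Rightarrow> real" where
  "besov_gamma \<delta> s q j m =
     2 powr (- real j * (s (\<chi> r. real (m $ r) / 2 ^ j) + real CARD('n) / 2
                          - real CARD('n) / ess_sup q))
       * (1 / \<delta>) powr (1 / ess_sup q)"

definition wavelet_indices :: "(nat \<times> ('n::finite \<Rightarrow> wavelet_kind) \<times> (nat ^ 'n)) set" where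
  "wavelet_indices = (SIGMA j:UNIV. wavelet_types j \<times> wavelet_positions j)"

text \<open>The i.i.d. coefficients are realised canonically on the product space of their common law;
  the series over the levels \<open>j\<close> converges almost surely in \<open>L\<^sup>2\<close> (each level is a finite sum).\<close>

definition is_besov_measure ::
  "real \<Rightarrow> (real ^ 'n::finite \<Rightarrow> real) \<Rightarrow> (real ^ 'n \<Rightarrow> real) \<Rightarrow>
   (real \<Rightarrow> real) \<Rightarrow> (real \<Rightarrow> real) \<Rightarrow> 'n torus_L2 measure \<Rightarrow> bool" where
  "is_besov_measure \<delta> s q \<psi>F \<psi>M \<mu> \<longleftrightarrow>
     (\<exists>u. u \<in> borel_measurable (PiM wavelet_indices (\<lambda>_. xi_law q)) \<and>
        (AE \<xi> in PiM wavelet_indices (\<lambda>_. xi_law q).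
           (\<lambda>j. \<Sum>G\<in>wavelet_types j. \<Sum>m\<in>wavelet_positions j.
              (besov_gamma \<delta> s q j m * \<xi> (j, G, m)) *\<^sub>R
                abs_torus_L2 (periodic_wavelet \<psi>F \<psi>M j G m)) sums u \<xi>) \<and>
        \<mu> = distr (PiM wavelet_indices (\<lambda>_. xi_law q)) borel u)"

subsection \<open>Gaussian noise, posterior and Hellinger distance\<close>

definition pos_def_matrix :: "real ^ 'k ^ 'k::finite \<Rightarrow> bool" where
  "pos_def_matrix S \<longleftrightarrow> transpose S = S \<and> (\<forall>x. x \<noteq> 0 \<longrightarrow> 0 < x \<bullet> (S *v x))"

definition matrix_inv_sqrt :: "real ^ 'k ^ 'k::finite \<Rightarrow> real ^ 'k ^ 'k" where
  "matrix_inv_sqrt S = (THE R. pos_def_matrix R \<and> R ** R = matrix_inv S)"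

definition gaussian_density :: "real ^ 'k ^ 'k::finite \<Rightarrow> real ^ 'k \<Rightarrow> real" where
  "gaussian_density S x =
     exp (- (x \<bullet> (matrix_inv S *v x)) / 2) / sqrt ((2 * pi) ^ CARD('k) * det S)"

text \<open>As \<^const>\<open>prob_space.indep_var\<close>, which however requires both variables to have the same
  value type.\<close>

definition independent_variables ::
  "'w measure \<Rightarrow> ('w \<Rightarrow> 'a::topological_space) \<Rightarrow> ('w \<Rightarrow> 'b::topological_space) \<Rightarrow> bool" where
  "independent_variables M U V \<longleftrightarrow>
     U \<in> borel_measurable M \<and> V \<in> borel_measurable M \<and>
     prob_space.indep_set M {U -` A \<inter> space M | A. A \<in> sets borel}
                            {V -` B \<inter> space M | B. B \<in> sets borel}"

text \<open>\<open>\<kappa>\<close> is a regular version of the conditional distribution of \<open>U\<close> given \<open>Y\<close>: a Markov kernel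
  that disintegrates the joint law of \<open>(Y, U)\<close>.\<close>

definition conditional_distribution ::
  "'w measure \<Rightarrow> ('w \<Rightarrow> 'a::topological_space) \<Rightarrow> ('w \<Rightarrow> 'b::topological_space) \<Rightarrow>
   ('b \<Rightarrow> 'a measure) \<Rightarrow> bool" where
  "conditional_distribution M U Y \<kappa> \<longleftrightarrow>
     \<kappa> \<in> borel \<rightarrow>\<^sub>M prob_algebra borel \<and>
     (\<forall>A\<in>sets borel. \<forall>B\<in>sets borel.
        emeasure M {\<omega> \<in> space M. U \<omega> \<in> A \<and> Y \<omega> \<in> B} =
        (\<integral>\<^sup>+y\<in>B. emeasure (\<kappa> y) A \<partial>distr M borel Y))"

definition hellinger_dist :: "'a measure \<Rightarrow> 'a measure \<Rightarrow> 'a measure \<Rightarrow> real" where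
  "hellinger_dist \<nu> \<mu> \<mu>' =
     sqrt (1 / 2 * (LINT x|\<nu>. (sqrt (enn2real (RN_deriv \<nu> \<mu> x)) - sqrt (enn2real (RN_deriv \<nu> \<mu>' x)))\<^sup>2))"

definition potential ::
  "real \<Rightarrow> real \<Rightarrow> ('k::finite \<Rightarrow> real ^ 'n::finite) \<Rightarrow> real ^ 'k ^ 'k \<Rightarrow>
   'n torus_L2 \<Rightarrow> real ^ 'k \<Rightarrow> real" where
  "potential \<alpha> \<beta> x S u y =
     1 / 2 * (norm (matrix_inv_sqrt S *v (y - point_values x (forward_map \<alpha> \<beta> u))))\<^sup>2
     - 1 / 2 * (norm (matrix_inv_sqrt S *v y))\<^sup>2"

definition evidence ::
  "real \<Rightarrow> real \<Rightarrow> ('k::finite \<Rightarrow> real ^ 'n::finite) \<Rightarrow> real ^ 'k ^ 'k \<Rightarrow>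
   'n torus_L2 measure \<Rightarrow> real ^ 'k \<Rightarrow> real" where
  "evidence \<alpha> \<beta> x S \<mu> y =
     (LINT u|\<mu>. exp (- 1 / 2 * (norm (matrix_inv_sqrt S *v
                           (y - point_values x (forward_map \<alpha> \<beta> u))))\<^sup>2
                      + 1 / 2 * (norm (matrix_inv_sqrt S *v y))\<^sup>2))"

end

theory Submission
  imports Defs "HOL-Real_Asymp.Real_Asymp"
begin

text \<open>On the Fourier side the fractional diffusion equation is a family of scalar relaxation equations
  \<open>\<partial>\<^sub>t\<^sup>\<alpha> f = - \<lambda> f\<close>; each is equivalent to a Volterra equation whose Picard iteration produces the
  Mittag-Leffler series, and since trigonometric polynomials are dense in \<open>L\<^sup>2\<close>, the Fourier coefficients
  determine the solution.  The bound \<open>0 \<le> E\<^sub>\<alpha>(-\<lambda>) \<le> 1 / (1 + \<lambda> / \<Gamma>(\<alpha> + 1))\<close> makes the multiplier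
  square summable exactly because \<open>4 \<beta> > n\<close>, so \<open>u \<mapsto> \<ell>(G(u))\<close> is bounded and linear.

  The likelihood \<open>exp (- \<Phi>(u; y)) = exp (w \<bullet> b - \<bar>b\<bar>\<^sup>2 / 2)\<close>, with \<open>w\<close> and \<open>b\<close>
  the images of \<open>y\<close> and \<open>\<ell>(G(u))\<close> under \<open>\<Gamma>\<^sup>-\<^sup>1\<^sup>/\<^sup>2\<close>, is bounded in \<open>u\<close>, and its
  square root is Lipschitz in \<open>y\<close> on bounded sets, uniformly in \<open>u\<close>; this gives the Hellinger estimate.
  Bayes' formula itself is Tonelli's theorem.\<close>

subsection \<open>Bounds for the Mittag-Leffler function\<close>

text \<open>The discretisation trades complete monotonicity, the usual source of positivity and
  decay of E_\<alpha>(-\<lambda>), for identities between powers of 1 - X. The analytic input is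
  then the sign pattern of the coefficients of (1 - X)^\<alpha> and the growth n^\<alpha> /
  Gamma(\<alpha> + 1) of those of (1 - X)^-(\<alpha> + 1); the latter is the origin of the constant
  in the upper bound.

  Density of trigonometric polynomials meets the obstacle that a continuous function on the cell
  need not match across opposite faces. Approximation is therefore done for functions F o e, where e
  wraps the cell onto a product of circles in C^n; Borel sets of the cell are reached because e has
  a Borel inverse there.

  In the Hellinger estimate, differentiating the likelihood in y produces a factor |b|, which is
  unbounded in u. Half of the Gaussian exponent, -|b|^2 / 4, survives in the square root and absorbs
  it. Strict positivity of the likelihood handles arbitrary reference measures: whatever dominates
  the posterior also dominates the prior.\<close>

text \<open>The formal power series of \<open>(1 - X)\<^sup>-\<^sup>a\<close>.\<close>

definition negbin :: "real \<Rightarrow> real fps" where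
  "negbin a = Abs_fps (\<lambda>n. pochhammer a n / fact n)"

lemma negbin_nth: "fps_nth (negbin a) n = pochhammer a n / fact n"
  by (simp add: negbin_def)

text \<open>Vandermonde's convolution for rising factorials. It makes composition of discrete
  fractional sums an addition of exponents, on which the later identities rest.\<close>

lemma negbin_add: "negbin (a + b) = negbin a * negbin b"
proof (rule fps_ext)
  fix n
  have "fps_nth (negbin (a + b)) n =
      (\<Sum>k\<le>n. of_nat (n choose k) * pochhammer a k * pochhammer b (n - k)) / fact n"
    by (simp add: negbin_nth pochhammer_binomial_sum)
  also have "\<dots> = (\<Sum>k\<le>n. (pochhammer a k / fact k) * (pochhammer b (n - k) / fact (n - k)))"
    unfolding sum_divide_distrib
    by (intro sum.cong refl) (simp add: binomial_fact field_simps)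
  also have "\<dots> = fps_nth (negbin a * negbin b) n"
    by (simp add: fps_mult_nth atMost_atLeast0 negbin_nth)
  finally show "fps_nth (negbin (a + b)) n = fps_nth (negbin a * negbin b) n" .
qed

lemma negbin_0: "negbin 0 = 1"
  by (rule fps_ext) (auto simp: negbin_nth pochhammer_0_left)

lemma negbin_1_nth: "fps_nth (negbin 1) n = 1"
  by (simp add: negbin_nth pochhammer_fact[symmetric])

lemma negbin_1_mult_nth: "fps_nth (negbin 1 * F) n = (\<Sum>j\<le>n. fps_nth F j)"
proof -
  have "fps_nth (F * negbin 1) n = (\<Sum>j\<le>n. fps_nth F j)"
    unfolding fps_mult_nth atMost_atLeast0 negbin_1_nth by simp
  then show ?thesis by (simp add: mult.commute)
qed

lemma negbin_nonneg: "0 \<le> a \<Longrightarrow> 0 \<le> fps_nth (negbin a) n"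
  by (cases "a = 0") (auto simp: negbin_nth pochhammer_0_left pochhammer_pos less_imp_le)

text \<open>The factor -a in front of the rising factorial of 1 - a fixes the sign. This pattern of
  (1 - X)^a, one positive entry followed by nonpositive ones, is what makes the scheme preserve
  positivity.\<close>

lemma negbin_uminus_nonpos:
  assumes "0 \<le> a" "a \<le> 1" "n > 0"
  shows "fps_nth (negbin (- a)) n \<le> 0"
proof -
  obtain k where n: "n = Suc k" using assms(3) gr0_implies_Suc by blast
  have "pochhammer (1 - a) k \<ge> 0"
    using assms by (cases "a = 1") (auto simp: pochhammer_0_left pochhammer_pos less_imp_le)
  then have "pochhammer (- a) n \<le> 0"
    unfolding n pochhammer_rec using assms by (simp add: mult_nonpos_nonneg add.commute)
  then show ?thesis by (simp add: negbin_nth divide_nonpos_pos)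
qed

text \<open>\<open>V = (1 - X)\<^sup>a\<^sup>-\<^sup>1 / ((1 - X)\<^sup>a + m)\<close> is the generating function of the implicit
  Gruenwald-Letnikov scheme for \<open>\<partial>\<^sub>t\<^sup>a f = - \<lambda> f\<close>, \<open>f 0 = 1\<close>; with step \<open>1 / n\<close> and \<open>m = \<lambda> n\<^sup>-\<^sup>a\<close>
  its \<open>n\<close>-th coefficient tends to \<open>E\<^sub>a(-\<lambda>)\<close>, so that bounds on the coefficients pass to the limit.\<close>

locale ml_scheme =
  fixes a m :: real
  assumes a: "0 < a" "a \<le> 1" and m: "0 \<le> m"
begin

definition T :: "real fps" where "T = inverse (negbin (- a) + fps_const m)"
definition V :: "real fps" where "V = negbin (1 - a) * T"

lemma T_eq: "T * (negbin (- a) + fps_const m) = 1"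
  unfolding T_def using m by (intro inverse_mult_eq_1) (auto simp: negbin_nth)

text \<open>The n-th coefficient of \<open>T_eq\<close> expresses (1 + m) times the new coefficient
  as a nonnegative number minus a sum of earlier coefficients with nonpositive weights.\<close>

lemma T_nonneg: "0 \<le> fps_nth T n"
proof (induction n rule: less_induct)
  case (less n)
  have "(\<Sum>j=0..n. fps_nth T j * fps_nth (negbin (- a) + fps_const m) (n - j)) = (if n = 0 then 1 else 0)"
    using arg_cong[OF T_eq, of "\<lambda>F. fps_nth F n"] by (simp add: fps_mult_nth)
  moreover have "(\<Sum>j=0..n. fps_nth T j * fps_nth (negbin (- a) + fps_const m) (n - j)) =
      (\<Sum>j=0..<n. fps_nth T j * fps_nth (negbin (- a) + fps_const m) (n - j)) + fps_nth T n * (1 + m)"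
    unfolding atLeastLessThanSuc_atLeastAtMost[symmetric] sum.atLeastLessThan_Suc[OF le0] by (simp add: negbin_nth)
  moreover have "(\<Sum>j=0..<n. fps_nth T j * fps_nth (negbin (- a) + fps_const m) (n - j)) \<le> 0"
    using less negbin_uminus_nonpos[of a] a by (intro sum_nonpos mult_nonneg_nonpos) auto
  ultimately have "fps_nth T n * (1 + m) \<ge> 0" by (smt (verit))
  then show ?case using m by (simp add: zero_le_mult_iff)
qed

lemma V_nonneg: "0 \<le> fps_nth V n"
  unfolding V_def fps_mult_nth using a by (intro sum_nonneg mult_nonneg_nonneg T_nonneg negbin_nonneg) auto

text \<open>The discrete Volterra equation: multiplication by \<open>negbin a\<close> is the
  fractional sum of order a, and \<open>negbin 1\<close> is the constant initial value 1.
  Multiplying \<open>T_eq\<close> by (1 - X)^-a and then by (1 - X)^(a - 1) yields it.\<close>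

lemma V_eq: "V = negbin 1 - fps_const m * (negbin a * V)"
proof -
  have *: "negbin (1 - a) * negbin a = negbin 1" "negbin a * negbin (- a) = 1"
    by (simp_all flip: negbin_add add: negbin_0)
  have "negbin a * (T * (negbin (- a) + fps_const m)) = T + fps_const m * (negbin a * T)"
    using *(2) by (simp only: distrib_left mult.left_commute[of _ T] mult.commute[of _ "fps_const m"]
        mult.left_commute[of _ "fps_const m"] mult_1_right)
  then have "T = negbin a - fps_const m * (negbin a * T)"
    unfolding T_eq mult_1_right by (simp add: eq_diff_eq)
  then have "negbin (1 - a) * T = negbin (1 - a) * (negbin a - fps_const m * (negbin a * T))"
    by simp
  also have "\<dots> = negbin 1 - fps_const m * (negbin a * (negbin (1 - a) * T))"
    using * by (simp add: algebra_simps)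
  finally show ?thesis unfolding V_def .
qed

text \<open>Successive differences are the coefficients of (1 - X) V = (1 - X)^a T = 1 - m T, and
  \<open>T\<close> has nonnegative coefficients.\<close>

lemma V_decreasing: assumes "j \<le> n" shows "fps_nth V n \<le> fps_nth V j"
proof -
  have "V = negbin 1 * (negbin (- a) * T)"
    unfolding V_def mult.assoc[symmetric] by (simp flip: negbin_add)
  also have "negbin (- a) * T = 1 - fps_const m * T"
    using T_eq by (simp add: algebra_simps)
  finally have V: "fps_nth V i = (\<Sum>l\<le>i. fps_nth (1 - fps_const m * T) l)" for i
    using negbin_1_mult_nth by metis
  have "fps_nth V (Suc i) \<le> fps_nth V i" for i
    using T_nonneg[of "Suc i"] m unfolding V by simp
  then have "decseq (fps_nth V)" by (rule decseq_SucI)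
  then show ?thesis using assms by (simp add: decseqD)
qed

text \<open>By monotonicity the last value can be pulled out of the convolution in
  \<open>V_eq\<close>; the remaining sum of coefficients of \<open>negbin a\<close> is a coefficient
  of \<open>negbin (a + 1)\<close>.\<close>

lemma V_upper: "fps_nth V n * (1 + m * fps_nth (negbin (a + 1)) n) \<le> 1"
proof -
  have "fps_nth V n * fps_nth (negbin (a + 1)) n = (\<Sum>j\<le>n. fps_nth (negbin a) j * fps_nth V n)"
    using negbin_1_mult_nth[of "negbin a" n] unfolding negbin_add
    unfolding mult.commute[of "negbin a"] by (simp add: mult.commute[of "fps_nth V n"] sum_distrib_right)
  also have "\<dots> \<le> (\<Sum>j\<le>n. fps_nth (negbin a) j * fps_nth V (n - j))"
    using a by (intro sum_mono mult_left_mono V_decreasing negbin_nonneg) auto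
  also have "\<dots> = fps_nth (negbin a * V) n"
    by (simp add: fps_mult_nth atMost_atLeast0)
  finally have "m * (fps_nth V n * fps_nth (negbin (a + 1)) n) \<le> m * fps_nth (negbin a * V) n"
    using m by (rule mult_left_mono)
  moreover have "fps_nth V n = 1 - m * fps_nth (negbin a * V) n"
    using arg_cong[OF V_eq, of "\<lambda>F. fps_nth F n"] by (simp add: negbin_1_nth)
  ultimately show ?thesis by (simp add: distrib_left mult.left_commute[of m])
qed

lemma V_le_1: "fps_nth V n \<le> 1"
proof -
  have "0 \<le> fps_nth (negbin a * V) n"
    unfolding fps_mult_nth using a by (intro sum_nonneg mult_nonneg_nonneg V_nonneg negbin_nonneg) auto
  moreover have "fps_nth V n = 1 - m * fps_nth (negbin a * V) n"
    using arg_cong[OF V_eq, of "\<lambda>F. fps_nth F n"] by (simp add: negbin_1_nth)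
  ultimately show ?thesis using m by simp
qed

text \<open>\<open>V_eq\<close> inserted into itself N times: a Neumann series with exact remainder,
  the discrete counterpart of the truncated Mittag-Leffler series.\<close>

lemma V_expansion:
  "V = (\<Sum>k<N. fps_const ((- m) ^ k) * negbin (a * k + 1)) + fps_const ((- m) ^ N) * (negbin (a * N) * V)"
proof (induction N)
  case 0 then show ?case by (simp add: negbin_0)
next
  case (Suc N)
  have "fps_const ((- m) ^ N) * (negbin (a * N) * V) =
      fps_const ((- m) ^ N) * (negbin (a * N) * (negbin 1 - fps_const m * (negbin a * V)))"
    using V_eq by simp
  also have "\<dots> = fps_const ((- m) ^ N) * negbin (a * N + 1) +
      fps_const ((- m) ^ N) * fps_const (- m) * (negbin (a * N) * negbin a * V)"
    by (simp add: algebra_simps negbin_add flip: fps_const_neg)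
  also have "negbin (a * N) * negbin a = negbin (a * Suc N)"
    by (simp flip: negbin_add add: algebra_simps)
  also have "fps_const ((- m) ^ N) * fps_const (- m) = fps_const ((- m) ^ Suc N)"
    by simp
  finally have "fps_const ((- m) ^ N) * (negbin (a * N) * V) =
     fps_const ((- m) ^ N) * negbin (a * N + 1) + fps_const ((- m) ^ Suc N) * (negbin (a * Suc N) * V)" .
  with Suc show ?case by (simp only: sum.lessThan_Suc add.assoc)
qed

text \<open>Since the coefficients of \<open>V\<close> lie between 0 and 1, replacing
  \<open>V\<close> by \<open>negbin 1\<close> in the remainder of \<open>V_expansion\<close> can
  only enlarge its modulus; what results is the modulus of the first omitted term.\<close>

lemma V_approx:
  "\<bar>fps_nth V n - (\<Sum>k<N. (- m) ^ k * fps_nth (negbin (a * k + 1)) n)\<bar>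
     \<le> m ^ N * fps_nth (negbin (a * N + 1)) n"
proof -
  have nn: "0 \<le> fps_nth (negbin (a * N) * V) n"
    unfolding fps_mult_nth using a by (intro sum_nonneg mult_nonneg_nonneg V_nonneg negbin_nonneg) auto
  have "fps_nth (negbin (a * N) * V) n \<le> (\<Sum>j=0..n. fps_nth (negbin (a * N)) j * 1)"
    unfolding fps_mult_nth using a by (intro sum_mono mult_left_mono V_le_1 negbin_nonneg) auto
  also have "\<dots> = fps_nth (negbin (a * N + 1)) n"
    using negbin_1_mult_nth[of "negbin (a * N)" n] unfolding negbin_add
    by (simp add: mult.commute atMost_atLeast0)
  finally have le: "fps_nth (negbin (a * N) * V) n \<le> fps_nth (negbin (a * N + 1)) n" .
  have "fps_nth V n - (\<Sum>k<N. (- m) ^ k * fps_nth (negbin (a * k + 1)) n) = (- m) ^ N * fps_nth (negbin (a * N) * V) n"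
    using arg_cong[OF V_expansion[of N], of "\<lambda>F. fps_nth F n"]
    by (simp add: fps_sum_nth)
  then have "\<bar>fps_nth V n - (\<Sum>k<N. (- m) ^ k * fps_nth (negbin (a * k + 1)) n)\<bar> = m ^ N * fps_nth (negbin (a * N) * V) n"
    using nn m by (simp only: abs_mult power_abs abs_minus_cancel abs_of_nonneg)
  then show ?thesis using le m by (simp add: mult_left_mono)
qed

end

section \<open>Passage from the scheme to the Mittag-Leffler function\<close>

lemma negbin_asymptotics:
  assumes "0 < z"
  shows "(\<lambda>n. real n powr (1 - z) * fps_nth (negbin z) n) \<longlonglongrightarrow> 1 / Gamma z"
proof -
  \<comment> \<open>\<open>rGamma_series\<close> is Gauss's limit for 1 / Gamma, but with a rising
    factorial of length n + 1; the extra factor removes its last entry z + n and supplies the power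
    of n.\<close>
  have "(\<lambda>n. rGamma_series z n * (real n / (z + real n))) \<longlonglongrightarrow> rGamma z * 1"
  proof (intro tendsto_mult rGamma_series_LIMSEQ)
    show "(\<lambda>n. real n / (z + real n)) \<longlonglongrightarrow> 1" by real_asymp
  qed
  moreover have "\<forall>\<^sub>F n in sequentially. rGamma_series z n * (real n / (z + real n)) =
      real n powr (1 - z) * fps_nth (negbin z) n"
    using eventually_gt_at_top[of 0]
  proof eventually_elim
    case (elim n)
    have eq: "rGamma_series z n = pochhammer z n * (z + n) / (fact n * real n powr z)"
      using elim by (simp add: rGamma_series_def pochhammer_Suc powr_def)
    have "z + real n \<noteq> 0" "real n powr z \<noteq> 0" using assms elim by auto
    then have "rGamma_series z n * (real n / (z + real n)) = pochhammer z n / fact n * (real n / real n powr z)"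
      unfolding eq by (simp add: divide_simps)
    also have "real n / real n powr z = real n powr (1 - z)"
      using elim by (simp add: powr_diff)
    finally show ?case by (simp add: negbin_nth)
  qed
  ultimately show ?thesis
    unfolding rGamma_inverse_Gamma mult_1_right inverse_eq_divide by (rule Lim_transform_eventually)
qed

text \<open>Only the tail [R, \<infinity>) of the Gamma integral is kept, where t powr x \<ge> R
  powr x. As R is free, Gamma outgrows every geometric sequence.\<close>

lemma Gamma_lower_bound:
  assumes "0 < R" "0 \<le> x"
  shows "exp (- R) * R powr x \<le> Gamma (x + 1 :: real)"
proof -
  have g: "((\<lambda>t. t powr x / exp t) has_integral Gamma (x + 1)) {0..}"
    using Gamma_integral_real[of "x + 1"] assms by simp
  have e: "((\<lambda>t. R powr x * exp (- t)) has_integral R powr x * exp (- R)) {R..}"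
    using has_integral_mult_right[OF has_integral_exp_minus_to_infinity[of 1 R], of "R powr x"] by simp
  have e': "((\<lambda>t. if t \<in> {R..} then R powr x * exp (- t) else 0) has_integral R powr x * exp (- R)) {0..}"
    using e assms by (subst has_integral_restrict) auto
  have "R powr x * exp (- R) \<le> Gamma (x + 1)"
    by (rule has_integral_le[OF e' g])
       (use assms in \<open>auto simp: exp_minus field_simps intro!: powr_mono2\<close>)
  then show ?thesis by (simp add: mult.commute)
qed

lemma mittag_leffler_summable:
  assumes "0 < a" "0 \<le> l"
  shows "summable (\<lambda>k. l ^ k / Gamma (a * real k + 1))"
proof -
  \<comment> \<open>Chosen so that R powr a = 2 l + 1: the k-th term is then at most a constant
    times (l / (2 l + 1)) ^ k, and this ratio stays below 1/2.\<close>
  define R where "R = (2 * l + 1) powr (1 / a)"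
  have R: "R > 0" "R powr a = 2 * l + 1"
    using assms by (simp_all add: R_def powr_powr)
  have "norm (l ^ k / Gamma (a * real k + 1)) \<le> exp R * (1/2) ^ k" for k
  proof -
    have "exp (- R) * (2 * l + 1) ^ k \<le> Gamma (a * k + 1)"
      using Gamma_lower_bound[OF R(1), of "a * k"] assms
      unfolding powr_powr[symmetric] R(2) by (simp add: powr_realpow)
    moreover have "0 < exp (- R) * (2 * l + 1) ^ k" using assms by simp
    ultimately have "l ^ k / Gamma (a * k + 1) \<le> l ^ k / (exp (- R) * (2 * l + 1) ^ k)"
      using assms by (intro divide_left_mono mult_pos_pos) (simp_all add: Gamma_real_pos add_nonneg_pos)
    also have "l ^ k / (exp (- R) * (2 * l + 1) ^ k) = exp R * (l / (2 * l + 1)) ^ k"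
    proof -
      have "x / (inverse e * P) = e * (x / P)" for x e P :: real
        by (simp add: divide_inverse)
      then show ?thesis unfolding exp_minus power_divide .
    qed
    also have "\<dots> \<le> exp R * (1/2) ^ k"
    proof (intro mult_left_mono power_mono)
      show "l / (2 * l + 1) \<le> 1 / 2" using assms(2) by (subst pos_divide_le_eq) auto
    qed (use assms(2) in auto)
    finally show ?thesis using assms Gamma_real_pos[of "a * k + 1"] by (simp add: add_nonneg_pos)
  qed
  note bound = this
  have "summable (\<lambda>k. exp R * (1/2) ^ k :: real)"
    by (rule summable_mult[OF summable_geometric]) simp
  then show ?thesis
    by (rule summable_comparison_test'[where N = 0]) (rule bound)
qed

lemma mittag_leffler_sums:
  assumes "0 < a" "0 \<le> l"
  shows "(\<lambda>k. (- l) ^ k / Gamma (a * real k + 1)) sums mittag_leffler a (- l)"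
  unfolding mittag_leffler_def
proof (rule summable_sums, rule summable_norm_cancel)
  have "norm ((- l) ^ k / Gamma (a * real k + 1)) = l ^ k / Gamma (a * real k + 1)" for k
    using assms Gamma_real_pos[of "a * k + 1"] by (simp add: power_abs add_nonneg_pos)
  then show "summable (\<lambda>k. norm ((- l) ^ k / Gamma (a * real k + 1)))"
    using mittag_leffler_summable[OF assms] by simp
qed

text \<open>The two bounds are \<open>V_nonneg\<close> and \<open>V_upper\<close> for the diagonal
  coefficient \<open>v n\<close>, the value after n steps of length 1 / n. Instead of proving that
  \<open>v n\<close> converges, each partial sum \<open>S N\<close> is compared with it up to the
  first omitted term; n tends to infinity for fixed N, and then N does.\<close>

lemma mittag_leffler_bounds:
  assumes a: "0 < a" "a \<le> 1" and l: "0 \<le> l"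
  shows "0 \<le> mittag_leffler a (- l)" "mittag_leffler a (- l) \<le> 1 / (1 + l / Gamma (a + 1))"
proof -
  define r where "r N = l ^ N / Gamma (a * real N + 1)" for N
  define S where "S N = (\<Sum>k<N. (- l) ^ k / Gamma (a * real k + 1))" for N
  have S: "S \<longlonglongrightarrow> mittag_leffler a (- l)"
    using mittag_leffler_sums[OF a(1) l] unfolding S_def sums_def .
  have r: "r \<longlonglongrightarrow> 0"
    using mittag_leffler_summable[OF a(1) l] unfolding r_def by (rule summable_LIMSEQ_zero)
  define m where "m n = l * real n powr (- a)" for n
  have sch: "ml_scheme a (m n)" for n
    using a l by unfold_locales (auto simp: m_def)
  define v where "v n = fps_nth (ml_scheme.V a (m n)) n" for n
  have lim: "(\<lambda>n. c ^ k * real n powr (- a * k) * fps_nth (negbin (a * k + 1)) n)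
      \<longlonglongrightarrow> c ^ k / Gamma (a * k + 1)" for k c
  proof -
    have "(\<lambda>n. c ^ k * (real n powr (1 - (a * k + 1)) * fps_nth (negbin (a * k + 1)) n))
       \<longlonglongrightarrow> c ^ k * (1 / Gamma (a * k + 1))"
      using a by (intro tendsto_mult tendsto_const negbin_asymptotics) (simp add: add_nonneg_pos)
    then show ?thesis by (simp add: mult.assoc)
  qed
  have m_pow: "(c * real n powr (- a)) ^ k = c ^ k * real n powr (- a * k)" if "n > 0" for c n k
    using that by (simp add: power_mult_distrib powr_power mult.commute)
  have appr: "\<bar>v n - (\<Sum>k<N. (- l) ^ k * real n powr (- a * k) * fps_nth (negbin (a * k + 1)) n)\<bar>
     \<le> l ^ N * real n powr (- a * N) * fps_nth (negbin (a * N + 1)) n" if n: "n \<ge> 1" for n N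
  proof -
    have "(- m n) ^ k = (- l) ^ k * real n powr (- a * k)" for k
      using m_pow[of n "- l" k] n by (simp add: m_def)
    moreover have "(m n) ^ N = l ^ N * real n powr (- a * N)"
      using m_pow[of n l N] n by (simp add: m_def)
    ultimately show ?thesis
      using ml_scheme.V_approx[OF sch[of n], of n N] unfolding v_def by simp
  qed
  have S_lim: "(\<lambda>n. \<Sum>k<N. (- l) ^ k * real n powr (- a * k) * fps_nth (negbin (a * k + 1)) n)
     \<longlonglongrightarrow> S N" for N
    unfolding S_def by (intro tendsto_sum lim)
  have lower: "- r N \<le> S N" for N
  proof -
    have 1: "(\<lambda>n. - (l ^ N * real n powr (- a * N) * fps_nth (negbin (a * N + 1)) n)) \<longlonglongrightarrow> - r N"
      unfolding r_def by (intro tendsto_minus lim)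
    show ?thesis
    proof (rule LIMSEQ_le[OF 1 S_lim], intro exI allI impI)
      fix n :: nat assume n: "1 \<le> n"
      show "- (l ^ N * real n powr (- a * N) * fps_nth (negbin (a * N + 1)) n)
         \<le> (\<Sum>k<N. (- l) ^ k * real n powr (- a * k) * fps_nth (negbin (a * k + 1)) n)"
        using appr[OF n, of N] ml_scheme.V_nonneg[OF sch[of n], of n] unfolding v_def by linarith
    qed
  qed
  have upper: "S N \<le> 1 / (1 + l / Gamma (a + 1)) + r N" for N
  proof -
    have "(\<lambda>n. l ^ 1 * real n powr (- a * real 1) * fps_nth (negbin (a * real 1 + 1)) n) \<longlonglongrightarrow> l ^ 1 / Gamma (a * real 1 + 1)"
      by (rule lim)
    then have 0: "(\<lambda>n. m n * fps_nth (negbin (a + 1)) n) \<longlonglongrightarrow> l / Gamma (a + 1)"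
      by (simp add: m_def)
    have "1 + l / Gamma (a + 1) > 0"
      using a l by (simp add: add_pos_nonneg Gamma_real_pos)
    then have 1: "(\<lambda>n. 1 / (1 + m n * fps_nth (negbin (a + 1)) n) +
        l ^ N * real n powr (- a * N) * fps_nth (negbin (a * N + 1)) n)
        \<longlonglongrightarrow> 1 / (1 + l / Gamma (a + 1)) + r N"
      unfolding r_def by (intro tendsto_add lim tendsto_divide tendsto_const 0) auto
    show ?thesis
    proof (rule LIMSEQ_le[OF S_lim 1], intro exI allI impI)
      fix n :: nat assume n: "1 \<le> n"
      have "0 \<le> m n * fps_nth (negbin (a + 1)) n"
        using a l by (intro mult_nonneg_nonneg negbin_nonneg) (auto simp: m_def)
      then have "v n \<le> 1 / (1 + m n * fps_nth (negbin (a + 1)) n)"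
        using ml_scheme.V_upper[OF sch[of n], of n] unfolding v_def
        by (simp add: pos_le_divide_eq)
      then show "(\<Sum>k<N. (- l) ^ k * real n powr (- a * k) * fps_nth (negbin (a * k + 1)) n)
         \<le> 1 / (1 + m n * fps_nth (negbin (a + 1)) n) + l ^ N * real n powr (- a * N) * fps_nth (negbin (a * N + 1)) n"
        using appr[OF n, of N] by linarith
    qed
  qed
  show "0 \<le> mittag_leffler a (- l)"
    using LIMSEQ_le[OF tendsto_minus[OF r] S] lower by simp
  show "mittag_leffler a (- l) \<le> 1 / (1 + l / Gamma (a + 1))"
    using LIMSEQ_le[OF S tendsto_add[OF tendsto_const r], of "1 / (1 + l / Gamma (a + 1))"] upper by simp
qed

subsection \<open>The fractional relaxation equation\<close>

lemma has_bochner_integral_Beta: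
  fixes a b c d :: real
  assumes "0 < a" "0 < b" "c < d"
  shows "has_bochner_integral lborel
    (\<lambda>s. indicator {c<..<d} s * ((s - c) powr (a - 1) * (d - s) powr (b - 1)))
    ((d - c) powr (a + b - 1) * Beta a b)"
proof -
  define f0 :: "real \<Rightarrow> real" where
    "f0 x = indicator {0<..<1} x * (x powr (a - 1) * (1 - x) powr (b - 1))" for x
  have "((\<lambda>x. x powr (a - 1) * (1 - x) powr (b - 1)) has_integral Beta a b) {0<..<1}"
    using has_integral_Beta_real[OF assms(1,2)] by (simp add: has_integral_Icc_iff_Ioo)
  then have "((\<lambda>x. if x \<in> {0<..<1} then x powr (a - 1) * (1 - x) powr (b - 1) else 0) has_integral Beta a b) UNIV"
    by (simp only: has_integral_restrict_UNIV)
  also have "(\<lambda>x. if x \<in> {0<..<1} then x powr (a - 1) * (1 - x) powr (b - 1) else 0) = f0"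
    by (auto simp: f0_def fun_eq_iff)
  finally have hi: "(f0 has_integral Beta a b) UNIV" .
  have meas: "f0 \<in> borel_measurable borel" unfolding f0_def by measurable
  have nn: "0 \<le> f0 x" for x by (simp add: f0_def)
  have B: "0 \<le> Beta a b" using has_integral_nonneg[OF hi] nn by simp
  have "has_bochner_integral lborel f0 (Beta a b)"
    by (rule has_bochner_integral_nn_integral)
      (use meas nn B nn_integral_has_integral_lborel[OF meas nn hi] in auto)
  \<comment> \<open>The integrand is homogeneous of degree a + b - 2; the remaining factor d - c is
    the Jacobian of the affine substitution.\<close>
  then have "has_bochner_integral lborel (\<lambda>x. (d - c) powr (a + b - 2) * f0 x) ((d - c) powr (a + b - 2) * Beta a b)"
    by (rule has_bochner_integral_mult_right)
  moreover have "(d - c) powr (a + b - 2) * f0 x =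
      indicator {c<..<d} (c + (d - c) * x) *
        ((c + (d - c) * x - c) powr (a - 1) * (d - (c + (d - c) * x)) powr (b - 1))" for x
  proof (cases "x \<in> {0<..<1}")
    case True
    have "0 < (d - c) * x" "(d - c) * x < (d - c) * 1"
      using True assms by (auto intro: mult_strict_left_mono)
    then have 1: "c + (d - c) * x \<in> {c<..<d}" by simp
    have 2: "d - (c + (d - c) * x) = (d - c) * (1 - x)" "c + (d - c) * x - c = (d - c) * x"
      by (simp_all add: algebra_simps)
    have "(d - c) powr (a + b - 2) = (d - c) powr (a - 1) * (d - c) powr (b - 1)"
      by (simp add: algebra_simps flip: powr_add)
    then show ?thesis
      unfolding 2 using 1 True assms by (simp add: f0_def powr_mult)
  next
    case False
    have "c + (d - c) * x \<notin> {c<..<d}"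
    proof
      assume *: "c + (d - c) * x \<in> {c<..<d}"
      have dc: "0 < d - c" using assms by simp
      from * have "(d - c) * 0 < (d - c) * x" "(d - c) * x < (d - c) * 1"
        unfolding mult_1_right mult_zero_right greaterThanLessThan_iff by linarith+
      then have "0 < x" "x < 1"
        unfolding mult_less_cancel_left_pos[OF dc] .
      then show False using False by simp
    qed
    then show ?thesis using False by (simp add: f0_def)
  qed
  moreover have "(d - c) powr (a + b - 2) * Beta a b = ((d - c) powr (a + b - 1) * Beta a b) /\<^sub>R \<bar>d - c\<bar>"
    using assms powr_diff[of "d - c" "a + b - 1" 1] by (simp add: field_simps)
  ultimately show ?thesis
    using assms by (subst lborel_has_bochner_integral_real_affine_iff[where c = "d - c" and t = c]) auto
qed

text \<open>The derivative may be singular at both ends. The gauge integral asks only for continuity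
  of f there, and absolute integrability of g turns its value into a Lebesgue integral.\<close>

lemma set_integral_derivative:
  fixes f :: "real \<Rightarrow> complex"
  assumes "0 < t" "continuous_on {0..t} f"
    and "\<And>\<tau>. \<tau> \<in> {0<..<t} \<Longrightarrow> (f has_vector_derivative g \<tau>) (at \<tau>)"
    and g: "set_integrable lborel {0<..<t} g"
  shows "(LINT \<tau>:{0<..<t}|lborel. g \<tau>) = f t - f 0"
proof -
  have "(g has_integral (f t - f 0)) {0..t}"
    using assms by (intro fundamental_theorem_of_calculus_interior) auto
  then have "(g has_integral (f t - f 0)) {0<..<t}"
    by (simp add: has_integral_Icc_iff_Ioo)
  then show ?thesis
    using set_borel_integral_eq_integral(2)[OF g] by (simp add: integral_unique)
qed

text \<open>For \<open>\<alpha> < 1\<close> this is \<open>I\<^sup>\<alpha> I\<^sup>1\<^sup>-\<^sup>\<alpha> f' = I\<^sup>1 f'\<close>: exchange the integrals and evaluate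
  the inner one as a Beta integral.\<close>

lemma caputo_relaxation_volterra:
  fixes f :: "real \<Rightarrow> complex"
  assumes \<alpha>: "0 < \<alpha>" "\<alpha> \<le> 1" and cont: "continuous_on {0..} f"
    and cap: "\<And>t. 0 < t \<Longrightarrow> has_caputo_derivative \<alpha> f (- (l *\<^sub>R f t)) t"
    and t: "0 < t"
  shows "f t = f 0 - (l / Gamma \<alpha>) *\<^sub>R (LINT s:{0<..<t}|lborel. (t - s) powr (\<alpha> - 1) *\<^sub>R f s)"
proof (cases "\<alpha> = 1")
  case True
  have d: "(f has_vector_derivative - (l *\<^sub>R f \<tau>)) (at \<tau>)" if "0 < \<tau>" for \<tau>
    using cap[OF that] True by (simp add: has_caputo_derivative_def)
  have c: "continuous_on {0..t} f" using cont by (rule continuous_on_subset) auto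
  have "set_integrable lborel {0..t} (\<lambda>s. - (l *\<^sub>R f s))"
    by (intro borel_integrable_atLeastAtMost' continuous_intros c)
  then have si: "set_integrable lborel {0<..<t} (\<lambda>s. - (l *\<^sub>R f s))"
    by (rule set_integrable_subset) auto
  have "f t - f 0 = (LINT \<tau>:{0<..<t}|lborel. - (l *\<^sub>R f \<tau>))"
    by (rule set_integral_derivative[symmetric, OF t c _ si]) (auto intro: d)
  also have "\<dots> = - (l *\<^sub>R (LINT \<tau>:{0<..<t}|lborel. f \<tau>))"
  proof -
    have "(LINT \<tau>:{0<..<t}|lborel. - (l *\<^sub>R f \<tau>)) = (LINT \<tau>|lborel. (- l) *\<^sub>R (indicator {0<..<t} \<tau> *\<^sub>R f \<tau>))"
      unfolding set_lebesgue_integral_def by (intro Bochner_Integration.integral_cong refl) simp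
    also have "\<dots> = (- l) *\<^sub>R (LINT \<tau>|lborel. indicator {0<..<t} \<tau> *\<^sub>R f \<tau>)"
      by (rule integral_scaleR_right)
    finally show ?thesis unfolding set_lebesgue_integral_def[of _ _ f] scaleR_minus_left .
  qed
  also have "(LINT \<tau>:{0<..<t}|lborel. f \<tau>) = (LINT s:{0<..<t}|lborel. (t - s) powr (\<alpha> - 1) *\<^sub>R f s)"
    unfolding set_lebesgue_integral_def by (intro Bochner_Integration.integral_cong) (auto simp: True indicator_def)
  finally show ?thesis using True by (simp add: algebra_simps)
next
  case False
  then have \<alpha>1: "\<alpha> < 1" using \<alpha> by simp
  define g where "g \<tau> = vector_derivative f (at \<tau>)" for \<tau>
  have cap': "(\<forall>\<tau>\<in>{0<..<t}. f differentiable at \<tau>) \<and>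
      set_integrable lborel {0<..<t} (\<lambda>\<tau>. (t - \<tau>) powr (- \<alpha>) *\<^sub>R g \<tau>) \<and>
      - (l *\<^sub>R f t) = (1 / Gamma (1 - \<alpha>)) *\<^sub>R (LINT \<tau>:{0<..<t}|lborel. (t - \<tau>) powr (- \<alpha>) *\<^sub>R g \<tau>)"
    if "0 < t" for t
    using cap[OF that] False by (simp add: has_caputo_derivative_def g_def)
  have G: "Gamma (1 - \<alpha>) > 0" "Gamma \<alpha> > 0" using \<alpha> \<alpha>1 by (simp_all add: Gamma_real_pos)
  \<comment> \<open>The Caputo derivative at time t speaks only about times strictly below t, so
    differentiability at \<tau> is read off at a later time.\<close>
  have d: "(f has_vector_derivative g \<tau>) (at \<tau>)" if "0 < \<tau>" for \<tau>
    using cap'[of "\<tau> + 1"] that unfolding g_def by (auto simp: vector_derivative_works)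
  have c: "continuous_on {0..t} f" using cont by (rule continuous_on_subset) auto
  define g0 where "g0 \<tau> = indicator {0<..<t} \<tau> *\<^sub>R g \<tau>" for \<tau>
  \<comment> \<open>Only the weighted derivative is known to be integrable; the factor (t - \<tau>)
    powr \<alpha>, bounded by t powr \<alpha>, undoes the weight.\<close>
  have intg: "integrable lborel g0"
  proof -
    define k where "k \<tau> = indicator {0<..<t} \<tau> *\<^sub>R ((t - \<tau>) powr (- \<alpha>) *\<^sub>R g \<tau>)" for \<tau>
    have k: "integrable lborel k" using cap'[OF t] unfolding k_def set_integrable_def by simp
    have eq: "g0 \<tau> = ((t - \<tau>) powr \<alpha> * indicator {0<..<t} \<tau>) *\<^sub>R k \<tau>" for \<tau>
      by (auto simp: g0_def k_def indicator_def simp flip: powr_add)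
    have km [measurable]: "k \<in> borel_measurable lborel" using k by simp
    show ?thesis
    proof (rule Bochner_Integration.integrable_bound)
      show "integrable lborel (\<lambda>\<tau>. t powr \<alpha> *\<^sub>R k \<tau>)" using k by simp
      show "g0 \<in> borel_measurable lborel" unfolding eq[abs_def] by measurable
      show "AE \<tau> in lborel. norm (g0 \<tau>) \<le> norm (t powr \<alpha> *\<^sub>R k \<tau>)"
      proof (rule AE_I2)
        fix \<tau>
        have "(t - \<tau>) powr \<alpha> * indicator {0<..<t} \<tau> \<le> t powr \<alpha>"
          using \<alpha> by (auto simp: indicator_def intro: powr_mono2)
        then show "norm (g0 \<tau>) \<le> norm (t powr \<alpha> *\<^sub>R k \<tau>)"
          unfolding eq by (simp add: mult_right_mono)
      qed
    qed
  qed
  have FTC: "(LINT \<tau>|lborel. g0 \<tau>) = f t - f 0"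
    using set_integral_derivative[OF t c, of g] d intg
    unfolding set_integrable_def set_lebesgue_integral_def g0_def by auto
  \<comment> \<open>The kernel of the iterated fractional integral. Integrating over s gives Beta (1
    - \<alpha>) \<alpha> for every \<tau> < t; integrating against the derivative over \<tau> gives
    the Caputo integral at time s.\<close>
  define K where "K \<tau> s = (if \<tau> < s \<and> s < t then (s - \<tau>) powr ((1 - \<alpha>) - 1) * (t - s) powr (\<alpha> - 1) else 0)" for \<tau> s :: real
  have [measurable]: "g0 \<in> borel_measurable lborel" using intg by simp
  have K_meas [measurable]: "(\<lambda>(\<tau>, s). K \<tau> s) \<in> borel_measurable (lborel \<Otimes>\<^sub>M lborel)"
    unfolding K_def by measurable
  have K: "has_bochner_integral lborel (K \<tau>) (Beta (1 - \<alpha>) \<alpha>)" if "\<tau> < t" for \<tau>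
  proof -
    have "K \<tau> = (\<lambda>s. indicator {\<tau><..<t} s * ((s - \<tau>) powr ((1 - \<alpha>) - 1) * (t - s) powr (\<alpha> - 1)))"
      by (auto simp: K_def fun_eq_iff)
    then show ?thesis
      using has_bochner_integral_Beta[of "1 - \<alpha>" \<alpha> \<tau> t] \<alpha> \<alpha>1 that by simp
  qed
  have Kg: "has_bochner_integral lborel (\<lambda>s. K \<tau> s *\<^sub>R g0 \<tau>) (Beta (1 - \<alpha>) \<alpha> *\<^sub>R g0 \<tau>)" for \<tau>
  proof (cases "\<tau> < t")
    case True
    then show ?thesis using K[OF True] by (intro has_bochner_integral_scaleR_left)
  qed (simp add: g0_def has_bochner_integral_zero)
  have K_nonneg: "0 \<le> K \<tau> s" for \<tau> s by (simp add: K_def)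
  have integrable_pair: "integrable (lborel \<Otimes>\<^sub>M lborel) (\<lambda>(\<tau>, s). K \<tau> s *\<^sub>R g0 \<tau>)"
  proof (rule lborel_pair.Fubini_integrable)
    show "(\<lambda>(\<tau>, s). K \<tau> s *\<^sub>R g0 \<tau>) \<in> borel_measurable (lborel \<Otimes>\<^sub>M lborel)"
      using K_meas by measurable
    have "(LINT s|lborel. norm (K \<tau> s *\<^sub>R g0 \<tau>)) = Beta (1 - \<alpha>) \<alpha> * norm (g0 \<tau>)" for \<tau>
    proof (cases "\<tau> < t")
      case True
      have "has_bochner_integral lborel (\<lambda>s. K \<tau> s * norm (g0 \<tau>)) (Beta (1 - \<alpha>) \<alpha> * norm (g0 \<tau>))"
        using K[OF True] by (rule has_bochner_integral_mult_left)
      then show ?thesis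
        using K_nonneg by (simp add: has_bochner_integral_iff)
    qed (simp add: g0_def)
    note eq = this
    show "integrable lborel (\<lambda>\<tau>. LINT s|lborel. norm (case (\<tau>, s) of (\<tau>, s) \<Rightarrow> K \<tau> s *\<^sub>R g0 \<tau>))"
      unfolding prod.case eq using intg by simp
    show "AE \<tau> in lborel. integrable lborel (\<lambda>s. case (\<tau>, s) of (\<tau>, s) \<Rightarrow> K \<tau> s *\<^sub>R g0 \<tau>)"
      using Kg by (simp add: has_bochner_integral_iff)
  qed
  have "Beta (1 - \<alpha>) \<alpha> *\<^sub>R (f t - f 0) = (LINT \<tau>|lborel. Beta (1 - \<alpha>) \<alpha> *\<^sub>R g0 \<tau>)"
    by (simp add: FTC)
  also have "\<dots> = (LINT \<tau>|lborel. (LINT s|lborel. K \<tau> s *\<^sub>R g0 \<tau>))"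
    using Kg by (simp add: has_bochner_integral_iff)
  also have "\<dots> = (LINT s|lborel. (LINT \<tau>|lborel. K \<tau> s *\<^sub>R g0 \<tau>))"
    using lborel_pair.Fubini_integral[OF integrable_pair] by simp
  also have "\<dots> = (LINT s|lborel. indicator {0<..<t} s *\<^sub>R ((t - s) powr (\<alpha> - 1) *\<^sub>R (Gamma (1 - \<alpha>) *\<^sub>R (- (l *\<^sub>R f s)))))"
  proof (rule Bochner_Integration.integral_cong[OF refl])
    fix s :: real
    show "(LINT \<tau>|lborel. K \<tau> s *\<^sub>R g0 \<tau>) =
      indicator {0<..<t} s *\<^sub>R ((t - s) powr (\<alpha> - 1) *\<^sub>R (Gamma (1 - \<alpha>) *\<^sub>R (- (l *\<^sub>R f s))))"
    proof (cases "s \<in> {0<..<t}")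
      case True
      have "(LINT \<tau>|lborel. K \<tau> s *\<^sub>R g0 \<tau>) =
          (LINT \<tau>|lborel. (t - s) powr (\<alpha> - 1) *\<^sub>R (indicator {0<..<s} \<tau> *\<^sub>R ((s - \<tau>) powr (- \<alpha>) *\<^sub>R g \<tau>)))"
        by (rule Bochner_Integration.integral_cong[OF refl]) (use True in \<open>auto simp: K_def g0_def indicator_def\<close>)
      also have "\<dots> = (t - s) powr (\<alpha> - 1) *\<^sub>R (LINT \<tau>:{0<..<s}|lborel. (s - \<tau>) powr (- \<alpha>) *\<^sub>R g \<tau>)"
        unfolding set_lebesgue_integral_def by (rule integral_scaleR_right)
      also have "(LINT \<tau>:{0<..<s}|lborel. (s - \<tau>) powr (- \<alpha>) *\<^sub>R g \<tau>) = Gamma (1 - \<alpha>) *\<^sub>R (- (l *\<^sub>R f s))"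
        using cap'[of s] True G by (simp del: scaleR_minus_right)
      finally show ?thesis using True by simp
    next
      case False
      then have "(\<lambda>\<tau>. K \<tau> s *\<^sub>R g0 \<tau>) = (\<lambda>\<tau>. 0)" by (auto simp: K_def g0_def indicator_def fun_eq_iff)
      then show ?thesis using False by simp
    qed
  qed
  also have "\<dots> = (LINT s|lborel. - (Gamma (1 - \<alpha>) * l) *\<^sub>R (indicator {0<..<t} s *\<^sub>R ((t - s) powr (\<alpha> - 1) *\<^sub>R f s)))"
    by (rule Bochner_Integration.integral_cong[OF refl]) (simp add: mult_ac)
  also have "\<dots> = - (Gamma (1 - \<alpha>) * l) *\<^sub>R (LINT s:{0<..<t}|lborel. (t - s) powr (\<alpha> - 1) *\<^sub>R f s)"
    unfolding set_lebesgue_integral_def by (rule integral_scaleR_right)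
  finally have eq: "Beta (1 - \<alpha>) \<alpha> *\<^sub>R (f t - f 0) =
      - (Gamma (1 - \<alpha>) * l) *\<^sub>R (LINT s:{0<..<t}|lborel. (t - s) powr (\<alpha> - 1) *\<^sub>R f s)" .
  have "Beta (1 - \<alpha>) \<alpha> = Gamma (1 - \<alpha>) * Gamma \<alpha>" by (simp add: Beta_def)
  then have "f t - f 0 = (1 / (Gamma (1 - \<alpha>) * Gamma \<alpha>)) *\<^sub>R (Beta (1 - \<alpha>) \<alpha> *\<^sub>R (f t - f 0))"
    using G by simp
  also have "\<dots> = - (l / Gamma \<alpha>) *\<^sub>R (LINT s:{0<..<t}|lborel. (t - s) powr (\<alpha> - 1) *\<^sub>R f s)"
    unfolding eq scaleR_scaleR using G by (simp add: field_simps)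
  finally show ?thesis by (simp add: algebra_simps)
qed

text \<open>The Riemann-Liouville integral of order \<alpha> of a monomial, before division by Gamma
  \<alpha>. It turns one Mittag-Leffler term into the next.\<close>

lemma has_bochner_integral_fractional_monomial:
  fixes t :: real
  assumes "0 < \<alpha>" "0 \<le> c" "0 < t"
  shows "has_bochner_integral lborel (\<lambda>s. indicator {0<..<t} s * ((t - s) powr (\<alpha> - 1) * s powr c))
    (t powr (c + \<alpha>) * (Gamma (c + 1) * Gamma \<alpha> / Gamma (c + \<alpha> + 1)))"
  using has_bochner_integral_Beta[of "c + 1" \<alpha> 0 t] assms
  by (simp add: Beta_def add_ac mult.commute[of "_ powr c"])

text \<open>\<open>S N\<close> is the N-th Picard iterate started from 0. The error f - S N
  satisfies the Volterra recursion without initial value, so each step integrates the previous bound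
  once more; at t = 1 what is left is M times a term of a convergent series.\<close>

lemma volterra_mittag_leffler:
  fixes f :: "real \<Rightarrow> complex"
  assumes \<alpha>: "0 < \<alpha>" and l: "0 \<le> l" and cont: "continuous_on {0..1} f"
    and volt: "\<And>t. 0 < t \<Longrightarrow> t \<le> 1 \<Longrightarrow>
      f t = f 0 - (l / Gamma \<alpha>) *\<^sub>R (LINT s:{0<..<t}|lborel. (t - s) powr (\<alpha> - 1) *\<^sub>R f s)"
  shows "f 1 = mittag_leffler \<alpha> (- l) *\<^sub>R f 0"
proof -
  obtain M where M: "\<And>s. s \<in> {0..1} \<Longrightarrow> norm (f s) \<le> M"
    using compact_imp_bounded[OF compact_continuous_image[OF cont compact_Icc]]
    unfolding bounded_iff by blast
  define c where "c k = 1 / Gamma (\<alpha> * real k + 1)" for k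
  have G: "Gamma (\<alpha> * real k + 1) > 0" for k
    using \<alpha> by (intro Gamma_real_pos add_nonneg_pos) auto
  have G\<alpha>: "Gamma \<alpha> > 0" using \<alpha> by (simp add: Gamma_real_pos)
  define J where "J t s = indicator {0<..<t} s * (t - s) powr (\<alpha> - 1)" for t s :: real
  have mono: "has_bochner_integral lborel (\<lambda>s. J t s * (c k * s powr (\<alpha> * k))) (Gamma \<alpha> * (c (Suc k) * t powr (\<alpha> * Suc k)))"
    if "0 < t" for t k
  proof -
    have "has_bochner_integral lborel (\<lambda>s. c k * (indicator {0<..<t} s * ((t - s) powr (\<alpha> - 1) * s powr (\<alpha> * k))))
      (c k * (t powr (\<alpha> * k + \<alpha>) * (Gamma (\<alpha> * k + 1) * Gamma \<alpha> / Gamma (\<alpha> * k + \<alpha> + 1))))"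
      using \<alpha> that by (intro has_bochner_integral_mult_right has_bochner_integral_fractional_monomial) auto
    moreover have "c k * (t powr (\<alpha> * k + \<alpha>) * (Gamma (\<alpha> * k + 1) * Gamma \<alpha> / Gamma (\<alpha> * k + \<alpha> + 1)))
      = Gamma \<alpha> * (c (Suc k) * t powr (\<alpha> * Suc k))"
      using G[of k] by (simp add: c_def algebra_simps)
    ultimately show ?thesis by (simp add: J_def mult_ac)
  qed
  \<comment> \<open>As 0 powr 0 = 0, this is the intended partial sum only for t > 0; these are the
    times that enter, since \<open>J t\<close> vanishes off the open interval.\<close>
  define S where "S N t = (\<Sum>k<N. ((- l) ^ k * (c k * t powr (\<alpha> * k))) *\<^sub>R f 0)" for N t
  have Jf: "integrable lborel (\<lambda>s. J t s *\<^sub>R f s)" if t: "0 < t" "t \<le> 1" for t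
  proof (rule Bochner_Integration.integrable_bound)
    \<comment> \<open>The factor c 0 * s powr 0 equals 1 on the interval; it is kept so that
      \<open>mono\<close> with k = 0 supplies the integrability.\<close>
    show "integrable lborel (\<lambda>s. M * (J t s * (c 0 * s powr (\<alpha> * real 0))))"
      using mono[OF t(1), of 0] by (intro integrable_mult_right) (auto simp: has_bochner_integral_iff)
    have "continuous_on {0<..<t} f" using cont by (rule continuous_on_subset) (use t in auto)
    then have [measurable]: "(\<lambda>s. indicator {0<..<t} s *\<^sub>R f s) \<in> borel_measurable borel"
      by (intro borel_measurable_continuous_on_indicator) auto
    have "(\<lambda>s. J t s *\<^sub>R f s) = (\<lambda>s. (t - s) powr (\<alpha> - 1) *\<^sub>R (indicator {0<..<t} s *\<^sub>R f s))"
      by (auto simp: J_def fun_eq_iff)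
    also have "\<dots> \<in> borel_measurable lborel" by measurable
    finally show "(\<lambda>s. J t s *\<^sub>R f s) \<in> borel_measurable lborel" .
    show "AE s in lborel. norm (J t s *\<^sub>R f s) \<le> norm (M * (J t s * (c 0 * s powr (\<alpha> * real 0))))"
    proof (rule AE_I2)
      fix s
      show "norm (J t s *\<^sub>R f s) \<le> norm (M * (J t s * (c 0 * s powr (\<alpha> * real 0))))"
      proof (cases "s \<in> {0<..<t}")
        case True
        then have "norm (f s) \<le> \<bar>M\<bar>" using M[of s] t by auto
        then show ?thesis using True by (simp add: J_def c_def abs_mult mult.commute[of "\<bar>M\<bar>"] mult_left_mono)
      qed (simp add: J_def)
    qed
  qed
  have JS: "has_bochner_integral lborel (\<lambda>s. J t s *\<^sub>R S N s)
      (\<Sum>k<N. ((- l) ^ k * (Gamma \<alpha> * (c (Suc k) * t powr (\<alpha> * Suc k)))) *\<^sub>R f 0)" if t: "0 < t" for t N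
  proof -
    have "has_bochner_integral lborel (\<lambda>s. \<Sum>k<N. ((- l) ^ k * (J t s * (c k * s powr (\<alpha> * k)))) *\<^sub>R f 0)
      (\<Sum>k<N. ((- l) ^ k * (Gamma \<alpha> * (c (Suc k) * t powr (\<alpha> * Suc k)))) *\<^sub>R f 0)"
      by (intro has_bochner_integral_sum has_bochner_integral_scaleR_left has_bochner_integral_mult_right mono t)
    moreover have "(\<Sum>k<N. ((- l) ^ k * (J t s * (c k * s powr (\<alpha> * k)))) *\<^sub>R f 0) = J t s *\<^sub>R S N s" for s
      unfolding S_def scaleR_sum_right scaleR_scaleR by (intro sum.cong refl) (simp add: mult_ac)
    ultimately show ?thesis by simp
  qed
  have main: "norm (f t - S N t) \<le> M * l ^ N * (c N * t powr (\<alpha> * N))" if "0 < t" "t \<le> 1" for t N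
    using that
  proof (induction N arbitrary: t)
    case 0
    then show ?case using M[of t] by (simp add: S_def c_def)
  next
    case (Suc N)
    note t = Suc.prems
    have "S (Suc N) t = f 0 + (\<Sum>k<N. ((- l) ^ Suc k * (c (Suc k) * t powr (\<alpha> * Suc k))) *\<^sub>R f 0)"
      unfolding S_def sum.lessThan_Suc_shift using t by (simp add: c_def)
    also have "(\<Sum>k<N. ((- l) ^ Suc k * (c (Suc k) * t powr (\<alpha> * Suc k))) *\<^sub>R f 0)
      = - (l / Gamma \<alpha>) *\<^sub>R (\<Sum>k<N. ((- l) ^ k * (Gamma \<alpha> * (c (Suc k) * t powr (\<alpha> * Suc k)))) *\<^sub>R f 0)"
      unfolding scaleR_sum_right scaleR_scaleR using G\<alpha> by (intro sum.cong refl) (simp add: field_simps)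
    also have "\<dots> = - (l / Gamma \<alpha>) *\<^sub>R (LINT s|lborel. J t s *\<^sub>R S N s)"
      using JS[OF t(1), of N] by (simp add: has_bochner_integral_iff)
    finally have S_Suc: "S (Suc N) t = f 0 - (l / Gamma \<alpha>) *\<^sub>R (LINT s|lborel. J t s *\<^sub>R S N s)" by simp
    have "f t = f 0 - (l / Gamma \<alpha>) *\<^sub>R (LINT s|lborel. J t s *\<^sub>R f s)"
      using volt[OF t] by (simp add: set_lebesgue_integral_def J_def)
    then have "f t - S (Suc N) t = (l / Gamma \<alpha>) *\<^sub>R ((LINT s|lborel. J t s *\<^sub>R S N s) - (LINT s|lborel. J t s *\<^sub>R f s))"
      using S_Suc by (simp add: scaleR_diff_right)
    also have "\<dots> = (l / Gamma \<alpha>) *\<^sub>R (LINT s|lborel. J t s *\<^sub>R S N s - J t s *\<^sub>R f s)"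
      using JS[OF t(1), of N] Jf[OF t] by (simp add: has_bochner_integral_iff)
    finally have "norm (f t - S (Suc N) t) = (l / Gamma \<alpha>) * norm (LINT s|lborel. J t s *\<^sub>R S N s - J t s *\<^sub>R f s)"
      using l G\<alpha> by simp
    also have "\<dots> \<le> (l / Gamma \<alpha>) * (LINT s|lborel. (M * l ^ N) * (J t s * (c N * s powr (\<alpha> * N))))"
    proof (intro mult_left_mono Bochner_Integration.integral_norm_bound_integral)
      show "integrable lborel (\<lambda>s. J t s *\<^sub>R S N s - J t s *\<^sub>R f s)"
        using JS[OF t(1), of N] Jf[OF t] by (simp add: has_bochner_integral_iff)
      show "integrable lborel (\<lambda>s. (M * l ^ N) * (J t s * (c N * s powr (\<alpha> * N))))"
        using mono[OF t(1), of N] by (intro integrable_mult_right) (auto simp: has_bochner_integral_iff)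
      fix s
      show "norm (J t s *\<^sub>R S N s - J t s *\<^sub>R f s) \<le> (M * l ^ N) * (J t s * (c N * s powr (\<alpha> * N)))"
      proof (cases "s \<in> {0<..<t}")
        case True
        have "norm (J t s *\<^sub>R S N s - J t s *\<^sub>R f s) = J t s * norm (f s - S N s)"
          by (simp add: J_def norm_minus_commute flip: scaleR_diff_right)
        also have "\<dots> \<le> J t s * (M * l ^ N * (c N * s powr (\<alpha> * N)))"
          using Suc.IH[of s] True t by (intro mult_left_mono) (auto simp: J_def)
        finally show ?thesis by (simp add: mult_ac)
      qed (simp add: J_def)
    qed (use l G\<alpha> in auto)
    also have "\<dots> = (l / Gamma \<alpha>) * ((M * l ^ N) * (Gamma \<alpha> * (c (Suc N) * t powr (\<alpha> * Suc N))))"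
      using mono[OF t(1), of N] by (simp add: has_bochner_integral_iff)
    also have "\<dots> = M * l ^ Suc N * (c (Suc N) * t powr (\<alpha> * Suc N))"
      using G\<alpha> by simp
    finally show ?case .
  qed
  have S1: "S N 1 = (\<Sum>k<N. (- l) ^ k / Gamma (\<alpha> * real k + 1)) *\<^sub>R f 0" for N
    by (simp add: S_def c_def scaleR_sum_left)
  have "(\<lambda>N. S N 1) \<longlonglongrightarrow> mittag_leffler \<alpha> (- l) *\<^sub>R f 0"
    unfolding S1 using mittag_leffler_sums[OF \<alpha> l] by (intro tendsto_scaleR tendsto_const) (simp add: sums_def)
  moreover have "(\<lambda>N. S N 1) \<longlonglongrightarrow> f 1"
  proof (rule LIM_zero_cancel, rule Lim_null_comparison)
    show "(\<lambda>N. M * (l ^ N / Gamma (\<alpha> * real N + 1))) \<longlonglongrightarrow> 0"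
      by (rule tendsto_mult_right_zero[OF summable_LIMSEQ_zero[OF mittag_leffler_summable[OF \<alpha> l]]])
    show "\<forall>\<^sub>F N in sequentially. norm (S N 1 - f 1) \<le> M * (l ^ N / Gamma (\<alpha> * real N + 1))"
      using main[of 1] by (simp add: norm_minus_commute c_def)
  qed
  ultimately show ?thesis by (rule LIMSEQ_unique[symmetric])
qed

subsection \<open>Square roots of positive definite matrices\<close>

lemma transpose_eq_iff_self_adjoint:
  fixes A :: "real ^ 'k ^ 'k::finite"
  shows "transpose A = A \<longleftrightarrow> (\<forall>x y. x \<bullet> (A *v y) = (A *v x) \<bullet> y)"
proof
  assume "transpose A = A"
  then show "\<forall>x y. x \<bullet> (A *v y) = (A *v x) \<bullet> y"
    by (metis dot_lmul_matrix transpose_matrix_vector)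
next
  assume *: "\<forall>x y. x \<bullet> (A *v y) = (A *v x) \<bullet> y"
  have "transpose A *v x = A *v x" for x
  proof (rule vector_eq_rdot[THEN iffD1], rule allI)
    fix y show "(transpose A *v x) \<bullet> y = (A *v x) \<bullet> y"
      unfolding transpose_matrix_vector dot_lmul_matrix using * by simp
  qed
  then show "transpose A = A" by (simp add: matrix_eq)
qed

lemma pos_def_matrixD:
  assumes "pos_def_matrix A"
  shows "x \<bullet> (A *v y) = (A *v x) \<bullet> y" "x \<noteq> 0 \<Longrightarrow> 0 < x \<bullet> (A *v x)"
  using assms by (auto simp: pos_def_matrix_def transpose_eq_iff_self_adjoint)

text \<open>The quadratic form attains a positive minimum on the compact unit sphere; homogeneity
  does the rest.\<close>

lemma pos_def_matrix_coercive:
  assumes "pos_def_matrix A"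
  obtains a where "a > 0" "\<And>x. a * (norm x)\<^sup>2 \<le> x \<bullet> (A *v x)"
proof -
  have "continuous_on (sphere 0 1) (\<lambda>x. x \<bullet> (A *v x))"
    by (intro continuous_intros linear_continuous_on matrix_vector_mul_bounded_linear)
  moreover have "sphere (0 :: real ^ 'a) 1 \<noteq> {}"
    by simp
  ultimately obtain z where z: "z \<in> sphere 0 1" "\<And>x. x \<in> sphere 0 1 \<Longrightarrow> z \<bullet> (A *v z) \<le> x \<bullet> (A *v x)"
    using continuous_attains_inf[OF compact_sphere] by meson
  have "z \<bullet> (A *v z) * (norm x)\<^sup>2 \<le> x \<bullet> (A *v x)" for x
  proof (cases "x = 0")
    case False
    have "z \<bullet> (A *v z) \<le> (x /\<^sub>R norm x) \<bullet> (A *v (x /\<^sub>R norm x))"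
      using False by (intro z) simp
    also have "\<dots> = (x \<bullet> (A *v x)) / (norm x)\<^sup>2"
      by (simp add: linear_cmul[OF matrix_vector_mul_linear] power2_eq_square divide_inverse)
    finally show ?thesis using False by (simp add: pos_le_divide_eq)
  qed simp
  moreover have "0 < z \<bullet> (A *v z)" using z by (intro pos_def_matrixD[OF assms]) auto
  ultimately show ?thesis using that by blast
qed

text \<open>After rescaling, \<open>A = I - B\<close> with \<open>\<parallel>B\<parallel> < 1\<close>, and a fixed point \<open>C\<close> of the contraction
  \<open>C \<mapsto> (B + C\<^sup>2) / 2\<close> satisfies \<open>(I - C)\<^sup>2 = I - B\<close>.\<close>

lemma pos_def_sqrt_exists:
  fixes A :: "real ^ 'k ^ 'k::finite"
  assumes A: "pos_def_matrix A"
  shows "\<exists>R. pos_def_matrix R \<and> R ** R = A"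
proof -
  obtain a where a: "a > 0" "\<And>x. a * (norm x)\<^sup>2 \<le> x \<bullet> (A *v x)"
    using pos_def_matrix_coercive[OF A] by blast
  obtain b where b: "b > 0" "\<And>x. norm (A *v x) \<le> norm x * b"
    using bounded_linear.pos_bounded[OF matrix_vector_mul_bounded_linear[of A]] by blast
  \<comment> \<open>This value minimises 1 - 2 a c + b^2 c^2, the bound for the squared norm of I -
    c A; the minimum 1 - a^2 / b^2 becomes \<rho>^2.\<close>
  define c where "c = a / b\<^sup>2"
  have c: "c > 0" using a b by (simp add: c_def)
  obtain e :: "real ^ 'k" where e: "norm e = 1" using vector_choose_size[of 1] by auto
  have "a \<le> e \<bullet> (A *v e)" using a(2)[of e] e by simp
  also have "\<dots> \<le> b" using norm_cauchy_schwarz[of e "A *v e"] b(2)[of e] e by simp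
  finally have "a \<le> b" .
  define \<rho> where "\<rho> = sqrt (1 - a\<^sup>2 / b\<^sup>2)"
  have ab: "0 < a\<^sup>2 / b\<^sup>2" "a\<^sup>2 / b\<^sup>2 \<le> 1"
    using \<open>a \<le> b\<close> a b by (auto simp: power_mono)
  then have \<rho>: "0 \<le> \<rho>" "\<rho> < 1" "\<rho>\<^sup>2 = 1 - a\<^sup>2 / b\<^sup>2"
    by (auto simp: \<rho>_def)
  have bl: "bounded_linear (\<lambda>x. x - c *\<^sub>R (A *v x))"
    by (intro bounded_linear_sub bounded_linear_ident bounded_linear_scaleR_right[THEN bounded_linear_compose]
        matrix_vector_mul_bounded_linear)
  define B where "B = Blinfun (\<lambda>x. x - c *\<^sub>R (A *v x))"
  have B: "blinfun_apply B x = x - c *\<^sub>R (A *v x)" for x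
    unfolding B_def bounded_linear_Blinfun_apply[OF bl] ..
  have "norm (blinfun_apply B x) \<le> \<rho> * norm x" for x
  proof (rule power2_le_imp_le)
    have "(norm (blinfun_apply B x))\<^sup>2 = (norm x)\<^sup>2 - 2 * c * (x \<bullet> (A *v x)) + c\<^sup>2 * (norm (A *v x))\<^sup>2"
      using dot_norm_neg[of x "c *\<^sub>R (A *v x)"] by (simp add: B power_mult_distrib)
    also have "\<dots> \<le> (norm x)\<^sup>2 - 2 * c * (a * (norm x)\<^sup>2) + c\<^sup>2 * (norm x * b)\<^sup>2"
      using a(2)[of x] b(2)[of x] c by (intro add_mono diff_mono mult_left_mono power_mono) auto
    also have "\<dots> = (\<rho> * norm x)\<^sup>2"
      using b unfolding power_mult_distrib \<rho>(3) by (simp add: c_def field_simps power2_eq_square)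
    finally show "(norm (blinfun_apply B x))\<^sup>2 \<le> (\<rho> * norm x)\<^sup>2" .
  qed (use \<rho> in simp)
  then have normB: "norm B \<le> \<rho>" using \<rho> by (intro norm_blinfun_bound) auto
  \<comment> \<open>Self-adjointness is a closed condition preserved by \<open>f\<close>, so it is
    built into the complete set and passes to the fixed point. On \<open>K\<close> the map has
    Lipschitz constant \<rho>, because C^2 - D^2 = C (C - D) + (C - D) D.\<close>
  define K where "K = {C :: (real ^ 'k) \<Rightarrow>\<^sub>L (real ^ 'k). norm C \<le> \<rho> \<and>
      (\<forall>x y. x \<bullet> blinfun_apply C y = blinfun_apply C x \<bullet> y)}"
  have BK: "B \<in> K"
    unfolding K_def using normB pos_def_matrixD(1)[OF A]
    by (auto simp: B inner_diff_left inner_diff_right)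
  define f where "f C = (1/2) *\<^sub>R (B + (C o\<^sub>L C))" for C
  have "closed K"
    unfolding K_def
    by (intro closed_Collect_conj closed_Collect_all closed_Collect_le closed_Collect_eq continuous_intros)
  note complete_K = complete_eq_closed[THEN iffD2, OF this]
  have "\<exists>!C\<in>K. f C = C"
  proof (rule Banach_fix[OF complete_K _ \<rho>(1,2)])
    show "K \<noteq> {}" using BK by auto
    show "f ` K \<subseteq> K"
    proof safe
      fix C assume C: "C \<in> K"
      then have "norm (C o\<^sub>L C) \<le> \<rho> * \<rho>"
        using order_trans[OF norm_blinfun_compose mult_mono[of "norm C" \<rho> "norm C" \<rho>]] \<rho>
        unfolding K_def by auto
      also have "\<dots> \<le> \<rho>" using \<rho> by (simp add: mult_left_le)
      finally have "norm (B + (C o\<^sub>L C)) \<le> \<rho> + \<rho>"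
        using normB by (intro norm_triangle_mono)
      then have "norm (f C) \<le> \<rho>" by (simp add: f_def)
      moreover have "x \<bullet> blinfun_apply (f C) y = blinfun_apply (f C) x \<bullet> y" for x y
        using BK C unfolding K_def f_def
        by (simp add: blinfun.add_left blinfun.scaleR_left inner_add_left inner_add_right)
      ultimately show "f C \<in> K" unfolding K_def by auto
    qed
    show "dist (f C) (f D) \<le> \<rho> * dist C D" if "C \<in> K" "D \<in> K" for C D
    proof -
      have "f C - f D = (1/2) *\<^sub>R ((C o\<^sub>L (C - D)) + ((C - D) o\<^sub>L D))"
        by (simp add: f_def bounded_bilinear.diff_left[OF bounded_bilinear_blinfun_compose]
            bounded_bilinear.diff_right[OF bounded_bilinear_blinfun_compose]
            flip: scaleR_diff_right)
      also have "norm \<dots> \<le> (1/2) * (\<rho> * norm (C - D) + norm (C - D) * \<rho>)"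
      proof -
        have "norm (C o\<^sub>L (C - D)) \<le> \<rho> * norm (C - D)"
          using norm_blinfun_compose[of C "C - D"] that(1)
          by (auto simp: K_def intro: order_trans[OF _ mult_right_mono])
        moreover have "norm ((C - D) o\<^sub>L D) \<le> norm (C - D) * \<rho>"
          using norm_blinfun_compose[of "C - D" D] that(2)
          by (auto simp: K_def intro: order_trans[OF _ mult_left_mono])
        ultimately have "norm ((C o\<^sub>L (C - D)) + ((C - D) o\<^sub>L D)) \<le> \<rho> * norm (C - D) + norm (C - D) * \<rho>"
          by (intro norm_triangle_mono)
        then show ?thesis by simp
      qed
      finally show ?thesis by (simp add: dist_norm)
    qed
  qed
  then obtain C where C: "C \<in> K" "f C = C" by blast
  have sq: "B = 2 *\<^sub>R C - (C o\<^sub>L C)"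
    using arg_cong[OF C(2), of "\<lambda>C. 2 *\<^sub>R C"] by (simp add: f_def algebra_simps)
  have sq': "blinfun_apply C (blinfun_apply C x) = 2 *\<^sub>R blinfun_apply C x - (x - c *\<^sub>R (A *v x))" for x
    using arg_cong[OF sq, of "\<lambda>D. blinfun_apply D x"]
    by (simp add: B blinfun.diff_left blinfun.scaleR_left algebra_simps)
  \<comment> \<open>From c A = I - B = (I - C)^2. Positivity of I - C follows from norm C \<le>
    \<rho> < 1.\<close>
  define R where "R = matrix (\<lambda>x. (x - blinfun_apply C x) /\<^sub>R sqrt c)"
  have R: "R *v x = (x - blinfun_apply C x) /\<^sub>R sqrt c" for x
  proof -
    have "bounded_linear (\<lambda>x. (x - blinfun_apply C x) /\<^sub>R sqrt c)"
      by (intro bounded_linear_const_scaleR bounded_linear_sub bounded_linear_ident blinfun.bounded_linear_right)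
    from fun_cong[OF matrix_vector_mul(3)[OF this], of x] show ?thesis unfolding R_def .
  qed
  have "pos_def_matrix R"
    unfolding pos_def_matrix_def transpose_eq_iff_self_adjoint
  proof (intro conjI allI impI)
    fix x y
    show "x \<bullet> (R *v y) = (R *v x) \<bullet> y"
      using C(1) by (simp add: R K_def inner_diff_left inner_diff_right)
  next
    fix x :: "real ^ 'k" assume x: "x \<noteq> 0"
    have "x \<bullet> blinfun_apply C x \<le> norm x * (norm C * norm x)"
      using norm_cauchy_schwarz[of x "blinfun_apply C x"] norm_blinfun[of C x]
      by (meson mult_left_mono norm_ge_zero order_trans)
    also have "\<dots> \<le> norm x * (\<rho> * norm x)"
      using C(1) by (intro mult_left_mono mult_right_mono) (auto simp: K_def)
    also have "\<dots> < norm x * norm x"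
      using x \<rho> by simp
    finally show "0 < x \<bullet> (R *v x)"
      using c by (simp add: R inner_diff_right dot_square_norm power2_eq_square)
  qed
  moreover have "R ** R = A"
  proof (subst matrix_eq, rule allI)
    fix x
    have "(R ** R) *v x = (x - 2 *\<^sub>R blinfun_apply C x + blinfun_apply C (blinfun_apply C x)) /\<^sub>R (sqrt c * sqrt c)"
    proof -
      have "(R ** R) *v x = ((x - blinfun_apply C x) /\<^sub>R sqrt c - blinfun_apply C ((x - blinfun_apply C x) /\<^sub>R sqrt c)) /\<^sub>R sqrt c"
        by (simp add: R flip: matrix_vector_mul_assoc)
      also have "\<dots> = ((x - blinfun_apply C x) - blinfun_apply C (x - blinfun_apply C x)) /\<^sub>R (sqrt c * sqrt c)"
        unfolding blinfun.scaleR_right by (simp only: scaleR_diff_right[symmetric] scaleR_scaleR inverse_mult_distrib)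
      finally show ?thesis by (simp add: blinfun.diff_right scaleR_2)
    qed
    also have "\<dots> = A *v x"
      unfolding sq' using c by simp
    finally show "(R ** R) *v x = A *v x" .
  qed
  ultimately show ?thesis by blast
qed

text \<open>Turns the trace into values of the quadratic form of P, so that for positive definite P
  a vanishing trace forces the columns of D to vanish.\<close>

lemma trace_self_adjoint_congruence:
  fixes D P :: "real ^ 'k ^ 'k::finite"
  assumes "transpose D = D"
  shows "trace (D ** P ** D) = (\<Sum>i\<in>UNIV. column i D \<bullet> (P *v column i D))"
  unfolding trace_def
proof (rule sum.cong[OF refl])
  fix i
  have r: "D $ i = column i D"
    using assms by (metis column_transpose row_def vec_lambda_eta)
  have "(D ** P ** D) $ i $ i = (D ** (P ** D)) $ i $ i" by (simp add: matrix_mul_assoc)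
  also have "\<dots> = D $ i \<bullet> column i (P ** D)"
    by (simp add: matrix_matrix_mult_def inner_vec_def column_def)
  also have "column i (P ** D) = P *v column i D"
    by (simp add: matrix_matrix_mult_def matrix_vector_mult_def column_def vec_eq_iff)
  finally show "(D ** P ** D) $ i $ i = column i D \<bullet> (P *v column i D)" unfolding r .
qed

text \<open>With D = P - Q the hypothesis reads P D + D Q = 0. Multiplying by D and taking traces
  gives tr(D P D) + tr(D Q D) = 0, where both terms are nonnegative.\<close>

lemma pos_def_sqrt_unique:
  fixes P Q :: "real ^ 'k ^ 'k::finite"
  assumes P: "pos_def_matrix P" and Q: "pos_def_matrix Q" and eq: "P ** P = Q ** Q"
  shows "P = Q"
proof -
  define D where "D = P - Q"
  have tD: "transpose D = D"
    using pos_def_matrixD(1)[OF P] pos_def_matrixD(1)[OF Q] unfolding D_def transpose_eq_iff_self_adjoint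
    by (simp add: matrix_vector_mult_diff_rdistrib inner_diff_left inner_diff_right)
  have "P ** D + D ** Q = 0"
  proof (subst matrix_eq, rule allI)
    fix x
    have "(P ** D + D ** Q) *v x = (P ** P) *v x - (Q ** Q) *v x"
      by (simp add: D_def matrix_vector_mult_add_rdistrib matrix_vector_mult_diff_rdistrib
          matrix_vector_mult_diff_distrib flip: matrix_vector_mul_assoc)
    then show "(P ** D + D ** Q) *v x = 0 *v x" by (simp add: eq)
  qed
  then have "D ** (P ** D + D ** Q) = 0" by simp
  then have "D ** P ** D + D ** (D ** Q) = 0" by (simp add: matrix_add_ldistrib matrix_mul_assoc)
  then have "trace (D ** P ** D) + trace (D ** (D ** Q)) = 0"
    by (metis trace_0 trace_add mat_0)
  moreover have "trace (D ** (D ** Q)) = trace (D ** Q ** D)" by (rule trace_mul_sym)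
  moreover have nn: "0 \<le> x \<bullet> (N *v x)" if "pos_def_matrix N" for N :: "real ^ 'k ^ 'k" and x
    using pos_def_matrixD(2)[OF that, of x] by (cases "x = 0") auto
  ultimately have "(\<Sum>i\<in>UNIV. column i D \<bullet> (P *v column i D)) \<le> 0"
    using sum_nonneg[of UNIV "\<lambda>i. column i D \<bullet> (Q *v column i D)"] nn[OF Q]
    unfolding trace_self_adjoint_congruence[OF tD] by auto
  then have "(\<Sum>i\<in>UNIV. column i D \<bullet> (P *v column i D)) = 0"
    using sum_nonneg[of UNIV "\<lambda>i. column i D \<bullet> (P *v column i D)"] nn[OF P] by force
  then have "column i D \<bullet> (P *v column i D) = 0" for i
    using nn[OF P] by (subst (asm) sum_nonneg_eq_0_iff) auto
  then have "column i D = 0" for i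
    using pos_def_matrixD(2)[OF P, of "column i D"] by force
  then have "D = 0" by (simp add: column_def vec_eq_iff)
  then show ?thesis by (simp add: D_def)
qed

lemma pos_def_matrix_inv:
  assumes S: "pos_def_matrix S"
  shows "pos_def_matrix (matrix_inv S)"
proof -
  have "invertible S"
    unfolding invertible_left_inverse matrix_left_invertible_ker
    using pos_def_matrixD(2)[OF S] by (metis inner_zero_right less_irrefl)
  then have "\<exists>S'. S ** S' = mat 1 \<and> S' ** S = mat 1"
    unfolding invertible_def by blast
  then have "S ** matrix_inv S = mat 1"
    unfolding matrix_inv_def by (rule someI2_ex) simp
  then have i: "S *v (matrix_inv S *v x) = x" for x
    by (simp add: matrix_vector_mul_assoc)
  show ?thesis
    unfolding pos_def_matrix_def transpose_eq_iff_self_adjoint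
  proof (intro conjI allI impI)
    fix x y show "x \<bullet> (matrix_inv S *v y) = (matrix_inv S *v x) \<bullet> y"
      by (metis i pos_def_matrixD(1)[OF S])
  next
    fix x :: "real ^ 'a" assume "x \<noteq> 0"
    then have "matrix_inv S *v x \<noteq> 0" using i[of x] by (metis matrix_vector_mult_0_right)
    from pos_def_matrixD(2)[OF S this] show "0 < x \<bullet> (matrix_inv S *v x)"
      by (simp add: i inner_commute)
  qed
qed

text \<open>Existence and uniqueness of the root together give meaning to the definite description
  in \<open>matrix_inv_sqrt\<close>.\<close>

lemma matrix_inv_sqrt:
  assumes "pos_def_matrix S"
  shows "pos_def_matrix (matrix_inv_sqrt S)" "matrix_inv_sqrt S ** matrix_inv_sqrt S = matrix_inv S"
proof -
  have "\<exists>!R. pos_def_matrix R \<and> R ** R = matrix_inv S"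
    using pos_def_sqrt_exists[OF pos_def_matrix_inv[OF assms]] pos_def_sqrt_unique by metis
  from theI'[OF this] show "pos_def_matrix (matrix_inv_sqrt S)"
    "matrix_inv_sqrt S ** matrix_inv_sqrt S = matrix_inv S"
    unfolding matrix_inv_sqrt_def by auto
qed

lemma matrix_inv_sqrt_quadratic_form:
  assumes "pos_def_matrix S"
  shows "x \<bullet> (matrix_inv S *v x) = (norm (matrix_inv_sqrt S *v x))\<^sup>2"
  unfolding matrix_inv_sqrt(2)[OF assms, symmetric] power2_norm_eq_inner
  using pos_def_matrixD(1)[OF matrix_inv_sqrt(1)[OF assms]]
  by (simp flip: matrix_vector_mul_assoc)

subsection \<open>Trigonometric polynomials in the space of square-integrable functions\<close>

abbreviation unit_cell :: "(real ^ 'n::finite) set" where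
  "unit_cell \<equiv> {x. \<forall>i. 0 \<le> x $ i \<and> x $ i < 1}"

lemma unit_cell_borel [measurable]: "(unit_cell :: (real ^ 'n::finite) set) \<in> sets borel"
proof -
  have "unit_cell = (\<Inter>i. {x :: real ^ 'n. 0 \<le> x $ i} \<inter> {x. x $ i < 1})" by auto
  also have "\<dots> \<in> sets borel"
    by (intro sets.finite_INT sets.Int borel_closed borel_open closed_Collect_le open_Collect_less
        continuous_intros) auto
  finally show ?thesis .
qed

lemma space_torus_measure [simp]: "space torus_measure = unit_cell"
  by (simp add: torus_measure_def space_restrict_space)

lemma sets_torus_measure: "sets torus_measure = {A \<inter> unit_cell |A. A \<in> sets borel}"
  unfolding torus_measure_def sets_restrict_space by auto

lemma borel_measurable_torus [measurable (raw)]: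
  "f \<in> borel_measurable borel \<Longrightarrow> f \<in> borel_measurable torus_measure"
  unfolding torus_measure_def by (intro measurable_restrict_space1) simp

lemma emeasure_torus_measure: "emeasure torus_measure (unit_cell :: (real ^ 'n::finite) set) = 1"
proof -
  have 1: "emeasure lborel (unit_cell :: (real ^ 'n) set) \<le> emeasure lborel (cbox 0 1 :: (real ^ 'n) set)"
    by (intro emeasure_mono) (auto simp: mem_box_cart less_imp_le)
  have 2: "emeasure lborel (box 0 1 :: (real ^ 'n) set) \<le> emeasure lborel (unit_cell :: (real ^ 'n) set)"
    by (intro emeasure_mono) (auto simp: mem_box_cart less_imp_le)
  have "(1 :: real ^ 'n) \<bullet> b = 1" "(0 :: real ^ 'n) \<bullet> b \<le> 1 \<bullet> b" if "b \<in> Basis" for b :: "real ^ 'n"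
    using that by (auto simp: Basis_vec_def inner_axis)
  then have 3: "emeasure lborel (cbox 0 1 :: (real ^ 'n) set) = 1" "emeasure lborel (box 0 1 :: (real ^ 'n) set) = 1"
    by (subst emeasure_lborel_cbox emeasure_lborel_box; simp)+
  have "emeasure lborel (unit_cell :: (real ^ 'n) set) = 1"
    using 1 2 unfolding 3 by (rule antisym)
  then show ?thesis
    unfolding torus_measure_def by (subst emeasure_restrict_space) auto
qed

interpretation torus: prob_space "torus_measure :: (real ^ 'n::finite) measure"
  by standard (simp add: emeasure_torus_measure)

lemma torus_L2_bounded:
  assumes "f \<in> borel_measurable torus_measure" "\<And>x. x \<in> unit_cell \<Longrightarrow> \<bar>f x\<bar> \<le> c"
  shows "torus_L2_rel f f"
proof -
  have "integrable torus_measure (\<lambda>x. (f x)\<^sup>2)"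
  proof (rule torus.integrable_const_bound[of _ "c\<^sup>2"])
    show "AE x in torus_measure. norm ((f x)\<^sup>2) \<le> c\<^sup>2"
      using power_mono[OF assms(2) abs_ge_zero, of _ 2] by (intro AE_I2) simp
    show "(\<lambda>x. (f x)\<^sup>2) \<in> borel_measurable torus_measure" using assms(1) by (rule borel_measurable_power)
  qed
  then show ?thesis using assms(1) by (simp add: torus_L2_rel_def)
qed

lemma torus_L2_rel_cell:
  assumes "torus_L2_rel f f" "\<And>x. x \<in> unit_cell \<Longrightarrow> f x = g x"
  shows "torus_L2_rel f g"
proof -
  have "g \<in> borel_measurable torus_measure"
    using assms measurable_cong[of torus_measure f g borel] by (simp add: torus_L2_rel_def)
  moreover have "integrable torus_measure (\<lambda>x. (g x)\<^sup>2)"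
    using assms Bochner_Integration.integrable_cong[of torus_measure torus_measure "\<lambda>x. (f x)\<^sup>2" "\<lambda>x. (g x)\<^sup>2"]
    by (simp add: torus_L2_rel_def)
  ultimately show ?thesis using assms by (auto simp: torus_L2_rel_def)
qed

lemma abs_torus_L2_cong_cell:
  assumes "torus_L2_rel f f" "\<And>x. x \<in> unit_cell \<Longrightarrow> f x = g x"
  shows "torus_L2_rel g g" "abs_torus_L2 f = abs_torus_L2 g"
proof -
  have r: "torus_L2_rel f g" by (rule torus_L2_rel_cell[OF assms])
  then show "torus_L2_rel g g" by (auto simp: torus_L2_rel_def)
  show "abs_torus_L2 f = abs_torus_L2 g"
    using r Quotient_rel[OF Quotient_torus_L2, of f g] by simp
qed

lemma torus_L2_cases:
  obtains f where "torus_L2_rel f f" "u = abs_torus_L2 f"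
proof -
  have "\<exists>f. torus_L2_rel f f \<and> u = abs_torus_L2 f"
    by (rule exI[of _ "rep_torus_L2 u"])
      (simp add: Quotient_abs_rep[OF Quotient_torus_L2] Quotient_rep_reflp[OF Quotient_torus_L2])
  then show ?thesis using that by blast
qed

lemma torus_L2_rel_add:
  "torus_L2_rel f f \<Longrightarrow> torus_L2_rel g g \<Longrightarrow> torus_L2_rel (\<lambda>x. f x + g x) (\<lambda>x. f x + g x)"
  unfolding torus_L2_rel_def by (auto intro!: torus_L2_add_integrable)

lemma torus_L2_rel_scale: "torus_L2_rel f f \<Longrightarrow> torus_L2_rel (\<lambda>x. c * f x) (\<lambda>x. c * f x)"
  unfolding torus_L2_rel_def by (auto simp: power_mult_distrib)

lemma torus_L2_rel_diff:
  "torus_L2_rel f f \<Longrightarrow> torus_L2_rel g g \<Longrightarrow> torus_L2_rel (\<lambda>x. f x - g x) (\<lambda>x. f x - g x)"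
  using torus_L2_rel_add[OF _ torus_L2_rel_scale[of g "-1"], of f] by simp

lemma abs_torus_L2_add:
  "torus_L2_rel f f \<Longrightarrow> torus_L2_rel g g \<Longrightarrow>
   abs_torus_L2 (\<lambda>x. f x + g x) = abs_torus_L2 f + abs_torus_L2 g"
  by (simp add: plus_torus_L2.abs_eq)

lemma abs_torus_L2_scale:
  "torus_L2_rel f f \<Longrightarrow> abs_torus_L2 (\<lambda>x. c * f x) = c *\<^sub>R abs_torus_L2 f"
  by (simp add: scaleR_torus_L2.abs_eq)

lemma abs_torus_L2_diff:
  assumes "torus_L2_rel f f" "torus_L2_rel g g"
  shows "abs_torus_L2 (\<lambda>x. f x - g x) = abs_torus_L2 f - abs_torus_L2 g"
  using abs_torus_L2_add[OF assms(1) torus_L2_rel_scale[OF assms(2)], of "-1"]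
    abs_torus_L2_scale[OF assms(2), of "-1"] by simp

lemma inner_abs_torus_L2:
  "torus_L2_rel f f \<Longrightarrow> torus_L2_rel g g \<Longrightarrow>
   abs_torus_L2 f \<bullet> abs_torus_L2 g = (LINT x|torus_measure. f x * g x)"
  by (simp add: inner_torus_L2.abs_eq)

lemma norm_abs_torus_L2:
  "torus_L2_rel f f \<Longrightarrow> norm (abs_torus_L2 f) = sqrt (LINT x|torus_measure. (f x)\<^sup>2)"
  by (simp add: norm_torus_L2_def inner_abs_torus_L2 power2_eq_square)

text \<open>Domination is by a square-integrable function: the squared error is at most 4 w^2, which
  is integrable.\<close>

lemma torus_L2_dominated_convergence:
  assumes f: "\<And>n. torus_L2_rel (f n) (f n)" and g: "torus_L2_rel g g" and w: "torus_L2_rel w w"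
    and lim: "\<And>x. x \<in> unit_cell \<Longrightarrow> (\<lambda>n. f n x) \<longlonglongrightarrow> g x"
    and bound: "\<And>n x. x \<in> unit_cell \<Longrightarrow> \<bar>f n x\<bar> \<le> w x"
  shows "(\<lambda>n. abs_torus_L2 (f n)) \<longlonglongrightarrow> abs_torus_L2 g"
proof -
  have m: "f n \<in> borel_measurable torus_measure" "g \<in> borel_measurable torus_measure"
    "w \<in> borel_measurable torus_measure" for n
    using f g w by (auto simp: torus_L2_rel_def)
  have g_le: "\<bar>g x\<bar> \<le> w x" if "x \<in> unit_cell" for x
    by (rule LIMSEQ_le_const2[OF tendsto_rabs[OF lim[OF that]]], intro exI allI impI, rule bound[OF that])
  have "(\<lambda>n. LINT x|torus_measure. (f n x - g x)\<^sup>2) \<longlonglongrightarrow> (LINT x|(torus_measure :: (real ^ 'a) measure). 0)"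
  proof (rule integral_dominated_convergence)
    show "(\<lambda>x. 0) \<in> borel_measurable torus_measure" by simp
    show "(\<lambda>x. (f n x - g x)\<^sup>2) \<in> borel_measurable torus_measure" for n using m by measurable
    show "integrable torus_measure (\<lambda>x. 4 * (w x)\<^sup>2)" using w by (simp add: torus_L2_rel_def)
    show "AE x in torus_measure. (\<lambda>n. (f n x - g x)\<^sup>2) \<longlonglongrightarrow> 0"
    proof (rule AE_I2)
      fix x :: "real ^ 'a" assume "x \<in> space torus_measure"
      then have "(\<lambda>n. f n x) \<longlonglongrightarrow> g x" using lim by simp
      then have "(\<lambda>n. (f n x - g x)\<^sup>2) \<longlonglongrightarrow> (g x - g x)\<^sup>2" by (intro tendsto_intros)
      then show "(\<lambda>n. (f n x - g x)\<^sup>2) \<longlonglongrightarrow> 0" by simp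
    qed
    fix n
    show "AE x in torus_measure. norm ((f n x - g x)\<^sup>2) \<le> 4 * (w x)\<^sup>2"
    proof (rule AE_I2)
      fix x :: "real ^ 'a" assume "x \<in> space torus_measure"
      then have x: "x \<in> unit_cell" by simp
      have "\<bar>f n x - g x\<bar> \<le> 2 * w x" using bound[OF x, of n] g_le[OF x] by linarith
      from power_mono[OF this abs_ge_zero, of 2] show "norm ((f n x - g x)\<^sup>2) \<le> 4 * (w x)\<^sup>2"
        by (simp add: power_mult_distrib)
    qed
  qed
  then have "(\<lambda>n. sqrt (LINT x|torus_measure. (f n x - g x)\<^sup>2)) \<longlonglongrightarrow> sqrt 0"
    by (intro tendsto_real_sqrt) simp
  moreover have "norm (abs_torus_L2 (f n) - abs_torus_L2 g) = sqrt (LINT x|torus_measure. (f n x - g x)\<^sup>2)" for n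
    by (simp add: abs_torus_L2_diff[OF f g, symmetric] norm_abs_torus_L2 torus_L2_rel_diff f g)
  ultimately have "(\<lambda>n. norm (abs_torus_L2 (f n) - abs_torus_L2 g)) \<longlonglongrightarrow> 0" by simp
  then show ?thesis by (rule LIM_zero_cancel[OF tendsto_norm_zero_cancel])
qed

text \<open>Sines and cosines take the place of the complex characters because the space consists of
  real functions.\<close>

inductive trig_poly :: "(real ^ 'n::finite \<Rightarrow> real) \<Rightarrow> bool" where
  cos: "trig_poly (\<lambda>x. cos (2 * pi * (int_vec k \<bullet> x)))"
| sin: "trig_poly (\<lambda>x. sin (2 * pi * (int_vec k \<bullet> x)))"
| add: "trig_poly f \<Longrightarrow> trig_poly g \<Longrightarrow> trig_poly (\<lambda>x. f x + g x)"
| scale: "trig_poly f \<Longrightarrow> trig_poly (\<lambda>x. c * f x)"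

definition trig_basis :: "('n::finite) torus_L2 set" where
  "trig_basis = range (\<lambda>k. abs_torus_L2 (\<lambda>x. cos (2 * pi * (int_vec k \<bullet> x)))) \<union>
     range (\<lambda>k. abs_torus_L2 (\<lambda>x. sin (2 * pi * (int_vec k \<bullet> x))))"

lemma int_vec_add: "int_vec (k + l) = int_vec k + int_vec l"
  and int_vec_diff: "int_vec (k - l) = int_vec k - int_vec l"
  and int_vec_uminus: "int_vec (- k) = - int_vec k"
  and int_vec_0 [simp]: "int_vec 0 = 0"
  by (simp_all add: int_vec_def vec_eq_iff)

lemma int_vec_axis_inner [simp]: "int_vec (axis i 1) \<bullet> x = x $ i"
proof -
  have "int_vec (axis i 1) = axis i 1" by (simp add: int_vec_def vec_eq_iff axis_def)
  then show ?thesis by (simp add: inner_axis' )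
qed

lemma trig_poly_const: "trig_poly (\<lambda>x. c)"
  using trig_poly.scale[OF trig_poly.cos[of 0], of c] by simp

lemma trig_poly_sum: "(\<And>i. i \<in> I \<Longrightarrow> trig_poly (f i)) \<Longrightarrow> trig_poly (\<lambda>x. \<Sum>i\<in>I. f i x)"
  by (induction I rule: infinite_finite_induct) (auto intro: trig_poly_const trig_poly.add)

lemma trig_poly_linear_comb: "trig_poly f \<Longrightarrow> trig_poly g \<Longrightarrow> trig_poly (\<lambda>x. c * (f x + d * g x))"
  by (intro trig_poly.scale trig_poly.add)

text \<open>The product-to-sum formulas, by induction on both factors. This lets real polynomials in
  the coordinates of the embedded torus become trigonometric polynomials.\<close>

lemma trig_poly_mult:
  assumes "trig_poly f" "trig_poly g"
  shows "trig_poly (\<lambda>x. f x * g x)"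
  using assms(1)
proof induction
  case (cos k)
  show ?case using assms(2)
  proof induction
    case (cos l)
    have "cos (2 * pi * (int_vec k \<bullet> x)) * cos (2 * pi * (int_vec l \<bullet> x)) =
        (1/2) * (cos (2 * pi * (int_vec (k - l) \<bullet> x)) + 1 * cos (2 * pi * (int_vec (k + l) \<bullet> x)))" for x
      unfolding cos_times_cos by (simp add: int_vec_add int_vec_diff algebra_simps)
    then show ?case by (simp only:) (intro trig_poly_linear_comb trig_poly.cos)
  next
    case (sin l)
    have "cos (2 * pi * (int_vec k \<bullet> x)) * sin (2 * pi * (int_vec l \<bullet> x)) =
        (1/2) * (sin (2 * pi * (int_vec (k + l) \<bullet> x)) + (-1) * sin (2 * pi * (int_vec (k - l) \<bullet> x)))" for x
      unfolding cos_times_sin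
      by (simp add: int_vec_add int_vec_diff inner_add_left inner_diff_left distrib_left right_diff_distrib)
    then show ?case by (simp only:) (intro trig_poly_linear_comb trig_poly.sin)
  next
    case (add f g)
    then show ?case unfolding distrib_left by (intro trig_poly.add)
  next
    case (scale f c)
    then show ?case unfolding mult.left_commute[of _ c] by (intro trig_poly.scale)
  qed
next
  case (sin k)
  show ?case using assms(2)
  proof induction
    case (cos l)
    have "sin (2 * pi * (int_vec k \<bullet> x)) * cos (2 * pi * (int_vec l \<bullet> x)) =
        (1/2) * (sin (2 * pi * (int_vec (k + l) \<bullet> x)) + 1 * sin (2 * pi * (int_vec (k - l) \<bullet> x)))" for x
      unfolding sin_times_cos by (simp add: int_vec_add int_vec_diff algebra_simps)
    then show ?case by (simp only:) (intro trig_poly_linear_comb trig_poly.sin)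
  next
    case (sin l)
    have "sin (2 * pi * (int_vec k \<bullet> x)) * sin (2 * pi * (int_vec l \<bullet> x)) =
        (1/2) * (cos (2 * pi * (int_vec (k - l) \<bullet> x)) + (-1) * cos (2 * pi * (int_vec (k + l) \<bullet> x)))" for x
      unfolding sin_times_sin
      by (simp add: int_vec_add int_vec_diff inner_add_left inner_diff_left distrib_left right_diff_distrib)
    then show ?case by (simp only:) (intro trig_poly_linear_comb trig_poly.cos)
  next
    case (add f g)
    then show ?case unfolding distrib_left by (intro trig_poly.add)
  next
    case (scale f c)
    then show ?case unfolding mult.left_commute[of _ c] by (intro trig_poly.scale)
  qed
next
  case (add f g)
  then show ?case unfolding distrib_right by (intro trig_poly.add)
next
  case (scale f c)
  then show ?case unfolding mult.assoc by (intro trig_poly.scale)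
qed

text \<open>Wraps the torus onto a product of unit circles. Functions of the embedded point are
  automatically periodic, and polynomial approximation on compact subsets of C^n applies to
  them.\<close>

definition torus_embed :: "real ^ 'n::finite \<Rightarrow> complex ^ 'n" where
  "torus_embed x = (\<chi> i. cis (2 * pi * x $ i))"

lemma measurable_torus_embed [measurable]: "torus_embed \<in> borel_measurable borel"
  unfolding torus_embed_def[abs_def] cis_conv_exp
  by (intro borel_measurable_continuous_onI continuous_intros)

lemma norm_torus_embed: "norm (torus_embed (x :: real ^ 'n::finite)) \<le> real CARD('n)"
proof -
  have "norm (torus_embed x) \<le> (\<Sum>i\<in>UNIV. norm (torus_embed x $ i))"
    unfolding norm_vec_def by (rule L2_set_le_sum) simp
  then show ?thesis by (simp add: torus_embed_def)
qed

lemma trig_poly_polynomial_torus_embed: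
  fixes p :: "complex ^ 'n::finite \<Rightarrow> real"
  assumes "real_polynomial_function p"
  shows "trig_poly (\<lambda>x. p (torus_embed x))"
  using assms
proof induction
  case (linear f)
  have "trig_poly (\<lambda>x. torus_embed x \<bullet> b)" if "b \<in> Basis" for b :: "complex ^ 'n"
  proof -
    from that obtain i where "b = axis i 1 \<or> b = axis i \<i>"
      by (auto simp: Basis_vec_def Basis_complex_def)
    then show ?thesis
    proof
      assume "b = axis i 1"
      then have "(\<lambda>x. torus_embed x \<bullet> b) = (\<lambda>x. cos (2 * pi * (int_vec (axis i 1) \<bullet> x)))"
        by (simp add: inner_axis torus_embed_def fun_eq_iff inner_complex_def)
      then show ?thesis by (simp only: trig_poly.cos)
    next
      assume "b = axis i \<i>"
      then have "(\<lambda>x. torus_embed x \<bullet> b) = (\<lambda>x. sin (2 * pi * (int_vec (axis i 1) \<bullet> x)))"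
        by (simp add: inner_axis torus_embed_def fun_eq_iff inner_complex_def)
      then show ?thesis by (simp only: trig_poly.sin)
    qed
  qed
  then have "trig_poly (\<lambda>x. \<Sum>b\<in>Basis. f b * (torus_embed x \<bullet> b))"
    by (intro trig_poly_sum trig_poly.scale)
  moreover have "f (torus_embed x) = (\<Sum>b\<in>Basis. f b * (torus_embed x \<bullet> b))" for x :: "real ^ 'n"
  proof -
    let ?z = "torus_embed x"
    note lin = bounded_linear.linear[OF linear]
    have "f ?z = f (\<Sum>b\<in>Basis. (?z \<bullet> b) *\<^sub>R b)" by (simp add: euclidean_representation)
    also have "\<dots> = (\<Sum>b\<in>Basis. f b * (?z \<bullet> b))"
      unfolding linear_sum[OF lin] linear_cmul[OF lin] by (intro sum.cong refl) (simp add: mult.commute)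
    finally show ?thesis .
  qed
  ultimately show ?case by (simp only:)
next
  case (const c)
  show ?case by (rule trig_poly_const)
next
  case (add f g)
  then show ?case by (intro trig_poly.add)
next
  case (mult f g)
  then show ?case by (intro trig_poly_mult)
qed

lemma trig_poly_continuous: "trig_poly f \<Longrightarrow> continuous_on UNIV f"
  by (induction rule: trig_poly.induct) (auto intro!: continuous_intros)

lemma trig_poly_bounded: "trig_poly f \<Longrightarrow> \<exists>c. \<forall>x. \<bar>f x\<bar> \<le> c"
proof (induction rule: trig_poly.induct)
  case (add f g)
  then obtain c d where "\<And>x. \<bar>f x\<bar> \<le> c" "\<And>x. \<bar>g x\<bar> \<le> d" by blast
  then have "\<bar>f x + g x\<bar> \<le> c + d" for x by (meson abs_triangle_ineq add_mono order_trans)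
  then show ?case by blast
next
  case (scale f c)
  then obtain d where "\<And>x. \<bar>f x\<bar> \<le> d" by blast
  then have "\<bar>c * f x\<bar> \<le> \<bar>c\<bar> * d" for x unfolding abs_mult by (intro mult_left_mono) auto
  then show ?case by blast
next
  case (cos k)
  show ?case by (rule exI[of _ 1]) (simp add: abs_cos_le_one)
next
  case (sin k)
  show ?case by (rule exI[of _ 1]) (simp add: abs_sin_le_one)
qed

lemma trig_poly_torus_L2:
  assumes "trig_poly f"
  shows "torus_L2_rel f f"
proof -
  obtain c where "\<And>x. \<bar>f x\<bar> \<le> c" using trig_poly_bounded[OF assms] by blast
  moreover have "f \<in> borel_measurable torus_measure"
    by (intro borel_measurable_torus borel_measurable_continuous_onI trig_poly_continuous assms)
  ultimately show ?thesis by (intro torus_L2_bounded)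
qed

lemma trig_poly_in_span: "trig_poly f \<Longrightarrow> abs_torus_L2 f \<in> span trig_basis"
proof (induction rule: trig_poly.induct)
  case (add f g)
  then show ?case by (simp add: abs_torus_L2_add trig_poly_torus_L2 span_add)
next
  case (scale f c)
  then show ?case by (simp add: abs_torus_L2_scale trig_poly_torus_L2 span_scale)
qed (simp_all add: span_base trig_basis_def)

definition trig_approximable :: "(real ^ 'n::finite \<Rightarrow> real) \<Rightarrow> bool" where
  "trig_approximable f \<longleftrightarrow> torus_L2_rel f f \<and> abs_torus_L2 f \<in> closure (span trig_basis)"

lemma subspace_closure:
  fixes V :: "'a::real_normed_vector set"
  assumes "subspace V"
  shows "subspace (closure V)"
proof (rule subspaceI)
  show "0 \<in> closure V" using subspace_0[OF assms] closure_subset by blast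
next
  fix u v assume "u \<in> closure V" "v \<in> closure V"
  then obtain f g where "\<And>n. f n \<in> V" "f \<longlonglongrightarrow> u" "\<And>n. g n \<in> V" "g \<longlonglongrightarrow> v"
    unfolding closure_sequential by blast
  then show "u + v \<in> closure V"
    unfolding closure_sequential using assms
    by (intro exI[of _ "\<lambda>n. f n + g n"]) (auto intro: tendsto_add subspace_add)
next
  fix c u assume "u \<in> closure V"
  then obtain f where "\<And>n. f n \<in> V" "f \<longlonglongrightarrow> u"
    unfolding closure_sequential by blast
  then show "c *\<^sub>R u \<in> closure V"
    unfolding closure_sequential using assms
    by (intro exI[of _ "\<lambda>n. c *\<^sub>R f n"]) (auto intro: tendsto_scaleR subspace_scale)
qed

lemmas subspace_closure_span = subspace_closure[OF subspace_span]

lemma trig_approximable_add: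
  "trig_approximable f \<Longrightarrow> trig_approximable g \<Longrightarrow> trig_approximable (\<lambda>x. f x + g x)"
  unfolding trig_approximable_def
  by (simp add: torus_L2_rel_add abs_torus_L2_add subspace_add[OF subspace_closure_span])

lemma trig_approximable_scale:
  "trig_approximable f \<Longrightarrow> trig_approximable (\<lambda>x. c * f x)"
  unfolding trig_approximable_def
  by (simp add: torus_L2_rel_scale abs_torus_L2_scale subspace_scale[OF subspace_closure_span])

lemma trig_approximable_trig_poly: "trig_poly f \<Longrightarrow> trig_approximable f"
  unfolding trig_approximable_def using trig_poly_in_span closure_subset by (auto simp: trig_poly_torus_L2)

lemma trig_approximable_sum:
  "(\<And>i. i \<in> I \<Longrightarrow> trig_approximable (f i)) \<Longrightarrow> trig_approximable (\<lambda>x. \<Sum>i\<in>I. f i x)"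
  by (induction I rule: infinite_finite_induct)
    (auto intro: trig_approximable_add trig_approximable_trig_poly trig_poly_const)

lemma trig_approximable_cong:
  "trig_approximable f \<Longrightarrow> (\<And>x. x \<in> unit_cell \<Longrightarrow> f x = g x) \<Longrightarrow> trig_approximable g"
  unfolding trig_approximable_def using abs_torus_L2_cong_cell[of f g] by simp

text \<open>Carries every later extension, from polynomials to continuous functions, open sets,
  Borel sets and square-integrable functions: domination yields convergence in L2, and the closure
  absorbs the limit.\<close>

lemma trig_approximable_limit:
  assumes f: "\<And>n. trig_approximable (f n)" and g: "g \<in> borel_measurable torus_measure" and w: "torus_L2_rel w w"
    and lim: "\<And>x. x \<in> unit_cell \<Longrightarrow> (\<lambda>n. f n x) \<longlonglongrightarrow> g x"
    and bound: "\<And>n x. x \<in> unit_cell \<Longrightarrow> \<bar>f n x\<bar> \<le> w x"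
  shows "trig_approximable g"
proof -
  have gr: "torus_L2_rel g g"
  proof -
    have "\<bar>g x\<bar> \<le> w x" if "x \<in> unit_cell" for x
      by (rule LIMSEQ_le_const2[OF tendsto_rabs[OF lim[OF that]]], intro exI allI impI, rule bound[OF that])
    note le = power_mono[OF this abs_ge_zero, of _ 2]
    have "integrable torus_measure (\<lambda>x. (g x)\<^sup>2)"
    proof (rule Bochner_Integration.integrable_bound)
      show "integrable torus_measure (\<lambda>x. (w x)\<^sup>2)" using w by (simp add: torus_L2_rel_def)
      show "(\<lambda>x. (g x)\<^sup>2) \<in> borel_measurable torus_measure" using g by (rule borel_measurable_power)
      show "AE x in torus_measure. norm ((g x)\<^sup>2) \<le> norm ((w x)\<^sup>2)"
      proof (rule AE_I2)
        fix x :: "real ^ 'a" assume "x \<in> space torus_measure"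
        then show "norm ((g x)\<^sup>2) \<le> norm ((w x)\<^sup>2)" using le[of x] by simp
      qed
    qed
    then show ?thesis using g by (simp add: torus_L2_rel_def)
  qed
  have "(\<lambda>n. abs_torus_L2 (f n)) \<longlonglongrightarrow> abs_torus_L2 g"
  proof (rule torus_L2_dominated_convergence[OF _ gr w lim bound])
    show "torus_L2_rel (f n) (f n)" for n using f[of n] by (simp add: trig_approximable_def)
  qed
  then have "abs_torus_L2 g \<in> closure (span trig_basis)"
    by (rule closed_sequentially[OF closed_closure, rotated]) (use f in \<open>simp add: trig_approximable_def\<close>)
  then show ?thesis using gr by (simp add: trig_approximable_def)
qed

text \<open>Stone-Weierstrass on a ball containing the embedded torus, with uniform error 1 / (n +
  1); the resulting common bound c + 1 is the dominating function.\<close>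

lemma trig_approximable_continuous:
  fixes F :: "complex ^ 'n::finite \<Rightarrow> real"
  assumes F: "continuous_on UNIV F"
  shows "trig_approximable (\<lambda>x. F (torus_embed x))"
proof -
  let ?S = "cball 0 (real CARD('n)) :: (complex ^ 'n) set"
  have S: "torus_embed x \<in> ?S" for x :: "real ^ 'n" using norm_torus_embed[of x] by simp
  have cont: "continuous_on ?S F" using F by (rule continuous_on_subset) auto
  obtain c where c: "\<And>z. z \<in> ?S \<Longrightarrow> \<bar>F z\<bar> \<le> c"
    using compact_imp_bounded[OF compact_continuous_image[OF cont compact_cball]]
    unfolding bounded_iff by (metis imageI real_norm_def)
  have "\<exists>p. real_polynomial_function p \<and> (\<forall>z\<in>?S. \<bar>F z - p z\<bar> < 1 / real (Suc n))" for n
    using Stone_Weierstrass_real_polynomial_function[OF compact_cball cont, of "1 / real (Suc n)"]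
    by (metis of_nat_0_less_iff zero_less_Suc zero_less_divide_1_iff)
  then obtain p where p: "\<And>n. real_polynomial_function (p n)"
    "\<And>n z. z \<in> ?S \<Longrightarrow> \<bar>F z - p n z\<bar> < 1 / real (Suc n)" by metis
  show ?thesis
  proof (rule trig_approximable_limit[of "\<lambda>n x. p n (torus_embed x)" _ "\<lambda>_. c + 1"])
    show "trig_approximable (\<lambda>x. p n (torus_embed x))" for n
      by (intro trig_approximable_trig_poly trig_poly_polynomial_torus_embed p)
    show "(\<lambda>x. F (torus_embed x)) \<in> borel_measurable torus_measure"
      using F by (intro borel_measurable_torus measurable_compose[OF measurable_torus_embed] borel_measurable_continuous_onI)
    show "torus_L2_rel (\<lambda>_ :: real ^ 'n. c + 1) (\<lambda>_. c + 1)" by (rule torus_L2_bounded[of _ "\<bar>c + 1\<bar>"]) auto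
    fix x :: "real ^ 'n"
    have "(\<lambda>n. p n (torus_embed x) - F (torus_embed x)) \<longlonglongrightarrow> 0"
    proof (rule Lim_null_comparison[OF _ LIMSEQ_inverse_real_of_nat])
      show "\<forall>\<^sub>F n in sequentially. norm (p n (torus_embed x) - F (torus_embed x)) \<le> inverse (real (Suc n))"
        using p(2)[OF S[of x]] by (intro always_eventually allI) (simp add: abs_minus_commute inverse_eq_divide less_imp_le)
    qed
    then show "(\<lambda>n. p n (torus_embed x)) \<longlonglongrightarrow> F (torus_embed x)" by (rule LIM_zero_cancel)
    fix n
    have "1 / real (Suc n) \<le> 1" by simp
    then show "\<bar>p n (torus_embed x)\<bar> \<le> c + 1"
      using p(2)[OF S[of x], of n] c[OF S[of x]] by linarith
  qed
qed

text \<open>A Dynkin argument starting from the open sets, which are stable under intersection. The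
  indicator of an open set is the limit of truncated multiples of the distance to its
  complement.\<close>

lemma trig_approximable_indicator_embed:
  fixes C :: "(complex ^ 'n::finite) set"
  assumes "C \<in> sets borel"
  shows "trig_approximable (\<lambda>x. indicator C (torus_embed x) :: real)"
proof -
  have one: "torus_L2_rel (\<lambda>_ :: real ^ 'n. 1) (\<lambda>_. 1)" by (rule torus_L2_bounded[of _ 1]) auto
  have "Int_stable {S :: (complex ^ 'n) set. open S}" by (auto simp: Int_stable_def)
  moreover have "{S :: (complex ^ 'n) set. open S} \<subseteq> Pow UNIV" by simp
  moreover have "C \<in> sigma_sets UNIV {S. open S}" using assms by (simp add: borel_def)
  ultimately show ?thesis
  proof (induction rule: sigma_sets_induct_disjoint)
    case (basic A)
    then have A: "open A" by simp
    show ?case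
    \<comment> \<open>\<open>infdist\<close> to the empty set is 0 by convention, so the distance to
      the complement says nothing when A is the whole space.\<close>
    proof (cases "A = UNIV")
      case True
      then show ?thesis by (simp add: trig_approximable_trig_poly trig_poly_const)
    next
      case False
      let ?F = "\<lambda>n z. min 1 (real n * infdist z (- A))"
      show ?thesis
      proof (rule trig_approximable_limit[of "\<lambda>n x. ?F n (torus_embed x)", OF _ _ one])
        show "trig_approximable (\<lambda>x. ?F n (torus_embed x))" for n
          by (rule trig_approximable_continuous) (intro continuous_intros)
        show "(\<lambda>x. indicator A (torus_embed x) :: real) \<in> borel_measurable torus_measure"
          using A by (intro borel_measurable_torus measurable_compose[OF measurable_torus_embed]) auto
        fix x :: "real ^ 'n"
        show "\<bar>?F n (torus_embed x)\<bar> \<le> 1" for n by (simp add: infdist_nonneg)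
        show "(\<lambda>n. ?F n (torus_embed x)) \<longlonglongrightarrow> indicator A (torus_embed x)"
        proof (cases "torus_embed x \<in> A")
          case True
          then have "infdist (torus_embed x) (- A) \<noteq> 0"
            using False A in_closed_iff_infdist_zero[of "- A" "torus_embed x"] by (auto simp: closed_Compl)
          then have pos: "0 < infdist (torus_embed x) (- A)" using infdist_nonneg[of "torus_embed x" "- A"] by linarith
          then obtain N where N: "1 < real N * infdist (torus_embed x) (- A)" using reals_Archimedean3 by blast
          have "1 \<le> real n * infdist (torus_embed x) (- A)" if "n \<ge> N" for n
            using N mult_right_mono[OF of_nat_mono[OF that, where 'a = real] infdist_nonneg[of "torus_embed x" "- A"]]
            by linarith
          then have "\<forall>\<^sub>F n in sequentially. ?F n (torus_embed x) = 1"
            unfolding eventually_sequentially by (intro exI[of _ N]) auto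
          then show ?thesis using True by (simp add: tendsto_eventually)
        next
          case False
          then show ?thesis by simp
        qed
      qed
    qed
  next
    case empty
    then show ?case by (simp add: trig_approximable_trig_poly trig_poly_const)
  next
    case (compl A)
    have "trig_approximable (\<lambda>x. 1 + (-1) * indicator A (torus_embed x))"
      by (intro trig_approximable_add trig_approximable_scale compl trig_approximable_trig_poly trig_poly_const)
    then show ?case by (rule trig_approximable_cong) (simp add: indicator_def)
  next
    case (union A)
    have A: "A i \<in> sets borel" for i using union(2) by (auto simp: borel_def)
    show ?case
    proof (rule trig_approximable_limit[of "\<lambda>n x. \<Sum>i<n. indicator (A i) (torus_embed x)", OF _ _ one])
      show "trig_approximable (\<lambda>x. \<Sum>i<n. indicator (A i) (torus_embed x))" for n
        by (intro trig_approximable_sum union)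
      show "(\<lambda>x. indicator (\<Union>i. A i) (torus_embed x) :: real) \<in> borel_measurable torus_measure"
        using A by (intro borel_measurable_torus measurable_compose[OF measurable_torus_embed]) auto
      fix x :: "real ^ 'n"
      have eq: "(\<Sum>i<n. indicator (A i) (torus_embed x) :: real) = indicator (\<Union>i<n. A i) (torus_embed x)" for n
        using union(1) by (intro indicator_UN_disjoint[symmetric]) (auto simp: disjoint_family_on_def)
      show "\<bar>\<Sum>i<n. indicator (A i) (torus_embed x)\<bar> \<le> (1 :: real)" for n
        unfolding eq by (simp add: indicator_def)
      have "(\<lambda>i. indicator (A i) (torus_embed x) :: real) sums indicator (\<Union>i. A i) (torus_embed x)"
        using union(1) by (intro indicator_sums) (auto simp: disjoint_family_on_def)
      then show "(\<lambda>n. \<Sum>i<n. indicator (A i) (torus_embed x) :: real) \<longlonglongrightarrow> indicator (\<Union>i. A i) (torus_embed x)"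
        by (simp add: sums_def)
    qed
  qed
qed

text \<open>The jump sits on the positive real axis, up to which the function is continuous from
  above. Hence the split into the closed upper half-plane without 0, the open lower half-plane, and
  0, where the value is 0 by convention.\<close>

lemma measurable_Arg2pi: "Arg2pi \<in> borel_measurable borel"
proof -
  let ?A = "{z. 0 \<le> Im z} - {0}" and ?B = "{z. Im z < 0}"
  have A: "?A \<in> sets borel" "?B \<in> sets borel"
    by (auto intro!: sets.Diff borel_closed borel_open closed_Collect_le open_Collect_less continuous_intros)
  have "continuous_on ?B Arg2pi"
    by (intro continuous_at_imp_continuous_on ballI continuous_at_Arg2pi) (auto simp: complex_nonneg_Reals_iff)
  then have 1: "(\<lambda>z. indicator ?B z *\<^sub>R Arg2pi z) \<in> borel_measurable borel"
    using A by (intro borel_measurable_continuous_on_indicator) auto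
  have 2: "(\<lambda>z. indicator ?A z *\<^sub>R Arg2pi z) \<in> borel_measurable borel"
    using A by (intro borel_measurable_continuous_on_indicator continuous_on_upperhalf_Arg2pi) auto
  have "Arg2pi = (\<lambda>z. indicator ?A z *\<^sub>R Arg2pi z + indicator ?B z *\<^sub>R Arg2pi z)"
    by (auto simp: fun_eq_iff indicator_def)
  also have "\<dots> \<in> borel_measurable borel" using 1 2 by (intro borel_measurable_add)
  finally show ?thesis .
qed

text \<open>\<open>h\<close> recovers a point of the cell from the angles of its embedding, so on
  the cell the indicator of B is that of a Borel subset of C^n evaluated at the embedded
  point.\<close>

lemma trig_approximable_indicator:
  fixes B :: "(real ^ 'n::finite) set"
  assumes B: "B \<in> sets borel"
  shows "trig_approximable (indicator B)"
proof -
  define h :: "complex ^ 'n \<Rightarrow> real ^ 'n" where "h z = (\<chi> i. Arg2pi (z $ i) / (2 * pi))" for z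
  have h: "h \<in> borel_measurable borel"
  proof -
    have "(\<lambda>z :: complex ^ 'n. h z \<bullet> axis i 1) \<in> borel_measurable borel" for i
      unfolding inner_axis h_def vec_lambda_beta inner_real_def mult_1_right
      by (intro borel_measurable_divide borel_measurable_const measurable_compose[OF _ measurable_Arg2pi]
          borel_measurable_continuous_onI continuous_intros)
    then show ?thesis
      by (subst borel_measurable_euclidean_space) (auto simp: Basis_vec_def)
  qed
  have "h (torus_embed x) = x" if "x \<in> unit_cell" for x
  proof -
    have "Arg2pi (cis (2 * pi * x $ i)) = 2 * pi * x $ i" for i
      using that by (intro Arg2pi_unique[of 1]) (auto simp: cis_conv_exp)
    then show ?thesis by (simp add: h_def torus_embed_def vec_eq_iff)
  qed
  moreover have "h -` B \<in> sets borel" using measurable_sets[OF h B] by simp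
  ultimately show ?thesis
    by (intro trig_approximable_cong[OF trig_approximable_indicator_embed[of "h -` B"]]) (auto simp: indicator_def)
qed

text \<open>Simple functions of modulus at most 2 |f| converge pointwise to f, and on the cell each
  is a finite combination of indicators of Borel sets.\<close>

lemma trig_polys_dense: "closure (span trig_basis) = (UNIV :: ('n::finite) torus_L2 set)"
proof (intro set_eqI iffI UNIV_I)
  fix u :: "'n torus_L2"
  obtain f where f: "torus_L2_rel f f" "u = abs_torus_L2 f" by (rule torus_L2_cases)
  then have fm: "f \<in> borel_measurable torus_measure" by (simp add: torus_L2_rel_def)
  obtain F where F: "\<And>i. simple_function torus_measure (F i)"
    "\<And>x. x \<in> unit_cell \<Longrightarrow> (\<lambda>i. F i x) \<longlonglongrightarrow> f x"
    "\<And>i x. x \<in> unit_cell \<Longrightarrow> \<bar>F i x\<bar> \<le> 2 * \<bar>f x\<bar>"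
    using borel_measurable_implies_sequence_metric[OF fm, of 0] by (auto simp: dist_real_def)
  have "torus_L2_rel (\<lambda>x. \<bar>f x\<bar>) (\<lambda>x. \<bar>f x\<bar>)" using f(1) by (auto simp: torus_L2_rel_def)
  then have w: "torus_L2_rel (\<lambda>x. 2 * \<bar>f x\<bar>) (\<lambda>x. 2 * \<bar>f x\<bar>)" by (rule torus_L2_rel_scale)
  have "trig_approximable (F i)" for i
  proof (rule trig_approximable_cong)
    have "F i -` {y} \<inter> unit_cell \<in> sets borel" for y
    proof -
      have "F i -` {y} \<inter> space torus_measure \<in> sets torus_measure"
        using F(1) by (rule simple_functionD)
      then show ?thesis unfolding sets_torus_measure by auto
    qed
    then show "trig_approximable (\<lambda>x. \<Sum>y\<in>F i ` unit_cell. y * indicator (F i -` {y} \<inter> unit_cell) x)"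
      by (intro trig_approximable_sum trig_approximable_scale trig_approximable_indicator)
    fix x :: "real ^ 'n" assume x: "x \<in> unit_cell"
    have "finite (F i ` unit_cell)" using simple_functionD(1)[OF F(1)[of i]] by simp
    then have "(\<Sum>y\<in>F i ` unit_cell. y * indicator (F i -` {y} \<inter> unit_cell) x) =
        (\<Sum>y\<in>F i ` unit_cell. if y = F i x then y else 0)"
      using x by (intro sum.cong refl) (auto simp: indicator_def)
    also have "\<dots> = F i x"
      using x \<open>finite (F i ` unit_cell)\<close> by (subst sum.delta) auto
    finally show "(\<Sum>y\<in>F i ` unit_cell. y * indicator (F i -` {y} \<inter> unit_cell) x) = F i x" .
  qed
  from trig_approximable_limit[OF this fm w F(2,3)] show "u \<in> closure (span trig_basis)"
    by (simp add: trig_approximable_def f(2))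
qed


section \<open>Separability\<close>

lemma closure_span_countable_separable:
  fixes d :: "'i::countable \<Rightarrow> 'a::real_normed_vector"
  shows "\<exists>X. countable X \<and> closure (span (range d)) \<subseteq> closure X"
proof -
  \<comment> \<open>Lists of coefficient-index pairs code the finite rational combinations:
    countability comes with the list type, and addition is concatenation.\<close>
  define X where "X = range (\<lambda>l :: (rat \<times> 'i) list. \<Sum>(q, i)\<leftarrow>l. of_rat q *\<^sub>R d i)"
  have X_add: "x + y \<in> X" if "x \<in> X" "y \<in> X" for x y
  proof -
    obtain k l where "x = (\<Sum>(q, i)\<leftarrow>k. of_rat q *\<^sub>R d i)" "y = (\<Sum>(q, i)\<leftarrow>l. of_rat q *\<^sub>R d i)"
      using \<open>x \<in> X\<close> \<open>y \<in> X\<close> unfolding X_def by blast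
    then show ?thesis unfolding X_def by (intro image_eqI[of _ _ "k @ l"]) auto
  qed
  have X_scale: "of_rat r *\<^sub>R x \<in> X" if "x \<in> X" for x r
  proof -
    obtain l where l: "x = (\<Sum>(q, i)\<leftarrow>l. of_rat q *\<^sub>R d i)"
      using \<open>x \<in> X\<close> unfolding X_def by blast
    have "of_rat r *\<^sub>R (\<Sum>(q, i)\<leftarrow>l. of_rat q *\<^sub>R d i) = (\<Sum>(q, i)\<leftarrow>map (\<lambda>(q, i). (r * q, i)) l. of_rat q *\<^sub>R d i)"
      by (induction l) (auto simp: scaleR_add_right of_rat_mult)
    then show ?thesis unfolding X_def l by (intro image_eqI[of _ _ "map (\<lambda>(q, i). (r * q, i)) l"]) auto
  qed
  have "subspace (closure X)"
  proof (rule subspaceI)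
    have "0 \<in> X" unfolding X_def by (intro image_eqI[of _ _ "[]"]) auto
    then show "0 \<in> closure X" using closure_subset by blast
  next
    fix x y assume "x \<in> closure X" "y \<in> closure X"
    then obtain f g where "\<And>n. f n \<in> X" "f \<longlonglongrightarrow> x" "\<And>n. g n \<in> X" "g \<longlonglongrightarrow> y"
      unfolding closure_sequential by blast
    then show "x + y \<in> closure X"
      unfolding closure_sequential by (intro exI[of _ "\<lambda>n. f n + g n"]) (auto intro: tendsto_add X_add)
  next
    fix c :: real and x assume "x \<in> closure X"
    then obtain f where f: "\<And>n. f n \<in> X" "f \<longlonglongrightarrow> x"
      unfolding closure_sequential by blast
    have "c \<in> closure \<rat>" by (simp add: Rats_closure_real)
    then obtain r where r: "\<And>n. r n \<in> \<rat>" "r \<longlonglongrightarrow> c"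
      unfolding closure_sequential by blast
    have "r n *\<^sub>R f n \<in> X" for n
      using r(1)[of n] X_scale[OF f(1)[of n]] by (auto elim!: Rats_cases)
    then show "c *\<^sub>R x \<in> closure X"
      unfolding closure_sequential using tendsto_scaleR[OF r(2) f(2)]
      by (intro exI[of _ "\<lambda>n. r n *\<^sub>R f n"]) simp
  qed
  moreover have "range d \<subseteq> closure X"
  proof -
    have "d i \<in> X" for i unfolding X_def by (intro image_eqI[of _ _ "[(1, i)]"]) auto
    then show ?thesis using closure_subset by blast
  qed
  ultimately have "span (range d) \<subseteq> closure X" by (intro span_minimal)
  then have "closure (span (range d)) \<subseteq> closure X" by (simp add: closure_minimal)
  moreover have "countable X" unfolding X_def by (rule countable_image) simp
  ultimately show ?thesis by blast
qed

lemma second_countable_if_separable: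
  fixes X :: "'a::metric_space set"
  assumes X: "countable X" "closure X = UNIV"
  shows "\<exists>B :: 'a set set. countable B \<and> open = generate_topology B"
proof -
  define B where "B = (\<lambda>(x, n). ball x (1 / real (Suc n))) ` (X \<times> UNIV)"
  have "topological_basis B"
  proof (rule topological_basisI)
    show "open b" if "b \<in> B" for b using that by (auto simp: B_def)
    fix S :: "'a set" and x assume "open S" "x \<in> S"
    then obtain e where e: "e > 0" "ball x e \<subseteq> S" unfolding open_contains_ball by blast
    obtain n where n: "1 / real (Suc n) < e / 2" using nat_approx_posE[of "e / 2"] e by auto
    have "x \<in> closure X" using X by simp
    then obtain y where y: "y \<in> X" "dist y x < 1 / real (Suc n)"
      unfolding closure_approachable by (meson of_nat_0_less_iff zero_less_Suc zero_less_divide_1_iff)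
    show "\<exists>b\<in>B. x \<in> b \<and> b \<subseteq> S"
    proof (intro bexI[of _ "ball y (1 / real (Suc n))"] conjI)
      show "x \<in> ball y (1 / real (Suc n))" using y by simp
      show "ball y (1 / real (Suc n)) \<subseteq> S"
      proof
        fix z assume "z \<in> ball y (1 / real (Suc n))"
        then have "dist x z < e" using y n dist_triangle[of x z y] by (simp add: dist_commute)
        then show "z \<in> S" using e by auto
      qed
      show "ball y (1 / real (Suc n)) \<in> B" using y unfolding B_def by force
    qed
  qed
  then have "open = generate_topology B"
    by (rule topological_basis_imp_subbasis)
  moreover have "countable B" unfolding B_def using X by simp
  ultimately show ?thesis by blast
qed

text \<open>A countable base makes the Borel \<sigma>-algebra of the space countably generated, on
  which the almost sure uniqueness of conditional distributions relies.\<close>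

instance torus_L2 :: (finite) second_countable_topology
proof
  define d :: "bool \<times> (int ^ 'a) \<Rightarrow> 'a torus_L2" where
    "d = (\<lambda>(b, k). if b then abs_torus_L2 (\<lambda>x. cos (2 * pi * (int_vec k \<bullet> x)))
       else abs_torus_L2 (\<lambda>x. sin (2 * pi * (int_vec k \<bullet> x))))"
  have "range d = range (\<lambda>k. d (True, k)) \<union> range (\<lambda>k. d (False, k))"
    by (auto simp: image_iff) (metis (full_types))
  then have "range d = trig_basis"
    by (simp add: d_def trig_basis_def)
  then obtain X :: "'a torus_L2 set" where "countable X" "closure X = UNIV"
    using closure_span_countable_separable[of d] trig_polys_dense by auto
  then show "\<exists>B :: 'a torus_L2 set set. countable B \<and> open = generate_topology B"
    by (rule second_countable_if_separable)
qed

subsection \<open>Fourier series and the forward map\<close>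

definition torus_char :: "int ^ 'n \<Rightarrow> real ^ 'n::finite \<Rightarrow> complex" where
  "torus_char k x = cis (2 * pi * (int_vec k \<bullet> x))"

lemma torus_char_mult: "torus_char k x * torus_char l x = torus_char (k + l) x"
  by (simp add: torus_char_def cis_mult int_vec_add inner_add_left distrib_left)

lemma torus_char_mult_uminus: "torus_char k x * torus_char (- l) x = torus_char (k - l) x"
  by (simp add: torus_char_mult)

lemma cnj_torus_char: "cnj (torus_char k x) = torus_char (- k) x"
  by (simp add: torus_char_def cis_cnj int_vec_uminus)

lemma norm_torus_char [simp]: "norm (torus_char k x) = 1"
  by (simp add: torus_char_def)

lemma continuous_torus_char: "continuous_on A (torus_char k)"
  unfolding torus_char_def[abs_def] cis_conv_exp by (intro continuous_intros)

lemma measurable_torus_char [measurable]: "torus_char k \<in> borel_measurable torus_measure"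
  by (intro borel_measurable_torus borel_measurable_continuous_onI continuous_torus_char)

lemma periodic_torus_char: "torus_char k (x + int_vec m) = torus_char k x"
proof -
  define N where "N = (\<Sum>i\<in>UNIV. k $ i * m $ i)"
  have "int_vec k \<bullet> int_vec m = real_of_int N"
    by (simp add: N_def inner_vec_def int_vec_def)
  then have "torus_char k (x + int_vec m) = torus_char k x * cis (2 * pi * real_of_int N)"
    by (simp add: torus_char_def inner_add_right distrib_left flip: cis_mult)
  also have "cis (2 * pi * real_of_int N) = 1" by (rule cis_multiple_2pi) simp
  finally show ?thesis by simp
qed

lemma integral_unit_interval_char:
  "integrable lborel (\<lambda>t. indicator {0..<1} t *\<^sub>R cis (2 * pi * real_of_int m * t))"
  "(LINT t|lborel. indicator {0..<1} t *\<^sub>R cis (2 * pi * real_of_int m * t)) = (if m = 0 then 1 else 0)"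
proof -
  have cont: "continuous_on A (\<lambda>t. cis (2 * pi * real_of_int m * t))" for A
    unfolding cis_conv_exp by (intro continuous_intros)
  have si: "set_integrable lborel {0..1} (\<lambda>t. cis (2 * pi * real_of_int m * t))"
    by (intro borel_integrable_atLeastAtMost' cont)
  show "integrable lborel (\<lambda>t. indicator {0..<1} t *\<^sub>R cis (2 * pi * real_of_int m * t))"
  proof -
    have "set_integrable lborel {0..<1} (\<lambda>t. cis (2 * pi * real_of_int m * t))"
      by (rule set_integrable_subset[OF si]) auto
    then show ?thesis unfolding set_integrable_def .
  qed
  show "(LINT t|lborel. indicator {0..<1} t *\<^sub>R cis (2 * pi * real_of_int m * t)) = (if m = 0 then 1 else 0)"
  proof (cases "m = 0")
    case True
    then show ?thesis by simp
  next
    case False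
    define f where "f t = cis (2 * pi * real_of_int m * t) / (2 * pi * m * \<i>)" for t :: real
    have si': "set_integrable lborel {0<..<1} (\<lambda>t. cis (2 * pi * real_of_int m * t))"
      by (rule set_integrable_subset[OF si]) auto
    have deriv: "(f has_vector_derivative cis (2 * pi * real_of_int m * t)) (at t)" for t
    proof -
      have "((\<lambda>z. exp (\<i> * (2 * pi * m * z)) / (2 * pi * m * \<i>)) has_field_derivative
          exp (\<i> * (2 * pi * m * of_real t))) (at (of_real t))"
        using False by (auto intro!: derivative_eq_intros)
      from has_vector_derivative_real_field[OF this] show ?thesis
        by (simp add: f_def[abs_def] cis_conv_exp)
    qed
    have "(LINT t|lborel. indicator {0..<1} t *\<^sub>R cis (2 * pi * real_of_int m * t)) =
        (LINT t:{0<..<1}|lborel. cis (2 * pi * real_of_int m * t))"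
      unfolding set_lebesgue_integral_def
    proof (rule integral_cong_AE)
      show "AE t in lborel. indicator {0..<1} t *\<^sub>R cis (2 * pi * real_of_int m * t) =
          indicator {0<..<1} t *\<^sub>R cis (2 * pi * real_of_int m * t)"
        using AE_lborel_singleton[of "0::real"] by eventually_elim (auto simp: indicator_def)
    qed (use borel_measurable_continuous_onI[OF cont] in \<open>auto intro!: borel_measurable_scaleR\<close>)
    also have "\<dots> = f 1 - f 0"
      by (intro set_integral_derivative si' deriv zero_less_one
          continuous_on_vector_derivative[OF has_vector_derivative_at_within[OF deriv]])
    also have "\<dots> = 0" by (simp add: f_def cis_multiple_2pi)
    finally show ?thesis using False by simp
  qed
qed

lemma prod_cis: "(\<Prod>i\<in>A. cis (f i)) = cis (\<Sum>i\<in>A. f i)"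
  by (induction A rule: infinite_finite_induct) (auto simp: cis_mult)

text \<open>The indicator of the cell times the character is a product of functions of single
  coordinates, so the integral factorises. Applied to k - l, this is the orthonormality of the
  characters.\<close>

lemma integral_torus_char:
  fixes k :: "int ^ 'n::finite"
  shows "(LINT x|torus_measure. torus_char k x) = (if k = 0 then 1 else 0)"
proof -
  define \<phi> where "\<phi> b t = indicator {0..<1} t *\<^sub>R cis (2 * pi * (int_vec k \<bullet> b) * t)"
    for b :: "real ^ 'n" and t :: real
  have \<phi>_axis: "\<phi> (axis i 1) = (\<lambda>t. indicator {0..<1} t *\<^sub>R cis (2 * pi * real_of_int (k $ i) * t))" for i
    by (simp add: \<phi>_def fun_eq_iff inner_axis int_vec_def)
  have B: "(Basis :: (real ^ 'n) set) = (\<lambda>i. axis i 1) ` UNIV" by (auto simp: Basis_vec_def)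
  have inj: "inj (\<lambda>i :: 'n. axis i (1 :: real))" by (auto simp: inj_def axis_eq_axis)
  have int: "integrable lborel (\<phi> b)" if "b \<in> Basis" for b
    using that integral_unit_interval_char(1) unfolding B by (auto simp: \<phi>_axis)
  interpret product_sigma_finite "\<lambda>_ :: real ^ 'n. lborel :: real measure" ..
  have prod: "indicator unit_cell x *\<^sub>R torus_char k x = (\<Prod>b\<in>Basis. \<phi> b (x \<bullet> b))" for x
  proof -
    have "(\<Prod>b\<in>Basis. \<phi> b (x \<bullet> b)) = (\<Prod>i\<in>UNIV. indicator {0..<1} (x $ i) *\<^sub>R cis (2 * pi * real_of_int (k $ i) * x $ i))"
      unfolding B prod.reindex[OF inj] by (simp add: \<phi>_axis inner_axis)
    also have "\<dots> = (\<Prod>i\<in>UNIV. complex_of_real (indicator {0..<1} (x $ i))) * cis (\<Sum>i\<in>UNIV. 2 * pi * real_of_int (k $ i) * x $ i)"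
      by (simp add: scaleR_conv_of_real prod.distrib prod_cis)
    also have "(\<Sum>i\<in>UNIV. 2 * pi * real_of_int (k $ i) * x $ i) = 2 * pi * (int_vec k \<bullet> x)"
      by (simp add: inner_vec_def int_vec_def sum_distrib_left mult.assoc)
    also have "(\<Prod>i\<in>UNIV. complex_of_real (indicator {0..<1} (x $ i))) = complex_of_real (indicator unit_cell x)"
    proof (cases "x \<in> unit_cell")
      case False
      then obtain i where "x $ i \<notin> {0..<1}" by auto
      then have "\<exists>i\<in>UNIV. complex_of_real (indicator {0..<1} (x $ i)) = 0" by (auto simp: indicator_def)
      then show ?thesis using False by (simp add: prod_zero)
    qed simp
    finally show ?thesis by (simp add: torus_char_def scaleR_conv_of_real)
  qed
  have "(LINT x|torus_measure. torus_char k x) = (LINT x|lborel. indicator unit_cell x *\<^sub>R torus_char k x)"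
    unfolding torus_measure_def by (rule integral_restrict_space) simp
  also have "\<dots> = integral\<^sup>L (distr (\<Pi>\<^sub>M b\<in>Basis. lborel) borel (\<lambda>f. \<Sum>b\<in>Basis. f b *\<^sub>R b)) (\<lambda>x. \<Prod>b\<in>Basis. \<phi> b (x \<bullet> b))"
    unfolding prod by (subst lborel_eq) (rule refl)
  also have "\<dots> = integral\<^sup>L (\<Pi>\<^sub>M b\<in>Basis. lborel) (\<lambda>f. \<Prod>b\<in>Basis. \<phi> b ((\<Sum>b\<in>Basis. f b *\<^sub>R b) \<bullet> b))"
  proof (rule integral_distr)
    show "(\<lambda>f. \<Sum>b\<in>Basis. f b *\<^sub>R b) \<in> borel_measurable (\<Pi>\<^sub>M b\<in>(Basis :: (real ^ 'n) set). (lborel :: real measure))"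
      by (intro borel_measurable_sum borel_measurable_scaleR borel_measurable_const)
        (auto intro!: measurable_compose[OF measurable_component_singleton])
    have "\<phi> b \<in> borel_measurable borel" if "b \<in> Basis" for b
      using borel_measurable_integrable[OF int[OF that]] by simp
    then show "(\<lambda>x. \<Prod>b\<in>Basis. \<phi> b (x \<bullet> b)) \<in> borel_measurable borel"
      by (intro borel_measurable_prod) (auto intro!: measurable_compose[of _ _ borel])
  qed
  also have "\<dots> = integral\<^sup>L (\<Pi>\<^sub>M b\<in>(Basis :: (real ^ 'n) set). lborel) (\<lambda>f. \<Prod>b\<in>Basis. \<phi> b (f b))"
    by (intro Bochner_Integration.integral_cong refl prod.cong) simp
  also have "\<dots> = (\<Prod>b\<in>Basis. integral\<^sup>L lborel (\<phi> b))"
    by (rule product_integral_prod) (auto intro: int)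
  also have "\<dots> = (\<Prod>i\<in>UNIV. if k $ i = 0 then 1 else 0)"
    unfolding B prod.reindex[OF inj] by (simp add: \<phi>_axis integral_unit_interval_char(2))
  also have "\<dots> = (if k = 0 then 1 else 0)"
    by (auto simp: vec_eq_iff intro!: prod_zero)
  finally show ?thesis .
qed

lemma torus_L2_integrable_char:
  assumes "torus_L2_rel f f"
  shows "integrable torus_measure (\<lambda>x. complex_of_real (f x) * torus_char k x)"
proof (rule Bochner_Integration.integrable_bound)
  have fm [measurable]: "f \<in> borel_measurable torus_measure" using assms by (simp add: torus_L2_rel_def)
  show "integrable torus_measure f"
    using torus_L2_mult_integrable[of f torus_measure "\<lambda>_. 1"] assms by (simp add: torus_L2_rel_def)
  show "(\<lambda>x. complex_of_real (f x) * torus_char k x) \<in> borel_measurable torus_measure" by measurable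
qed (simp add: norm_mult)

lemma fourier_coeff_abs:
  assumes "torus_L2_rel f f"
  shows "fourier_coeff (abs_torus_L2 f) k = (LINT x|torus_measure. complex_of_real (f x) * torus_char (- k) x)"
  using assms by (simp add: fourier_coeff.abs_eq torus_char_def int_vec_uminus)

lemma fourier_coeff_add: "fourier_coeff (u + v) k = fourier_coeff u k + fourier_coeff v k"
proof -
  obtain f g where f: "torus_L2_rel f f" "u = abs_torus_L2 f" and g: "torus_L2_rel g g" "v = abs_torus_L2 g"
    by (metis torus_L2_cases)
  show ?thesis
    unfolding f(2) g(2) abs_torus_L2_add[OF f(1) g(1), symmetric]
    using f(1) g(1) by (simp add: fourier_coeff_abs torus_L2_rel_add distrib_right torus_L2_integrable_char)
qed

lemma fourier_coeff_scaleR: "fourier_coeff (c *\<^sub>R u) k = c *\<^sub>R fourier_coeff u k"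
proof -
  obtain f where f: "torus_L2_rel f f" "u = abs_torus_L2 f" by (metis torus_L2_cases)
  show ?thesis
    unfolding f(2) abs_torus_L2_scale[OF f(1), symmetric]
    using f(1) by (simp add: fourier_coeff_abs torus_L2_rel_scale scaleR_conv_of_real mult.assoc)
qed

lemma fourier_coeff_uminus_index: "fourier_coeff u (- k) = cnj (fourier_coeff u k)"
proof -
  obtain f where f: "torus_L2_rel f f" "u = abs_torus_L2 f" by (metis torus_L2_cases)
  have "complex_of_real (f x) * torus_char (- (- k)) x = cnj (complex_of_real (f x) * torus_char (- k) x)" for x
    by (simp add: cnj_torus_char)
  then have "fourier_coeff u (- k) = (LINT x|torus_measure. cnj (complex_of_real (f x) * torus_char (- k) x))"
    unfolding f(2) fourier_coeff_abs[OF f(1)] by (simp only:)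
  also have "\<dots> = cnj (fourier_coeff u k)"
    unfolding f(2) fourier_coeff_abs[OF f(1)]
    by (rule integral_bounded_linear[OF bounded_linear_cnj]) (rule torus_L2_integrable_char[OF f(1)])
  finally show ?thesis .
qed

text \<open>The nonnegative integral of |f - S|^2, with S the partial Fourier sum over K, is
  computed term by term: two cross terms -s and one square +s leave |u|^2 - s.\<close>

lemma bessel_inequality:
  assumes K: "finite K"
  shows "(\<Sum>k\<in>K. (norm (fourier_coeff u k))\<^sup>2) \<le> (norm u)\<^sup>2"
proof -
  obtain f where f: "torus_L2_rel f f" "u = abs_torus_L2 f" by (metis torus_L2_cases)
  define c where "c = fourier_coeff u"
  define S where "S x = (\<Sum>k\<in>K. c k * torus_char k x)" for x
  define s where "s = (\<Sum>k\<in>K. (norm (c k))\<^sup>2)"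
  have cc: "c k * cnj (c k) = complex_of_real ((norm (c k))\<^sup>2)" for k by (rule complex_norm_square[symmetric])
  have c_int: "(LINT x|torus_measure. complex_of_real (f x) * torus_char k x) = cnj (c k)" for k
    using fourier_coeff_uminus_index[of u k] fourier_coeff_abs[OF f(1), of "- k"] by (simp add: c_def f(2))
  have cnjS: "cnj (S x) = (\<Sum>k\<in>K. cnj (c k) * torus_char (- k) x)" for x by (simp add: S_def cnj_torus_char)
  have f2: "integrable torus_measure (\<lambda>x. complex_of_real ((f x)\<^sup>2))"
    "(LINT x|torus_measure. complex_of_real ((f x)\<^sup>2)) = complex_of_real ((norm u)\<^sup>2)"
    using f(1) by (auto simp: f(2) norm_abs_torus_L2 torus_L2_rel_def simp del: of_real_power)
  have fS: "integrable torus_measure (\<lambda>x. complex_of_real (f x) * cnj (S x))"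
    "(LINT x|torus_measure. complex_of_real (f x) * cnj (S x)) = complex_of_real s"
  proof -
    have eq: "complex_of_real (f x) * cnj (S x) = (\<Sum>k\<in>K. cnj (c k) * (complex_of_real (f x) * torus_char (- k) x))" for x
      by (simp add: cnjS sum_distrib_left mult_ac)
    show "integrable torus_measure (\<lambda>x. complex_of_real (f x) * cnj (S x))"
      unfolding eq by (intro Bochner_Integration.integrable_sum integrable_mult_right torus_L2_integrable_char f)
    show "(LINT x|torus_measure. complex_of_real (f x) * cnj (S x)) = complex_of_real s"
      unfolding eq s_def of_real_sum cc[symmetric]
      using f(1) by (subst Bochner_Integration.integral_sum)
        (auto simp: torus_L2_integrable_char c_int c_def fourier_coeff_uminus_index mult.commute)
  qed
  have Sf: "integrable torus_measure (\<lambda>x. complex_of_real (f x) * S x)"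
    "(LINT x|torus_measure. complex_of_real (f x) * S x) = complex_of_real s"
  proof -
    have eq: "complex_of_real (f x) * S x = (\<Sum>k\<in>K. c k * (complex_of_real (f x) * torus_char k x))" for x
      by (simp add: S_def sum_distrib_left mult_ac)
    show "integrable torus_measure (\<lambda>x. complex_of_real (f x) * S x)"
      unfolding eq by (intro Bochner_Integration.integrable_sum integrable_mult_right torus_L2_integrable_char f)
    show "(LINT x|torus_measure. complex_of_real (f x) * S x) = complex_of_real s"
      unfolding eq s_def of_real_sum cc[symmetric]
      using f(1) by (subst Bochner_Integration.integral_sum) (auto simp: torus_L2_integrable_char c_int)
  qed
  have one: "torus_L2_rel (\<lambda>_. 1) (\<lambda>_. 1)" by (rule torus_L2_bounded[of _ 1]) auto
  have ch: "integrable torus_measure (torus_char k)" for k :: "int ^ 'a"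
    using torus_L2_integrable_char[OF one, of k] by simp
  have SS: "integrable torus_measure (\<lambda>x. S x * cnj (S x))"
    "(LINT x|torus_measure. S x * cnj (S x)) = complex_of_real s"
  proof -
    have eq: "S x * cnj (S x) = (\<Sum>k\<in>K. \<Sum>l\<in>K. c k * cnj (c l) * torus_char (k - l) x)" for x
      unfolding cnjS unfolding S_def sum_product
      by (intro sum.cong refl) (simp add: mult_ac flip: torus_char_mult_uminus)
    show "integrable torus_measure (\<lambda>x. S x * cnj (S x))"
      unfolding eq by (intro Bochner_Integration.integrable_sum integrable_mult_right ch)
    have "(LINT x|torus_measure. S x * cnj (S x)) = (\<Sum>k\<in>K. \<Sum>l\<in>K. c k * cnj (c l) * (if k - l = 0 then 1 else 0))"
      unfolding eq by (simp add: ch integral_torus_char)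
    also have "\<dots> = (\<Sum>k\<in>K. \<Sum>l\<in>K. if l = k then c k * cnj (c k) else 0)"
      by (intro sum.cong refl) auto
    also have "\<dots> = complex_of_real s" using K by (simp add: sum.delta s_def cc)
    finally show "(LINT x|torus_measure. S x * cnj (S x)) = complex_of_real s" .
  qed
  have expand: "complex_of_real ((norm (complex_of_real (f x) - S x))\<^sup>2) =
      complex_of_real ((f x)\<^sup>2) - complex_of_real (f x) * cnj (S x) - complex_of_real (f x) * S x + S x * cnj (S x)" for x
    unfolding complex_norm_square by (simp add: algebra_simps power2_eq_square)
  have "(LINT x|torus_measure. complex_of_real ((norm (complex_of_real (f x) - S x))\<^sup>2)) =
      complex_of_real ((norm u)\<^sup>2) - complex_of_real s - complex_of_real s + complex_of_real s"
    unfolding expand using f2 fS Sf SS by (simp del: of_real_power)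
  then have "complex_of_real (LINT x|torus_measure. (norm (complex_of_real (f x) - S x))\<^sup>2) = complex_of_real ((norm u)\<^sup>2 - s)"
    by (simp del: of_real_power)
  then have "(LINT x|torus_measure. (norm (complex_of_real (f x) - S x))\<^sup>2) = (norm u)\<^sup>2 - s"
    unfolding of_real_eq_iff .
  moreover have "0 \<le> (LINT x|torus_measure. (norm (complex_of_real (f x) - S x))\<^sup>2)" by simp
  ultimately show ?thesis by (simp add: s_def c_def)
qed

lemma norm_fourier_coeff_le: "norm (fourier_coeff u k) \<le> norm u"
  using bessel_inequality[of "{k}" u] by (simp add: power2_le_iff_abs_le)

lemma bounded_linear_fourier_coeff: "bounded_linear (\<lambda>u. fourier_coeff u k)"
  by (rule bounded_linear_intro[where K = 1])
    (auto simp: fourier_coeff_add fourier_coeff_scaleR norm_fourier_coeff_le)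

lemma fourier_coeff_summable: "(\<lambda>k. (norm (fourier_coeff u k))\<^sup>2) summable_on UNIV"
  by (rule nonneg_bdd_above_summable_on)
    (auto intro!: bdd_aboveI[of _ "(norm u)\<^sup>2"] bessel_inequality)

text \<open>An element with vanishing coefficients is orthogonal to the sines and cosines, hence to
  the closure of their span, which is everything. Consequently a Fourier multiplier determines its
  image uniquely.\<close>

lemma fourier_coeff_eqI:
  assumes "\<And>k. fourier_coeff u k = fourier_coeff v k"
  shows "u = v"
proof -
  define w where "w = u - v"
  have "fourier_coeff w k = 0" for k
    using assms[of k] linear_diff[OF bounded_linear.linear[OF bounded_linear_fourier_coeff[of k]], of u v] by (simp add: w_def)
  moreover obtain f where f: "torus_L2_rel f f" "w = abs_torus_L2 f" by (metis torus_L2_cases)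
  ultimately have 0: "(LINT x|torus_measure. complex_of_real (f x) * torus_char k x) = 0" for k
    using fourier_coeff_abs[OF f(1), of "- k"] by (metis minus_minus)
  have re: "(LINT x|torus_measure. f x * cos (2 * pi * (int_vec k \<bullet> x))) = 0" for k
    using integral_Re[OF torus_L2_integrable_char[OF f(1)], of k] unfolding 0 by (simp add: torus_char_def)
  have im: "(LINT x|torus_measure. f x * sin (2 * pi * (int_vec k \<bullet> x))) = 0" for k
    using integral_Im[OF torus_L2_integrable_char[OF f(1)], of k] unfolding 0 by (simp add: torus_char_def)
  have "trig_basis \<subseteq> {z. w \<bullet> z = 0}"
    using re im f(1) unfolding trig_basis_def f(2)
    by (auto simp: inner_abs_torus_L2 trig_poly_torus_L2 trig_poly.cos trig_poly.sin)
  then have "span trig_basis \<subseteq> {z. w \<bullet> z = 0}"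
    by (rule span_minimal) (auto intro!: subspaceI simp: inner_add_right)
  moreover have "closed {z. w \<bullet> z = 0}"
    by (intro closed_Collect_eq continuous_intros)
  ultimately have "closure (span trig_basis) \<subseteq> {z. w \<bullet> z = 0}" by (rule closure_minimal)
  then have "w \<in> {z. w \<bullet> z = 0}" unfolding trig_polys_dense by (rule subsetD) (rule UNIV_I)
  then show ?thesis by (simp add: w_def)
qed

lemma fourier_multiplier_eqI: "is_fourier_multiplier a u w \<Longrightarrow> fourier_multiplier a u = w"
  unfolding fourier_multiplier_def
  by (rule the_equality) (auto simp: is_fourier_multiplier_def intro!: fourier_coeff_eqI)

lemma torus_continuous_L2:
  assumes "continuous_on UNIV (g :: real ^ 'n::finite \<Rightarrow> real)"
  shows "torus_L2_rel g g"
proof -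
  have "compact (g ` cbox 0 1)"
    using assms by (intro compact_continuous_image compact_cbox) (auto intro: continuous_on_subset)
  from compact_imp_bounded[OF this] obtain c where c: "\<And>x. x \<in> cbox 0 1 \<Longrightarrow> \<bar>g x\<bar> \<le> c"
    unfolding bounded_iff by (metis imageI real_norm_def)
  show ?thesis
  proof (rule torus_L2_bounded)
    show "g \<in> borel_measurable torus_measure"
      by (intro borel_measurable_torus borel_measurable_continuous_onI assms)
    show "\<bar>g x\<bar> \<le> c" if "x \<in> unit_cell" for x
      using that by (intro c) (auto simp: mem_box_cart less_imp_le)
  qed
qed

text \<open>The set where two candidates differ inside the open cube is open and null, hence empty;
  closure and periodicity carry the equality to the whole space.\<close>

lemma continuous_representative_eqI:
  fixes g :: "real ^ 'n::finite \<Rightarrow> real"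
  assumes g: "continuous_on UNIV g" "periodic g"
  shows "continuous_representative (abs_torus_L2 g) = g"
  unfolding continuous_representative_def
proof (rule the_equality)
  show "continuous_on UNIV g \<and> periodic g \<and> abs_torus_L2 g = abs_torus_L2 g" using g by simp
  fix h assume h: "continuous_on UNIV h \<and> periodic h \<and> abs_torus_L2 h = abs_torus_L2 g"
  have r: "torus_L2_rel h g"
    using h torus_continuous_L2[of h] torus_continuous_L2[OF g(1)]
    by (subst Quotient_rel[OF Quotient_torus_L2, symmetric]) auto
  then have "AE x in torus_measure. h x = g x" by (simp add: torus_L2_rel_def)
  then have ae: "AE x in lborel. x \<in> unit_cell \<longrightarrow> h x = g x"
    unfolding torus_measure_def by (subst (asm) AE_restrict_space_iff) auto
  let ?N = "{x. h x \<noteq> g x} \<inter> box 0 1"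
  have "open {x. h x \<noteq> g x}" using h g by (intro open_Collect_neq) auto
  then have N: "open ?N" by (intro open_Int open_box)
  have "AE x in lborel. x \<notin> ?N"
    using ae by eventually_elim (auto simp: mem_box_cart less_imp_le)
  then have "emeasure lborel ?N = 0"
    using N by (subst (asm) AE_iff_measurable[of ?N]) auto
  then have "?N \<in> null_sets lborel" using N by auto
  then have "negligible ?N"
    by (simp add: negligible_iff_null_sets null_sets_completionI)
  then have "?N = {}" using open_not_negligible[OF N] by blast
  then have "box 0 1 \<subseteq> {x. h x = g x}" by auto
  moreover have "closed {x. h x = g x}" using h g by (intro closed_Collect_eq) auto
  ultimately have "closure (box 0 1) \<subseteq> {x. h x = g x}" by (rule closure_minimal)
  moreover have "box 0 (1 :: real ^ 'n) \<noteq> {}"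
  proof -
    have "(\<chi> i. 1/2) \<in> box 0 (1 :: real ^ 'n)" by (simp add: mem_box_cart)
    then show ?thesis by blast
  qed
  ultimately have eq: "h x = g x" if "x \<in> cbox 0 1" for x using that by auto
  show "h = g"
  proof
    fix x :: "real ^ 'n"
    define k :: "int ^ 'n" where "k = (\<chi> i. - \<lfloor>x $ i\<rfloor>)"
    have "x + int_vec k \<in> cbox 0 1"
      using of_int_floor_le[of "x $ _"] real_of_int_floor_add_one_ge[of "x $ _"]
      by (auto simp: mem_box_cart k_def int_vec_def algebra_simps)
    from eq[OF this] show "h x = g x" using h g(2) by (simp add: periodic_def)
  qed
qed

text \<open>The Weierstrass test gives uniform convergence, which passes to continuity and to
  integrals against characters. The symmetry of c makes the sum real, so that taking
  \<open>Re\<close> loses nothing.\<close>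

lemma absolutely_convergent_fourier_series:
  fixes c :: "int ^ 'n::finite \<Rightarrow> complex"
  assumes c: "(\<lambda>k. norm (c k)) summable_on UNIV" and sym: "\<And>k. c (- k) = cnj (c k)"
  defines "g \<equiv> \<lambda>x. Re (\<Sum>\<^sub>\<infinity>k. c k * torus_char k x)"
  shows "continuous_on UNIV g" "periodic g" "fourier_coeff (abs_torus_L2 g) k = c k"
proof -
  define h where "h x = (\<Sum>\<^sub>\<infinity>k. c k * torus_char k x)" for x
  have ul: "uniform_limit UNIV (\<lambda>F x. \<Sum>k\<in>F. c k * torus_char k x) h (finite_subsets_at_top UNIV)"
    unfolding h_def by (rule Weierstrass_m_test_general[OF _ c]) (simp add: norm_mult)
  have hc: "continuous_on UNIV h"
    by (rule uniform_limit_theorem[OF _ ul]) (auto intro!: always_eventually continuous_intros continuous_torus_char)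
  have gh: "g x = Re (h x)" for x by (simp add: g_def h_def)
  show gc: "continuous_on UNIV g" unfolding gh[abs_def] by (intro continuous_intros hc)
  show "periodic g" unfolding periodic_def g_def by (simp add: periodic_torus_char)
  have "cnj (h x) = h x" for x
  proof -
    have "cnj (h x) = (\<Sum>\<^sub>\<infinity>k. c (- k) * torus_char (- k) x)"
      unfolding h_def infsum_cnj[symmetric] by (simp add: sym cnj_torus_char)
    also have "\<dots> = h x"
      unfolding h_def by (rule infsum_reindex_bij_betw) (auto intro!: bij_betwI[of _ _ _ uminus])
    finally show ?thesis .
  qed
  then have hr: "complex_of_real (g x) = h x" for x
    by (metis gh complex_is_Real_iff Reals_cnj_iff of_real_Re)
  have one: "torus_L2_rel (\<lambda>_. 1) (\<lambda>_. 1)" by (rule torus_L2_bounded[of _ 1]) auto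
  have ch: "integrable torus_measure (torus_char k)" for k :: "int ^ 'n"
    using torus_L2_integrable_char[OF one, of k] by simp
  have hi: "integrable torus_measure (\<lambda>x. h x * torus_char (- k) x)"
    using torus_L2_integrable_char[OF torus_continuous_L2[OF gc], of "- k"] by (simp add: hr)
  define I where "I F = (LINT x|torus_measure. (\<Sum>j\<in>F. c j * torus_char j x) * torus_char (- k) x)" for F
  have Si: "integrable torus_measure (\<lambda>x. (\<Sum>j\<in>F. c j * torus_char j x) * torus_char (- k) x)" for F
    unfolding sum_distrib_right mult.assoc torus_char_mult
    by (intro Bochner_Integration.integrable_sum integrable_mult_right ch)
  have I: "I F = (if k \<in> F then c k else 0)" if "finite F" for F
  proof -
    have "I F = (\<Sum>j\<in>F. c j * (if j = k then 1 else 0))"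
      unfolding I_def sum_distrib_right mult.assoc torus_char_mult
      by (simp add: ch integral_torus_char)
    also have "\<dots> = (\<Sum>j\<in>F. if j = k then c k else 0)" by (intro sum.cong) auto
    finally show ?thesis using that by (simp add: sum.delta')
  qed
  have "\<forall>\<^sub>F F in finite_subsets_at_top UNIV. finite F \<and> k \<in> F"
    unfolding eventually_finite_subsets_at_top by (rule exI[of _ "{k}"]) auto
  then have "\<forall>\<^sub>F F in finite_subsets_at_top UNIV. I F = c k"
    by eventually_elim (simp add: I)
  then have lim1: "(I \<longlongrightarrow> c k) (finite_subsets_at_top UNIV)"
    by (rule tendsto_eventually)
  have lim2: "(I \<longlongrightarrow> (LINT x|torus_measure. h x * torus_char (- k) x)) (finite_subsets_at_top UNIV)"
  proof (rule tendstoI)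
    fix e :: real assume e: "e > 0"
    have "\<forall>\<^sub>F F in finite_subsets_at_top UNIV. \<forall>x\<in>UNIV. dist (\<Sum>k\<in>F. c k * torus_char k x) (h x) < e / 2"
      by (rule uniform_limitD[OF ul]) (use e in simp)
    then show "\<forall>\<^sub>F F in finite_subsets_at_top UNIV. dist (I F) (LINT x|torus_measure. h x * torus_char (- k) x) < e"
    proof eventually_elim
      case (elim F)
      have "I F - (LINT x|torus_measure. h x * torus_char (- k) x) =
          (LINT x|torus_measure. (\<Sum>j\<in>F. c j * torus_char j x) * torus_char (- k) x - h x * torus_char (- k) x)"
        unfolding I_def by (rule Bochner_Integration.integral_diff[symmetric, OF Si hi])
      also have "norm \<dots> \<le> (LINT x|(torus_measure :: (real ^ 'n) measure). e / 2)"
      proof (rule Bochner_Integration.integral_norm_bound_integral)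
        show "integrable torus_measure (\<lambda>x. (\<Sum>j\<in>F. c j * torus_char j x) * torus_char (- k) x - h x * torus_char (- k) x)"
          by (intro Bochner_Integration.integrable_diff Si hi)
        fix x
        show "norm ((\<Sum>j\<in>F. c j * torus_char j x) * torus_char (- k) x - h x * torus_char (- k) x) \<le> e / 2"
          using elim by (simp add: norm_mult dist_norm less_imp_le flip: left_diff_distrib)
      qed simp
      also have "\<dots> = e / 2" by (simp add: torus.prob_space[unfolded space_torus_measure])
      also have "\<dots> < e" using e by simp
      finally show ?case by (simp add: dist_norm)
    qed
  qed
  have "c k = (LINT x|torus_measure. h x * torus_char (- k) x)"
    by (rule tendsto_unique[OF _ lim1 lim2]) simp
  then show "fourier_coeff (abs_torus_L2 g) k = c k"
    by (simp add: fourier_coeff_abs[OF torus_continuous_L2[OF gc]] hr)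
qed

text \<open>Square summability of a and of the Fourier coefficients makes the series of their
  products absolutely convergent, so the image under the multiplier has a continuous representative
  given by its Fourier series.\<close>

lemma fourier_multiplier_point_evaluation:
  fixes a :: "int ^ 'n::finite \<Rightarrow> real"
  assumes a: "(\<lambda>k. (a k)\<^sup>2) summable_on UNIV" and sym: "\<And>k. a (- k) = a k"
  shows "bounded_linear (\<lambda>u. continuous_representative (fourier_multiplier a u) x)"
proof -
  define c where "c u k = complex_of_real (a k) * fourier_coeff u k" for u k
  have bound: "norm (c u k) \<le> (a k)\<^sup>2 + (norm (fourier_coeff u k))\<^sup>2" for u k
  proof -
    have "2 * (\<bar>a k\<bar> * norm (fourier_coeff u k)) \<le> \<bar>a k\<bar>\<^sup>2 + (norm (fourier_coeff u k))\<^sup>2"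
      using sum_squares_bound[of "\<bar>a k\<bar>" "norm (fourier_coeff u k)"] by simp
    moreover have "0 \<le> \<bar>a k\<bar> * norm (fourier_coeff u k)" by simp
    ultimately have "\<bar>a k\<bar> * norm (fourier_coeff u k) \<le> (a k)\<^sup>2 + (norm (fourier_coeff u k))\<^sup>2"
      unfolding power2_abs by linarith
    then show ?thesis by (simp add: c_def norm_mult)
  qed
  have s: "(\<lambda>k. (a k)\<^sup>2 + (norm (fourier_coeff u k))\<^sup>2) summable_on UNIV" for u
    by (intro summable_on_add a fourier_coeff_summable)
  have cs: "(\<lambda>k. norm (c u k)) summable_on UNIV" for u
    by (rule summable_on_comparison_test[OF s[of u]]) (use bound in auto)
  have csym: "c u (- k) = cnj (c u k)" for u k
    by (simp add: c_def sym fourier_coeff_uminus_index)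
  define T where "T u = Re (\<Sum>\<^sub>\<infinity>k. c u k * torus_char k x)" for u
  have T: "continuous_representative (fourier_multiplier a u) x = T u" for u
  proof -
    note series = absolutely_convergent_fourier_series[OF cs[of u] csym]
    have "is_fourier_multiplier a u (abs_torus_L2 (\<lambda>x. Re (\<Sum>\<^sub>\<infinity>k. c u k * torus_char k x)))"
      unfolding is_fourier_multiplier_def series(3) by (simp add: c_def)
    then show ?thesis
      unfolding T_def by (simp add: fourier_multiplier_eqI continuous_representative_eqI series)
  qed
  have sm: "(\<lambda>k. c u k * torus_char k x) summable_on UNIV" for u
    by (rule abs_summable_summable) (use cs[of u] in \<open>simp add: norm_mult\<close>)
  have T_add: "T (u + v) = T u + T v" for u v
  proof -
    have "(\<Sum>\<^sub>\<infinity>k. c (u + v) k * torus_char k x) = (\<Sum>\<^sub>\<infinity>k. c u k * torus_char k x + c v k * torus_char k x)"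
      by (simp add: c_def fourier_coeff_add algebra_simps)
    then show ?thesis unfolding T_def using infsum_add[OF sm sm, of u v] by simp
  qed
  have T_scale: "T (r *\<^sub>R u) = r *\<^sub>R T u" for r u
  proof -
    have "(\<Sum>\<^sub>\<infinity>k. c (r *\<^sub>R u) k * torus_char k x) = (\<Sum>\<^sub>\<infinity>k. complex_of_real r * (c u k * torus_char k x))"
      by (simp add: c_def fourier_coeff_scaleR scaleR_conv_of_real algebra_simps)
    then show ?thesis unfolding T_def using infsum_cmult_right[OF sm[of u], of "complex_of_real r"] by simp
  qed
  \<comment> \<open>The bound a^2 + |c|^2 for a product is not homogeneous in u. It is therefore
    used on unit vectors, where Bessel's inequality contributes the summand 1, and the result is
    scaled.\<close>
  define C where "C = (\<Sum>\<^sub>\<infinity>k. (a k)\<^sup>2) + 1"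
  have unit: "\<bar>T w\<bar> \<le> C" if "norm w = 1" for w
  proof -
    have "\<bar>T w\<bar> \<le> norm (\<Sum>\<^sub>\<infinity>k. c w k * torus_char k x)" unfolding T_def by (rule abs_Re_le_cmod)
    also have "\<dots> \<le> (\<Sum>\<^sub>\<infinity>k. norm (c w k * torus_char k x))"
      by (rule norm_infsum_bound) (use cs[of w] in \<open>simp add: norm_mult\<close>)
    also have "\<dots> = (\<Sum>\<^sub>\<infinity>k. norm (c w k))" by (simp add: norm_mult)
    also have "\<dots> \<le> (\<Sum>\<^sub>\<infinity>k. (a k)\<^sup>2 + (norm (fourier_coeff w k))\<^sup>2)"
      by (rule infsum_mono[OF cs s]) (rule bound)
    also have "\<dots> = (\<Sum>\<^sub>\<infinity>k. (a k)\<^sup>2) + (\<Sum>\<^sub>\<infinity>k. (norm (fourier_coeff w k))\<^sup>2)"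
      by (rule infsum_add[OF a fourier_coeff_summable])
    also have "(\<Sum>\<^sub>\<infinity>k. (norm (fourier_coeff w k))\<^sup>2) \<le> 1"
      by (rule infsum_le_finite_sums[OF fourier_coeff_summable]) (use bessel_inequality[of _ w] that in auto)
    finally show ?thesis by (simp add: C_def)
  qed
  have "norm (T u) \<le> norm u * C" for u
  proof (cases "u = 0")
    case True
    then show ?thesis using T_scale[of 0 u] by simp
  next
    case False
    have "T u = norm u *\<^sub>R T (u /\<^sub>R norm u)"
      using False by (simp add: T_scale)
    then show ?thesis using unit[of "u /\<^sub>R norm u"] False by (simp add: abs_mult mult_left_mono)
  qed
  then have "bounded_linear T" by (intro bounded_linear_intro[where K = C] T_add T_scale)
  then show ?thesis unfolding T .
qed

section \<open>Lattice sums and decay of the symbol\<close>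

lemma summable_int_powr:
  assumes "1 < p"
  shows "(\<lambda>j::int. (1 + \<bar>real_of_int j\<bar>) powr (- p)) summable_on UNIV"
proof -
  have "summable (\<lambda>n. real (Suc n) powr (- p))"
    using assms by (subst summable_Suc_iff) (simp add: summable_real_powr_iff)
  then have 1: "(\<lambda>n. real (Suc n) powr (- p)) summable_on UNIV"
    by (intro summable_nonneg_imp_summable_on) auto
  have "(\<lambda>j::int. (1 + \<bar>real_of_int j\<bar>) powr (- p)) summable_on range int"
    by (subst summable_on_reindex) (use 1 in \<open>auto simp: o_def add.commute\<close>)
  moreover have "(\<lambda>j::int. (1 + \<bar>real_of_int j\<bar>) powr (- p)) summable_on range (\<lambda>n. - int n)"
    by (subst summable_on_reindex) (use 1 in \<open>auto simp: o_def add.commute inj_def\<close>)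
  ultimately have "(\<lambda>j::int. (1 + \<bar>real_of_int j\<bar>) powr (- p)) summable_on (range int \<union> range (\<lambda>n. - int n))"
    by (rule summable_on_union)
  moreover have "range int \<union> range (\<lambda>n. - int n) = UNIV"
    by (auto intro: int_cases2)
  ultimately show ?thesis by simp
qed

lemma summable_int_vec_product:
  fixes \<phi> :: "int \<Rightarrow> real"
  assumes \<phi>: "\<phi> summable_on UNIV" "\<And>j. 0 \<le> \<phi> j"
  shows "(\<lambda>k :: int ^ 'n::finite. \<Prod>i\<in>UNIV. \<phi> (k $ i)) summable_on UNIV"
proof (rule nonneg_bdd_above_summable_on)
  show "0 \<le> (\<Prod>i\<in>UNIV. \<phi> (k $ i))" for k :: "int ^ 'n" using \<phi>(2) by (simp add: prod_nonneg)
  show "bdd_above (sum (\<lambda>k :: int ^ 'n. \<Prod>i\<in>UNIV. \<phi> (k $ i)) ` {F. F \<subseteq> UNIV \<and> finite F})"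
  proof (rule bdd_aboveI2)
    fix F :: "(int ^ 'n) set" assume "F \<in> {F. F \<subseteq> UNIV \<and> finite F}"
    then have F: "finite F" by simp
    \<comment> \<open>All coordinates that occur in F: the sum over F is at most the sum over the
      box with sides J, and the latter factorises.\<close>
    define J where "J = (\<Union>k\<in>F. range (\<lambda>i. k $ i))"
    have J: "finite J" using F by (simp add: J_def)
    have "(\<Sum>k\<in>F. \<Prod>i\<in>UNIV. \<phi> (k $ i)) = (\<Sum>f\<in>vec_nth ` F. \<Prod>i\<in>UNIV. \<phi> (f i))"
      by (subst sum.reindex) (auto simp: inj_on_def vec_nth_inject)
    also have "\<dots> \<le> (\<Sum>f\<in>PiE (UNIV :: 'n set) (\<lambda>_. J). \<Prod>i\<in>UNIV. \<phi> (f i))"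
    proof (rule sum_mono2)
      show "finite (PiE (UNIV :: 'n set) (\<lambda>_. J))" using J by (intro finite_PiE) auto
      show "vec_nth ` F \<subseteq> PiE UNIV (\<lambda>_. J)" by (auto simp: J_def)
      show "0 \<le> (\<Prod>i\<in>UNIV. \<phi> (f i))" for f :: "'n \<Rightarrow> int" using \<phi>(2) by (simp add: prod_nonneg)
    qed
    also have "\<dots> = (\<Prod>i\<in>(UNIV :: 'n set). \<Sum>j\<in>J. \<phi> j)"
      using J by (intro prod_sum_PiE[symmetric]) auto
    also have "\<dots> \<le> (\<Prod>i\<in>(UNIV :: 'n set). infsum \<phi> UNIV)"
      using \<phi> J by (intro prod_mono conjI sum_nonneg finite_sum_le_infsum) auto
    finally show "(\<Sum>k\<in>F. \<Prod>i\<in>UNIV. \<phi> (k $ i)) \<le> (\<Prod>i\<in>(UNIV :: 'n set). infsum \<phi> UNIV)" .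
  qed
qed

lemma one_plus_norm_int_vec_pos: "0 < 1 + norm (int_vec k)"
  by (simp add: add_pos_nonneg)

text \<open>Distributing the exponent evenly over the n coordinates and using |k_i| \<le> |k| bounds
  each term by a product of one-dimensional terms with exponent p / n > 1.\<close>

lemma summable_int_vec_powr:
  assumes p: "real CARD('n::finite) < p"
  shows "(\<lambda>k :: int ^ 'n. (1 + norm (int_vec k)) powr (- p)) summable_on UNIV"
proof (rule summable_on_comparison_test)
  let ?n = "real CARD('n)"
  have n: "?n > 0" by simp
  show "(\<lambda>k :: int ^ 'n. \<Prod>i\<in>UNIV. (1 + \<bar>real_of_int (k $ i)\<bar>) powr (- (p / ?n))) summable_on UNIV"
    using p n by (intro summable_int_vec_product summable_int_powr) auto
  fix k :: "int ^ 'n"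
  have "(1 + norm (int_vec k)) powr (- p) = (\<Prod>i\<in>(UNIV :: 'n set). (1 + norm (int_vec k)) powr (- (p / ?n)))"
    using n one_plus_norm_int_vec_pos[of k] by (subst prod_constant, subst powr_power) auto
  also have "\<dots> \<le> (\<Prod>i\<in>UNIV. (1 + \<bar>real_of_int (k $ i)\<bar>) powr (- (p / ?n)))"
  proof (intro prod_mono conjI)
    fix i :: 'n
    have "\<bar>int_vec k $ i\<bar> \<le> norm (int_vec k)" by (rule component_le_norm_cart)
    then show "(1 + norm (int_vec k)) powr (- (p / ?n)) \<le> (1 + \<bar>real_of_int (k $ i)\<bar>) powr (- (p / ?n))"
      using p n by (intro powr_mono2') (auto simp: int_vec_def)
  qed simp
  finally show "(1 + norm (int_vec k)) powr (- p) \<le> (\<Prod>i\<in>UNIV. (1 + \<bar>real_of_int (k $ i)\<bar>) powr (- (p / ?n)))" .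
qed simp

lemma norm_int_vec_ge_1:
  assumes "k \<noteq> 0"
  shows "1 \<le> norm (int_vec k)"
proof -
  obtain i where "k $ i \<noteq> 0" using assms by (auto simp: vec_eq_iff)
  then have "1 \<le> \<bar>int_vec k $ i\<bar>" by (simp add: int_vec_def)
  also have "\<dots> \<le> norm (int_vec k)" by (rule component_le_norm_cart)
  finally show ?thesis .
qed

lemma summable_mittag_leffler_symbol:
  assumes \<alpha>: "0 < \<alpha>" "\<alpha> \<le> 1" and \<beta>: "real CARD('n::finite) / 4 < \<beta>" "\<beta> \<le> 1"
  shows "(\<lambda>k :: int ^ 'n. (mittag_leffler \<alpha> (- frac_laplacian_symbol \<beta> k))\<^sup>2) summable_on UNIV"
proof (rule summable_on_comparison_test)
  define G where "G = Gamma (\<alpha> + 1)"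
  have G: "G > 0" using \<alpha> by (simp add: G_def Gamma_real_pos)
  \<comment> \<open>The 1 serves k = 0, where the symbol vanishes. For k \<noteq> 0, 1 + |k| \<le> 2
    |k| and 2 powr (2 * \<beta>) \<le> 4, so (1 + |k|) powr (2 * \<beta>) is at most four times the
    symbol; hence 4 * G.\<close>
  define D where "D = max 1 (4 * G)"
  show "(\<lambda>k :: int ^ 'n. D\<^sup>2 * (1 + norm (int_vec k)) powr (- (4 * \<beta>))) summable_on UNIV"
    using \<beta> by (intro summable_on_cmult_right summable_int_vec_powr) simp
  fix k :: "int ^ 'n"
  let ?N = "norm (int_vec k)" and ?l = "frac_laplacian_symbol \<beta> k"
  have \<beta>0: "\<beta> > 0" using \<beta>(1) by (rule le_less_trans[rotated]) simp
  have l: "0 \<le> ?l" by (simp add: frac_laplacian_symbol_def)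
  note ml = mittag_leffler_bounds[OF \<alpha> l]
  have "mittag_leffler \<alpha> (- ?l) \<le> D * (1 + ?N) powr (- (2 * \<beta>))"
  proof (cases "k = 0")
    case True
    then show ?thesis using ml(2) \<beta>0 by (simp add: frac_laplacian_symbol_def D_def)
  next
    case False
    note N = norm_int_vec_ge_1[OF this]
    have "1 \<le> pi\<^sup>2" using pi_ge_two by (intro one_le_power) simp
    then have "1 \<le> 4 * pi\<^sup>2" by simp
    then have "?N\<^sup>2 \<le> 4 * pi\<^sup>2 * ?N\<^sup>2" using mult_right_mono[of 1 "4 * pi\<^sup>2" "?N\<^sup>2"] by simp
    then have "(?N\<^sup>2) powr \<beta> \<le> ?l" unfolding frac_laplacian_symbol_def using \<beta>0 by (intro powr_mono2) auto
    moreover have N2: "(?N\<^sup>2) powr \<beta> = ?N powr (2 * \<beta>)" using N by (simp add: powr_powr flip: powr_numeral)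
    ultimately have lN: "?N powr (2 * \<beta>) \<le> ?l" by simp
    have "(1 + ?N) powr (2 * \<beta>) \<le> (2 * ?N) powr (2 * \<beta>)" using N \<beta>0 by (intro powr_mono2) auto
    also have "\<dots> = 2 powr (2 * \<beta>) * ?N powr (2 * \<beta>)" using N by (simp add: powr_mult)
    also have "\<dots> \<le> 4 * ?l"
    proof (rule mult_mono[OF _ lN])
      have "2 powr (2 * \<beta>) \<le> 2 powr (2 :: real)" using \<beta> by (intro powr_mono) auto
      then show "2 powr (2 * \<beta>) \<le> (4 :: real)" by simp
    qed auto
    finally have le: "(1 + ?N) powr (2 * \<beta>) \<le> 4 * ?l" .
    have pos: "0 < (1 + ?N) powr (2 * \<beta>)" using N by simp
    then have lpos: "0 < ?l" using le by linarith
    have "mittag_leffler \<alpha> (- ?l) \<le> 1 / (1 + ?l / G)" using ml(2) by (simp add: G_def)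
    also have "\<dots> \<le> 1 / (?l / G)" using lpos G by (intro divide_left_mono mult_pos_pos add_pos_pos) auto
    also have "\<dots> = 4 * G / (4 * ?l)" by simp
    also have "\<dots> \<le> 4 * G / (1 + ?N) powr (2 * \<beta>)"
      using le pos lpos G by (intro divide_left_mono) auto
    also have "\<dots> \<le> D / (1 + ?N) powr (2 * \<beta>)"
      using pos by (intro divide_right_mono) (auto simp: D_def)
    finally show ?thesis by (simp add: powr_minus divide_inverse)
  qed
  from power_mono[OF this ml(1), of 2]
  show "(mittag_leffler \<alpha> (- ?l))\<^sup>2 \<le> D\<^sup>2 * (1 + ?N) powr (- (4 * \<beta>))"
    using one_plus_norm_int_vec_pos[of k] by (simp add: power_mult_distrib powr_power)
qed simp

lemma measurable_forward_observation:
  fixes x :: "'k::finite \<Rightarrow> real ^ 'n::finite"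
  assumes "0 < \<alpha>" "\<alpha> \<le> 1" "real CARD('n) / 4 < \<beta>" "\<beta> \<le> 1"
  shows "(\<lambda>u. point_values x (forward_map \<alpha> \<beta> u)) \<in> borel_measurable borel"
proof -
  have "bounded_linear (\<lambda>u. continuous_representative (forward_map \<alpha> \<beta> u) (x i))" for i
    unfolding forward_map_def using assms
    by (intro fourier_multiplier_point_evaluation summable_mittag_leffler_symbol)
      (auto simp: frac_laplacian_symbol_def int_vec_uminus)
  then have "(\<lambda>u. continuous_representative (forward_map \<alpha> \<beta> u) (x i)) \<in> borel_measurable borel" for i
    by (intro borel_measurable_continuous_onI linear_continuous_on)
  then show ?thesis
    by (subst borel_measurable_euclidean_space) (auto simp: Basis_vec_def point_values_def inner_axis)
qed

text \<open>Taking a Fourier coefficient is bounded and linear, so continuity of v down to t = 0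
  passes to each scalar component, for which the weak equation is a relaxation equation.\<close>

lemma frac_diffusion_solution_at_1:
  assumes \<alpha>: "0 < \<alpha>" "\<alpha> \<le> 1" and sol: "frac_diffusion_solution \<alpha> \<beta> u v"
  shows "v 1 = forward_map \<alpha> \<beta> u"
proof -
  have v0: "v 0 = u" and vc: "continuous_on {0..} v"
    using sol by (auto simp: frac_diffusion_solution_def)
  have "is_fourier_multiplier (\<lambda>k. mittag_leffler \<alpha> (- frac_laplacian_symbol \<beta> k)) u (v 1)"
    unfolding is_fourier_multiplier_def
  proof
    fix k
    define f where "f t = fourier_coeff (v t) k" for t
    define l where "l = frac_laplacian_symbol \<beta> k"
    have l: "0 \<le> l" by (simp add: l_def frac_laplacian_symbol_def)
    have fc: "continuous_on {0..} f"
      unfolding f_def by (rule bounded_linear.continuous_on[OF bounded_linear_fourier_coeff vc])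
    have "has_caputo_derivative \<alpha> f (- (l *\<^sub>R f t)) t" if "0 < t" for t
    proof -
      obtain w where w: "frac_laplacian_graph \<beta> (v t) w"
        "has_caputo_derivative \<alpha> (\<lambda>\<tau>. fourier_coeff (v \<tau>) k) (- fourier_coeff w k) t"
        using sol \<open>0 < t\<close> unfolding frac_diffusion_solution_def by blast
      have "fourier_coeff w k = l *\<^sub>R f t"
        using w(1) by (simp add: frac_laplacian_graph_def is_fourier_multiplier_def l_def f_def scaleR_conv_of_real)
      then show ?thesis using w(2) by (simp add: f_def[abs_def])
    qed
    then have "f 1 = mittag_leffler \<alpha> (- l) *\<^sub>R f 0"
      using caputo_relaxation_volterra[OF \<alpha> fc] continuous_on_subset[OF fc, of "{0..1}"]
      by (intro volterra_mittag_leffler[OF \<alpha>(1) l]) auto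
    then show "fourier_coeff (v 1) k = complex_of_real (mittag_leffler \<alpha> (- frac_laplacian_symbol \<beta> k)) * fourier_coeff u k"
      by (simp add: f_def l_def v0 scaleR_conv_of_real)
  qed
  then show ?thesis unfolding forward_map_def by (rule fourier_multiplier_eqI[symmetric])
qed

subsection \<open>Posterior measures for Gaussian observations\<close>

lemma abs_exp_diff_le: "\<bar>exp a - exp b\<bar> \<le> \<bar>a - b\<bar> * max (exp a) (exp (b :: real))"
proof -
  have *: "exp x - exp y \<le> (x - y) * exp x" for x y :: real
  proof -
    have "exp x * (1 + (y - x)) \<le> exp x * exp (y - x)"
      by (intro mult_left_mono exp_ge_add_one_self) auto
    also have "\<dots> = exp y" by (simp flip: exp_add)
    finally show ?thesis by (simp add: algebra_simps)
  qed
  show ?thesis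
  proof (cases "a \<le> b")
    case True
    then show ?thesis using *[of b a] by (simp add: max_def abs_real_def)
  next
    case False
    then show ?thesis using *[of a b] by (simp add: max_def abs_real_def)
  qed
qed

text \<open>With d = b - \<rho> the exponent is (\<rho>^2 - d^2) / 4, while b \<le> (\<rho> + 1) (1
  + d^2 / 4) \<le> (\<rho> + 1) exp (d^2 / 4).\<close>

lemma shifted_gaussian_moment_bound:
  fixes b \<rho> :: real
  assumes "0 \<le> \<rho>"
  shows "b * exp (\<rho> * b / 2 - b\<^sup>2 / 4) \<le> (\<rho> + 1) * exp (\<rho>\<^sup>2 / 4)"
proof -
  define d where "d = b - \<rho>"
  have "b \<le> (\<rho> + 1) * (1 + d\<^sup>2 / 4)"
  proof -
    have "0 \<le> (1 - d / 2)\<^sup>2 + \<rho> * d\<^sup>2 / 4" using assms by simp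
    also have "\<dots> = (\<rho> + 1) * (1 + d\<^sup>2 / 4) - b"
      unfolding d_def by (simp add: field_simps power2_eq_square)
    finally show ?thesis by simp
  qed
  also have "\<dots> \<le> (\<rho> + 1) * exp (d\<^sup>2 / 4)"
    using assms by (intro mult_left_mono exp_ge_add_one_self) auto
  finally have "b * exp (\<rho>\<^sup>2 / 4 - d\<^sup>2 / 4) \<le> (\<rho> + 1) * exp (d\<^sup>2 / 4) * exp (\<rho>\<^sup>2 / 4 - d\<^sup>2 / 4)"
    by (rule mult_right_mono) simp
  also have "\<dots> = (\<rho> + 1) * exp (\<rho>\<^sup>2 / 4)"
    by (simp add: mult.assoc flip: exp_add)
  also have "\<rho>\<^sup>2 / 4 - d\<^sup>2 / 4 = \<rho> * b / 2 - b\<^sup>2 / 4"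
    unfolding d_def by (simp add: field_simps power2_eq_square)
  finally show ?thesis .
qed

lemma gaussian_tilt_bound:
  fixes v b :: "'b::real_inner"
  assumes "norm v \<le> \<rho>"
  shows "v \<bullet> b / 2 - (norm b)\<^sup>2 / 4 \<le> \<rho> * norm b / 2 - (norm b)\<^sup>2 / 4"
  using norm_cauchy_schwarz[of v b] mult_right_mono[OF assms norm_ge_zero[of b]] by simp

text \<open>These exponentials are the square roots of the likelihood. Comparing two of them costs a
  factor |b| / 2, which \<open>shifted_gaussian_moment_bound\<close> absorbs uniformly in b.\<close>

lemma gaussian_tilt_lipschitz:
  fixes v v' b :: "'b::real_inner"
  assumes "norm v \<le> \<rho>" "norm v' \<le> \<rho>"
  shows "\<bar>exp (v \<bullet> b / 2 - (norm b)\<^sup>2 / 4) - exp (v' \<bullet> b / 2 - (norm b)\<^sup>2 / 4)\<bar>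
    \<le> (\<rho> + 1) * exp (\<rho>\<^sup>2 / 4) / 2 * norm (v - v')"
proof -
  have "0 \<le> \<rho>" using assms(1) norm_ge_zero order_trans by blast
  have "\<bar>exp (v \<bullet> b / 2 - (norm b)\<^sup>2 / 4) - exp (v' \<bullet> b / 2 - (norm b)\<^sup>2 / 4)\<bar>
    \<le> \<bar>(v \<bullet> b / 2 - (norm b)\<^sup>2 / 4) - (v' \<bullet> b / 2 - (norm b)\<^sup>2 / 4)\<bar> *
       max (exp (v \<bullet> b / 2 - (norm b)\<^sup>2 / 4)) (exp (v' \<bullet> b / 2 - (norm b)\<^sup>2 / 4))"
    by (rule abs_exp_diff_le)
  also have "\<dots> \<le> (norm (v - v') * norm b / 2) * exp (\<rho> * norm b / 2 - (norm b)\<^sup>2 / 4)"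
  proof (rule mult_mono)
    have "\<bar>(v - v') \<bullet> b\<bar> \<le> norm (v - v') * norm b" by (rule Cauchy_Schwarz_ineq2)
    then show "\<bar>(v \<bullet> b / 2 - (norm b)\<^sup>2 / 4) - (v' \<bullet> b / 2 - (norm b)\<^sup>2 / 4)\<bar> \<le> norm (v - v') * norm b / 2"
      by (simp add: inner_diff_left flip: diff_divide_distrib)
  qed (use gaussian_tilt_bound[OF assms(1), of b] gaussian_tilt_bound[OF assms(2), of b]
      in \<open>auto simp: le_max_iff_disj\<close>)
  also have "\<dots> = norm (v - v') / 2 * (norm b * exp (\<rho> * norm b / 2 - (norm b)\<^sup>2 / 4))" by simp
  also have "\<dots> \<le> norm (v - v') / 2 * ((\<rho> + 1) * exp (\<rho>\<^sup>2 / 4))"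
    by (intro mult_left_mono shifted_gaussian_moment_bound \<open>0 \<le> \<rho>\<close>) auto
  finally show ?thesis by (simp add: mult_ac)
qed

text \<open>Finite intersections of members of a countable base. Agreement of two Borel probability
  measures then has to be checked on countably many sets only.\<close>

lemma countable_Int_stable_generator:
  "\<exists>G :: 'a::second_countable_topology set set.
     countable G \<and> Int_stable G \<and> UNIV \<in> G \<and> borel = sigma UNIV G"
proof -
  obtain B :: "'a set set" where B: "countable B" "topological_basis B"
    using ex_countable_basis by blast
  define G where "G = Inter ` {F. finite F \<and> F \<subseteq> B}"
  have "countable G"
    unfolding G_def by (intro countable_image countable_Collect_finite_subset B)
  moreover have "Int_stable G"
  proof (rule Int_stableI)
    fix a b assume "a \<in> G" "b \<in> G"
    then obtain F F' where "finite F" "F \<subseteq> B" "a = \<Inter>F" "finite F'" "F' \<subseteq> B" "b = \<Inter>F'"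
      unfolding G_def by auto
    then show "a \<inter> b \<in> G"
      unfolding G_def by (intro image_eqI[of _ _ "F \<union> F'"]) auto
  qed
  moreover have "UNIV \<in> G" unfolding G_def by (intro image_eqI[of _ _ "{}"]) auto
  moreover have "borel = sigma UNIV G"
  \<comment> \<open>This is an equation between measures, not just between \<sigma>-algebras:
    \<open>borel\<close> is itself built by \<open>sigma\<close>, which carries the zero
    measure.\<close>
  proof (rule measure_eqI)
    have "sets borel = sigma_sets UNIV B"
      unfolding borel_eq_countable_basis[OF B] by simp
    also have "\<dots> = sigma_sets UNIV G"
    proof (rule sigma_sets_eqI)
      fix a assume "a \<in> B"
      then have "a \<in> G" unfolding G_def by (intro image_eqI[of _ _ "{a}"]) auto
      then show "a \<in> sigma_sets UNIV G" by auto
    next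
      fix a assume "a \<in> G"
      then obtain F where F: "finite F" "F \<subseteq> B" "a = \<Inter>F" unfolding G_def by auto
      then have "open a" using topological_basis_open[OF B(2)] by (metis open_Inter subset_iff)
      then have "a \<in> sets borel" by simp
      then have "a \<in> sets (sigma UNIV B)" unfolding borel_eq_countable_basis[OF B, symmetric] .
      then show "a \<in> sigma_sets UNIV B" by simp
    qed
    finally show "sets borel = sets (sigma UNIV G)" by simp
    show "emeasure borel X = emeasure (sigma UNIV G) X" for X
      by (simp add: emeasure_sigma borel_def)
  qed
  ultimately show ?thesis by blast
qed

text \<open>For fixed A both kernels are densities of one and the same measure with respect to the
  law of Y. The countable generator merges these almost sure equalities into a single one.\<close>

lemma conditional_distribution_unique:
  fixes U :: "'w \<Rightarrow> 'a::second_countable_topology" and Y :: "'w \<Rightarrow> 'b::topological_space"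
  assumes M: "prob_space M" and Y: "Y \<in> borel_measurable M"
    and "conditional_distribution M U Y \<kappa>" "conditional_distribution M U Y \<kappa>'"
  shows "AE y in distr M borel Y. \<kappa> y = \<kappa>' y"
proof -
  interpret prob_space M by (rule M)
  interpret D: prob_space "distr M borel Y" using Y by (rule prob_space_distr)
  have m: "\<kappa> \<in> borel \<rightarrow>\<^sub>M prob_algebra borel" "\<kappa>' \<in> borel \<rightarrow>\<^sub>M prob_algebra borel"
    using assms by (auto simp: conditional_distribution_def)
  have ms: "\<kappa> \<in> borel \<rightarrow>\<^sub>M subprob_algebra borel" "\<kappa>' \<in> borel \<rightarrow>\<^sub>M subprob_algebra borel"
    using m by (auto intro: measurable_prob_algebraD)
  have eqA: "AE y in distr M borel Y. emeasure (\<kappa> y) A = emeasure (\<kappa>' y) A" if A: "A \<in> sets borel" for A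
  proof (rule D.density_unique)
    show 1: "(\<lambda>y. emeasure (\<kappa> y) A) \<in> borel_measurable (distr M borel Y)"
      using measurable_compose[OF ms(1) measurable_emeasure_subprob_algebra[OF A]] by simp
    show 2: "(\<lambda>y. emeasure (\<kappa>' y) A) \<in> borel_measurable (distr M borel Y)"
      using measurable_compose[OF ms(2) measurable_emeasure_subprob_algebra[OF A]] by simp
    show "density (distr M borel Y) (\<lambda>y. emeasure (\<kappa> y) A) = density (distr M borel Y) (\<lambda>y. emeasure (\<kappa>' y) A)"
    proof (rule measure_eqI)
      fix B assume "B \<in> sets (density (distr M borel Y) (\<lambda>y. emeasure (\<kappa> y) A))"
      then have B: "B \<in> sets borel" by simp
      have "(\<integral>\<^sup>+y\<in>B. emeasure (\<kappa> y) A \<partial>distr M borel Y) = (\<integral>\<^sup>+y\<in>B. emeasure (\<kappa>' y) A \<partial>distr M borel Y)"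
      proof -
        have "emeasure M {\<omega> \<in> space M. U \<omega> \<in> A \<and> Y \<omega> \<in> B} = (\<integral>\<^sup>+y\<in>B. emeasure (\<kappa> y) A \<partial>distr M borel Y)"
          "emeasure M {\<omega> \<in> space M. U \<omega> \<in> A \<and> Y \<omega> \<in> B} = (\<integral>\<^sup>+y\<in>B. emeasure (\<kappa>' y) A \<partial>distr M borel Y)"
          using assms(3,4) A B by (simp_all add: conditional_distribution_def)
        then show ?thesis by (rule trans[OF sym])
      qed
      then show "emeasure (density (distr M borel Y) (\<lambda>y. emeasure (\<kappa> y) A)) B =
        emeasure (density (distr M borel Y) (\<lambda>y. emeasure (\<kappa>' y) A)) B"
        using 1 2 B by (simp add: emeasure_density)
    qed simp
  qed
  obtain G :: "'a set set" where G: "countable G" "Int_stable G" "UNIV \<in> G" "borel = sigma UNIV G"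
    using countable_Int_stable_generator by blast
  have Gs: "sets borel = sigma_sets UNIV G" by (simp add: G(4))
  have "AE y in distr M borel Y. \<forall>A\<in>G. emeasure (\<kappa> y) A = emeasure (\<kappa>' y) A"
  proof (subst AE_ball_countable[OF G(1)], rule ballI)
    fix A assume "A \<in> G"
    then have "A \<in> sigma_sets UNIV G" by blast
    then show "AE y in distr M borel Y. emeasure (\<kappa> y) A = emeasure (\<kappa>' y) A"
      unfolding Gs[symmetric] by (rule eqA)
  qed
  then show ?thesis
  proof (rule AE_mp[OF _ AE_I2], intro impI)
    fix y assume eq: "\<forall>A\<in>G. emeasure (\<kappa> y) A = emeasure (\<kappa>' y) A"
    have k: "prob_space (\<kappa> y)" "sets (\<kappa> y) = sets borel" "sets (\<kappa>' y) = sets borel"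
      using measurable_space[OF m(1), of y] measurable_space[OF m(2), of y]
      by (auto simp: space_prob_algebra)
    show "\<kappa> y = \<kappa>' y"
    proof (rule measure_eqI_generator_eq[OF G(2), where \<Omega> = UNIV and A = "\<lambda>_. UNIV"])
      show "emeasure (\<kappa> y) UNIV \<noteq> \<infinity>"
        using finite_measure.emeasure_finite[OF prob_space.finite_measure[OF k(1)]] by simp
      show "sets (\<kappa> y) = sigma_sets UNIV G" "sets (\<kappa>' y) = sigma_sets UNIV G"
        using k(2,3) Gs by (blast intro: trans)+
    qed (use eq G(3) in auto)
  qed
qed

text \<open>\<open>L\<close> stands for the observation map u \<mapsto> \<ell>(G(u)) and
  \<open>R\<close> for the inverse square root of the covariance; \<open>weight y\<close> then
  becomes exp (-\<Phi>(.; y)) and \<open>normaliser y\<close> becomes Z(y).\<close>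

locale gaussian_observation =
  prob_space \<mu> for \<mu> :: "'a::second_countable_topology measure" +
  fixes L :: "'a \<Rightarrow> 'b::euclidean_space" and R :: "'b \<Rightarrow> 'b"
  assumes sets_\<mu>: "sets \<mu> = sets borel"
    and L_measurable: "L \<in> borel_measurable borel"
    and R_linear: "bounded_linear R"
begin

definition weight :: "'b \<Rightarrow> 'a \<Rightarrow> real" where
  "weight y u = exp (- (1 / 2 * (norm (R (y - L u)))\<^sup>2 - 1 / 2 * (norm (R y))\<^sup>2))"

definition normaliser :: "'b \<Rightarrow> real" where
  "normaliser y = (LINT u|\<mu>. weight y u)"

definition posterior :: "'b \<Rightarrow> 'a measure" where
  "posterior y = density \<mu> (\<lambda>u. ennreal (1 / normaliser y * weight y u))"

lemma measurable_weight_pair [measurable]: "(\<lambda>(y, u). weight y u) \<in> borel_measurable (borel \<Otimes>\<^sub>M \<mu>)"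
proof -
  have R: "R \<in> borel_measurable borel"
    by (intro borel_measurable_continuous_onI linear_continuous_on R_linear)
  have "(\<lambda>p. L (snd p)) \<in> borel_measurable (borel \<Otimes>\<^sub>M \<mu>)"
    using L_measurable by (intro measurable_compose[OF measurable_snd]) (simp add: measurable_cong_sets[OF sets_\<mu> refl])
  then have *: "(\<lambda>p. R (fst p - L (snd p))) \<in> borel_measurable (borel \<Otimes>\<^sub>M \<mu>)"
    by (intro measurable_compose[OF _ R] borel_measurable_diff measurable_fst) auto
  have "(\<lambda>p. R (fst p)) \<in> borel_measurable (borel \<Otimes>\<^sub>M \<mu>)"
    by (intro measurable_compose[OF _ R] measurable_fst)
  with * show ?thesis
    unfolding weight_def split_beta by measurable
qed

lemma measurable_weight [measurable]: "weight y \<in> borel_measurable \<mu>"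
  using measurable_compose[OF measurable_Pair1' measurable_weight_pair, of y] by simp

lemma weight_pos: "0 < weight y u"
  by (simp add: weight_def)

text \<open>The term |R y|^2 / 2 subtracted in the potential cancels the part quadratic in y. The
  rest is displayed as a square because the Hellinger distance compares square roots of
  densities.\<close>

lemma weight_eq_square: "weight y u = (exp (R y \<bullet> R (L u) / 2 - (norm (R (L u)))\<^sup>2 / 4))\<^sup>2"
proof -
  have "- (1 / 2 * (norm (R (y - L u)))\<^sup>2 - 1 / 2 * (norm (R y))\<^sup>2) =
      (R y \<bullet> R (L u) / 2 - (norm (R (L u)))\<^sup>2 / 4) + (R y \<bullet> R (L u) / 2 - (norm (R (L u)))\<^sup>2 / 4)"
    unfolding linear_diff[OF bounded_linear.linear[OF R_linear]]
    by (simp add: power2_norm_eq_inner inner_diff_left inner_diff_right inner_commute field_simps)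
  then show ?thesis unfolding weight_def power2_eq_square by (simp flip: exp_add)
qed

lemma integrable_weight: "integrable \<mu> (weight y)"
proof (rule integrable_const_bound[of _ "exp (1 / 2 * (norm (R y))\<^sup>2)"])
  show "AE u in \<mu>. norm (weight y u) \<le> exp (1 / 2 * (norm (R y))\<^sup>2)"
    by (simp add: weight_def)
qed simp

lemma normaliser_pos: "0 < normaliser y"
proof -
  have "normaliser y \<noteq> 0"
  proof
    assume "normaliser y = 0"
    then have "AE u in \<mu>. weight y u = 0"
      unfolding normaliser_def
      by (subst (asm) integral_nonneg_eq_0_iff_AE[OF integrable_weight]) (auto simp: weight_pos less_imp_le)
    then have "AE u in \<mu>. False" by eventually_elim (simp add: less_imp_neq[OF weight_pos, symmetric])
    then show False by simp
  qed
  moreover have "0 \<le> normaliser y"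
    unfolding normaliser_def by (simp add: weight_pos less_imp_le)
  ultimately show ?thesis by simp
qed

lemma nn_integral_weight: "(\<integral>\<^sup>+u. ennreal (weight y u) \<partial>\<mu>) = ennreal (normaliser y)"
  unfolding normaliser_def by (rule nn_integral_eq_integral[OF integrable_weight]) (simp add: weight_pos less_imp_le)

lemma emeasure_posterior:
  assumes "A \<in> sets borel"
  shows "emeasure (posterior y) A = ennreal (1 / normaliser y) * (\<integral>\<^sup>+u\<in>A. ennreal (weight y u) \<partial>\<mu>)"
proof -
  have [measurable]: "A \<in> sets \<mu>" using assms by (simp add: sets_\<mu>)
  have "emeasure (posterior y) A = (\<integral>\<^sup>+u\<in>A. ennreal (1 / normaliser y * weight y u) \<partial>\<mu>)"
    unfolding posterior_def by (rule emeasure_density) auto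
  also have "\<dots> = (\<integral>\<^sup>+u. ennreal (1 / normaliser y) * (ennreal (weight y u) * indicator A u) \<partial>\<mu>)"
    using normaliser_pos[of y] by (subst ennreal_mult) (auto simp: mult.assoc less_imp_le weight_pos)
  also have "\<dots> = ennreal (1 / normaliser y) * (\<integral>\<^sup>+u\<in>A. ennreal (weight y u) \<partial>\<mu>)"
    by (rule nn_integral_cmult) measurable
  finally show ?thesis .
qed

lemma sets_posterior [simp]: "sets (posterior y) = sets borel"
  by (simp add: posterior_def sets_\<mu>)

lemma space_\<mu>: "space \<mu> = UNIV"
  using sets_eq_imp_space_eq[OF sets_\<mu>] by simp

lemma prob_space_posterior: "prob_space (posterior y)"
proof
  have "emeasure (posterior y) UNIV = 1"
    using normaliser_pos[of y]
    by (subst emeasure_posterior) (auto simp: nn_integral_weight less_imp_le simp flip: ennreal_mult)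
  then show "emeasure (posterior y) (space (posterior y)) = 1"
    by (simp add: posterior_def space_\<mu>)
qed

lemma measurable_normaliser [measurable]: "normaliser \<in> borel_measurable borel"
  unfolding normaliser_def by (rule borel_measurable_lebesgue_integral) simp

lemma measurable_posterior: "posterior \<in> borel \<rightarrow>\<^sub>M prob_algebra borel"
proof (intro measurable_prob_algebraI measurable_subprob_algebra)
  fix A :: "'a set" assume A: "A \<in> sets borel"
  then have [measurable]: "A \<in> sets \<mu>" by (simp add: sets_\<mu>)
  show "(\<lambda>y. emeasure (posterior y) A) \<in> borel_measurable borel"
    unfolding emeasure_posterior[OF A] by measurable
qed (auto simp: prob_space_posterior prob_space_imp_subprob_space)

lemma posterior_RN_deriv:
  "absolutely_continuous \<mu> (posterior y)"
  "AE u in \<mu>. RN_deriv \<mu> (posterior y) u = ennreal (1 / normaliser y * weight y u)"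
proof -
  show "absolutely_continuous \<mu> (posterior y)"
    unfolding posterior_def by (rule absolutely_continuousI_density) simp
  have "AE u in \<mu>. ennreal (1 / normaliser y * weight y u) = RN_deriv \<mu> (posterior y) u"
    by (rule RN_deriv_unique) (auto simp: posterior_def)
  then show "AE u in \<mu>. RN_deriv \<mu> (posterior y) u = ennreal (1 / normaliser y * weight y u)"
    by eventually_elim simp
qed

text \<open>The square root of the density is a / sqrt Z with a Lipschitz in y uniformly in u.
  Integration over the prior makes Z Lipschitz, and compactness of the ball keeps Z away from
  0.\<close>

lemma sqrt_density_lipschitz:
  "\<exists>C\<ge>0. \<forall>y y' u. norm y \<le> r \<longrightarrow> norm y' \<le> r \<longrightarrow>
     \<bar>sqrt (1 / normaliser y * weight y u) - sqrt (1 / normaliser y' * weight y' u)\<bar> \<le> C * norm (y - y')"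
proof (cases "r < 0")
  case True
  then show ?thesis by (intro exI[of _ 0]) (auto dest: order_trans[OF norm_ge_zero])
next
  case False
  then have r: "0 \<le> r" by simp
  obtain B where B: "B > 0" "\<And>x. norm (R x) \<le> norm x * B"
    using bounded_linear.pos_bounded[OF R_linear] by blast
  define \<rho> where "\<rho> = r * B"
  have \<rho>: "0 \<le> \<rho>" using r B by (simp add: \<rho>_def)
  have R\<rho>: "norm (R y) \<le> \<rho>" if "norm y \<le> r" for y
    using order_trans[OF B(2) mult_right_mono[OF that, of B]] B(1) unfolding \<rho>_def by simp
  define a where "a y u = exp (R y \<bullet> R (L u) / 2 - (norm (R (L u)))\<^sup>2 / 4)" for y u
  have a_pos: "0 < a y u" for y u by (simp add: a_def)
  have w: "weight y u = (a y u)\<^sup>2" for y u by (simp add: a_def weight_eq_square)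
  \<comment> \<open>The maximum over b of \<rho> b / 2 - b^2 / 4 is \<rho>^2 / 4, attained at b =
    \<rho>.\<close>
  define A where "A = exp (\<rho>\<^sup>2 / 4)"
  have a_le: "a y u \<le> A" if "norm y \<le> r" for y u
  proof -
    let ?b = "norm (R (L u))"
    have "R y \<bullet> R (L u) / 2 - ?b\<^sup>2 / 4 \<le> \<rho> * ?b / 2 - ?b\<^sup>2 / 4"
      by (rule gaussian_tilt_bound[OF R\<rho>[OF that]])
    also have "\<dots> \<le> \<rho>\<^sup>2 / 4"
      using sum_squares_bound[of \<rho> ?b] by simp
    finally show ?thesis by (simp add: a_def A_def)
  qed
  have A: "A > 0" by (simp add: A_def)
  define K where "K = (\<rho> + 1) * A / 2 * B"
  have K: "K \<ge> 0" using \<rho> B A by (simp add: K_def)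
  have a_lip: "\<bar>a y u - a y' u\<bar> \<le> K * norm (y - y')" if "norm y \<le> r" "norm y' \<le> r" for y y' u
  proof -
    have "\<bar>a y u - a y' u\<bar> \<le> (\<rho> + 1) * A / 2 * norm (R y - R y')"
      unfolding a_def A_def by (rule gaussian_tilt_lipschitz[OF R\<rho>[OF that(1)] R\<rho>[OF that(2)]])
    also have "\<dots> \<le> (\<rho> + 1) * A / 2 * (norm (y - y') * B)"
      unfolding linear_diff[OF bounded_linear.linear[OF R_linear], symmetric]
      using \<rho> A by (intro mult_left_mono B) auto
    finally show ?thesis by (simp add: K_def mult_ac)
  qed
  have w_lip: "\<bar>weight y u - weight y' u\<bar> \<le> 2 * A * K * norm (y - y')" if "norm y \<le> r" "norm y' \<le> r" for y y' u
  proof -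
    have "weight y u - weight y' u = (a y u - a y' u) * (a y u + a y' u)"
      by (simp add: w power2_eq_square algebra_simps)
    then have "\<bar>weight y u - weight y' u\<bar> = \<bar>a y u - a y' u\<bar> * (a y u + a y' u)"
      using add_pos_pos[OF a_pos[of y u] a_pos[of y' u]] by (simp add: abs_mult)
    also have "\<dots> \<le> (K * norm (y - y')) * (A + A)"
      using a_lip[OF that] a_le[OF that(1)] a_le[OF that(2)] a_pos[of y u] a_pos[of y' u] K
      by (intro mult_mono add_mono) (auto simp: add_nonneg_nonneg less_imp_le)
    finally show ?thesis by (simp add: mult_ac)
  qed
  have Z_lip: "\<bar>normaliser y - normaliser y'\<bar> \<le> 2 * A * K * norm (y - y')" if "norm y \<le> r" "norm y' \<le> r" for y y'
  proof -
    have "\<bar>normaliser y - normaliser y'\<bar> = \<bar>LINT u|\<mu>. weight y u - weight y' u\<bar>"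
      unfolding normaliser_def by (simp add: integrable_weight)
    also have "\<dots> \<le> (LINT u|\<mu>. \<bar>weight y u - weight y' u\<bar>)"
      by (rule integral_abs_bound)
    also have "\<dots> \<le> (LINT u|\<mu>. 2 * A * K * norm (y - y'))"
      using w_lip[OF that] by (intro integral_mono) (auto intro!: integrable_abs integrable_weight)
    finally show ?thesis by (simp add: prob_space)
  qed
  have "continuous_on (cball 0 r) normaliser"
    unfolding continuous_on_iff
  proof safe
    fix y :: 'b and e :: real assume y: "y \<in> cball 0 r" and e: "e > 0"
    define d where "d = e / (2 * A * K + 1)"
    have d: "d > 0" using e A K by (simp add: d_def add_nonneg_pos)
    show "\<exists>d>0. \<forall>y'\<in>cball 0 r. dist y' y < d \<longrightarrow> dist (normaliser y') (normaliser y) < e"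
    proof (intro exI[of _ d] conjI d ballI impI)
      fix y' :: 'b assume y': "y' \<in> cball 0 r" "dist y' y < d"
      have "dist (normaliser y') (normaliser y) \<le> 2 * A * K * dist y' y"
        using Z_lip[of y' y] y y' by (simp add: dist_real_def dist_norm)
      also have "\<dots> \<le> 2 * A * K * d" using y' A K by (intro mult_left_mono) auto
      also have "\<dots> < (2 * A * K + 1) * d" using d by (simp add: algebra_simps)
      also have "\<dots> = e" using A K by (simp add: d_def add_nonneg_pos less_imp_neq[symmetric])
      finally show "dist (normaliser y') (normaliser y) < e" .
    qed
  qed
  then obtain y0 where y0: "\<And>y. norm y \<le> r \<Longrightarrow> normaliser y0 \<le> normaliser y"
    using continuous_attains_inf[of "cball 0 r" normaliser] r by (force simp: cball_eq_empty)
  define z where "z = normaliser y0"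
  have z: "z > 0" "\<And>y. norm y \<le> r \<Longrightarrow> z \<le> normaliser y"
    using normaliser_pos y0 by (auto simp: z_def)
  \<comment> \<open>The first summand comes from varying a, the second from varying sqrt Z through
    s' - s = (Z' - Z) / (s + s'); in every denominator s and s' are replaced by their lower bound
    sqrt z.\<close>
  define C where "C = K / sqrt z + A * (2 * A * K) / ((2 * sqrt z) * (sqrt z * sqrt z))"
  have "C \<ge> 0" using A K z by (simp add: C_def)
  moreover have "\<bar>sqrt (1 / normaliser y * weight y u) - sqrt (1 / normaliser y' * weight y' u)\<bar> \<le> C * norm (y - y')"
    if y: "norm y \<le> r" and y': "norm y' \<le> r" for y y' u
  proof -
    define s s' where "s = sqrt (normaliser y)" and "s' = sqrt (normaliser y')"
    have s: "sqrt z \<le> s" "sqrt z \<le> s'" using z(2) y y' by (auto simp: s_def s'_def)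
    have sz: "0 < sqrt z" using z by simp
    have s0: "0 < s" "0 < s'" using s sz by linarith+
    have "sqrt (1 / normaliser y * weight y u) - sqrt (1 / normaliser y' * weight y' u) = a y u / s - a y' u / s'"
      using a_pos[of y u] a_pos[of y' u] by (simp add: w real_sqrt_divide s_def s'_def)
    also have "\<dots> = (a y u - a y' u) / s + a y' u * ((s' - s) / (s * s'))"
      using s0 by (simp add: field_simps)
    also have "s' - s = (normaliser y' - normaliser y) / (s + s')"
    proof -
      have "(s' - s) * (s + s') = s'\<^sup>2 - s\<^sup>2" by (simp add: power2_eq_square algebra_simps)
      also have "\<dots> = normaliser y' - normaliser y"
        unfolding s_def s'_def using normaliser_pos[of y] normaliser_pos[of y'] by simp
      finally show ?thesis using s0 by (simp add: eq_divide_eq)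
    qed
    finally have eq: "sqrt (1 / normaliser y * weight y u) - sqrt (1 / normaliser y' * weight y' u)
        = (a y u - a y' u) / s + a y' u * ((normaliser y' - normaliser y) / (s + s') / (s * s'))" .
    have "\<bar>sqrt (1 / normaliser y * weight y u) - sqrt (1 / normaliser y' * weight y' u)\<bar>
        \<le> \<bar>(a y u - a y' u) / s\<bar> + \<bar>a y' u * ((normaliser y' - normaliser y) / (s + s') / (s * s'))\<bar>"
      unfolding eq by (rule abs_triangle_ineq)
    also have "\<dots> = \<bar>a y u - a y' u\<bar> / s + a y' u * \<bar>normaliser y' - normaliser y\<bar> / ((s + s') * (s * s'))"
      using s0 a_pos[of y' u] by (simp add: abs_mult)
    also have "\<dots> \<le> (K * norm (y - y')) / sqrt z + A * (2 * A * K * norm (y - y')) / ((2 * sqrt z) * (sqrt z * sqrt z))"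
    proof (rule add_mono)
      show "\<bar>a y u - a y' u\<bar> / s \<le> (K * norm (y - y')) / sqrt z"
        by (rule frac_le[OF _ a_lip[OF y y'] sz s(1)]) (use K in simp)
      have num: "a y' u * \<bar>normaliser y' - normaliser y\<bar> \<le> A * (2 * A * K * norm (y - y'))"
        using Z_lip[OF y' y] less_imp_le[OF A]
        by (intro mult_mono a_le[OF y']) (auto simp: norm_minus_commute)
      have den: "(2 * sqrt z) * (sqrt z * sqrt z) \<le> (s + s') * (s * s')"
      proof (rule mult_mono)
        show "sqrt z * sqrt z \<le> s * s'" by (rule mult_mono[OF s]) (use s0 sz in linarith)+
        show "0 \<le> s + s'" using s0 by linarith
      qed (use s z in auto)
      show "a y' u * \<bar>normaliser y' - normaliser y\<bar> / ((s + s') * (s * s'))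
        \<le> A * (2 * A * K * norm (y - y')) / ((2 * sqrt z) * (sqrt z * sqrt z))"
        by (rule frac_le[OF _ num _ den]) (use A K sz in auto)
    qed
    also have "\<dots> = C * norm (y - y')"
      by (simp add: C_def distrib_right)
    finally show ?thesis .
  qed
  ultimately show ?thesis by blast
qed

text \<open>The density is strictly positive, so a \<nu>-null set, being null for the posterior, is
  null for the prior. Hence both densities with respect to \<nu> are the prior's density f times
  those with respect to \<mu>, and the integrand is at most C^2 f.\<close>

lemma hellinger_dist_posterior_le:
  assumes C: "0 \<le> C" "\<And>u. \<bar>sqrt (1 / normaliser y * weight y u) - sqrt (1 / normaliser y' * weight y' u)\<bar> \<le> C"
    and \<nu>: "sigma_finite_measure \<nu>" "sets \<nu> = sets borel" and ac: "absolutely_continuous \<nu> (posterior y)"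
  shows "hellinger_dist \<nu> (posterior y) (posterior y') \<le> C"
proof -
  interpret \<nu>: sigma_finite_measure \<nu> by fact
  have sets_eq: "sets \<nu> = sets \<mu>" by (simp add: \<nu> sets_\<mu>)
  have mw [measurable]: "weight y \<in> borel_measurable \<nu>" for y
    using measurable_weight[of y] by (simp add: measurable_cong_sets[OF sets_eq refl])
  have "absolutely_continuous \<nu> \<mu>"
    unfolding absolutely_continuous_def null_sets_def
  proof safe
    fix A assume A: "A \<in> sets \<nu>" "emeasure \<nu> A = 0"
    then have "emeasure (posterior y) A = 0"
      using ac unfolding absolutely_continuous_def null_sets_def by auto
    moreover have A': "A \<in> sets \<mu>" using A sets_eq by simp
    ultimately have "AE u in \<mu>. ennreal (1 / normaliser y * weight y u) * indicator A u = 0"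
      unfolding posterior_def by (simp add: emeasure_density nn_integral_0_iff_AE)
    moreover have "0 < 1 / normaliser y * weight y u" for u
      using normaliser_pos[of y] weight_pos[of y u] by simp
    ultimately have "AE u in \<mu>. u \<notin> A"
      by (auto simp: indicator_def ennreal_eq_0_iff not_le[symmetric] simp del: not_le elim!: eventually_mono
          split: if_splits)
    then show "emeasure \<mu> A = 0"
      using A' by (simp add: AE_iff_measurable[OF A'] space_\<mu>)
  qed (use sets_eq in auto)
  then have RN: "density \<nu> (RN_deriv \<nu> \<mu>) = \<mu>"
    by (rule \<nu>.density_RN_deriv) (simp add: sets_eq)
  define f where "f = RN_deriv \<nu> \<mu>"
  have [measurable]: "f \<in> borel_measurable \<nu>" by (simp add: f_def)
  have RNp: "AE u in \<nu>. f u * ennreal (1 / normaliser y * weight y u) = RN_deriv \<nu> (posterior y) u" for y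
  proof (rule \<nu>.RN_deriv_unique)
    have "density \<nu> (\<lambda>u. f u * ennreal (1 / normaliser y * weight y u)) = density (density \<nu> f) (\<lambda>u. ennreal (1 / normaliser y * weight y u))"
      by (rule density_density_eq[symmetric]) auto
    then show "density \<nu> (\<lambda>u. f u * ennreal (1 / normaliser y * weight y u)) = posterior y"
      using RN by (simp add: posterior_def f_def)
  qed simp
  have "(\<integral>\<^sup>+u. f u \<partial>\<nu>) = emeasure (density \<nu> f) (space \<nu>)"
    by (simp add: emeasure_density cong: nn_integral_cong)
  also have "\<dots> = 1"
    unfolding f_def RN using emeasure_space_1 sets_eq_imp_space_eq[OF sets_eq] by simp
  finally have f1: "(\<integral>\<^sup>+u. f u \<partial>\<nu>) = 1" .
  \<comment> \<open>\<open>enn2real\<close> sends \<infinity> to 0, so passing to real values can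
    only lower the integral; an upper bound is what the estimate asks for.\<close>
  have "(\<integral>\<^sup>+u. ennreal (enn2real (f u)) \<partial>\<nu>) \<le> (\<integral>\<^sup>+u. f u \<partial>\<nu>)"
    by (rule nn_integral_mono) (simp add: ennreal_enn2real_if)
  then have fe: "(\<integral>\<^sup>+u. ennreal (enn2real (f u)) \<partial>\<nu>) \<le> 1" by (simp add: f1)
  have int_f: "integrable \<nu> (\<lambda>u. enn2real (f u))"
    using fe by (intro integrableI_nonneg) (auto intro: le_less_trans)
  have int_f1: "(LINT u|\<nu>. enn2real (f u)) \<le> 1"
    using fe enn2real_mono[OF fe] by (subst integral_eq_nn_integral) auto
  have "(LINT u|\<nu>. (sqrt (enn2real (RN_deriv \<nu> (posterior y) u)) - sqrt (enn2real (RN_deriv \<nu> (posterior y') u)))\<^sup>2)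
      \<le> (LINT u|\<nu>. C\<^sup>2 * enn2real (f u))"
  proof (rule integral_mono_AE')
    show "AE u in \<nu>. (sqrt (enn2real (RN_deriv \<nu> (posterior y) u)) - sqrt (enn2real (RN_deriv \<nu> (posterior y') u)))\<^sup>2
      \<le> C\<^sup>2 * enn2real (f u)"
      using RNp[of y] RNp[of y']
    proof eventually_elim
      case (elim u)
      have p: "0 \<le> 1 / normaliser y * weight y u" for y
        using normaliser_pos[of y] weight_pos[of y u] by simp
      have "(sqrt (enn2real (RN_deriv \<nu> (posterior y) u)) - sqrt (enn2real (RN_deriv \<nu> (posterior y') u)))\<^sup>2
        = (sqrt (enn2real (f u)) * (sqrt (1 / normaliser y * weight y u) - sqrt (1 / normaliser y' * weight y' u)))\<^sup>2"
        unfolding elim[symmetric] enn2real_mult enn2real_ennreal[OF p] real_sqrt_mult by (simp add: algebra_simps)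
      also have "\<dots> = enn2real (f u) * \<bar>sqrt (1 / normaliser y * weight y u) - sqrt (1 / normaliser y' * weight y' u)\<bar>\<^sup>2"
        by (simp add: power_mult_distrib)
      also have "\<dots> \<le> enn2real (f u) * C\<^sup>2"
        by (intro mult_left_mono power_mono C) auto
      finally show ?case by (simp add: mult.commute)
    qed
  qed (use int_f in auto)
  also have "\<dots> \<le> C\<^sup>2" using int_f1 by (simp add: mult_left_le)
  finally have "1 / 2 * (LINT u|\<nu>. (sqrt (enn2real (RN_deriv \<nu> (posterior y) u)) - sqrt (enn2real (RN_deriv \<nu> (posterior y') u)))\<^sup>2) \<le> C\<^sup>2"
    using zero_le_power2[of C] by linarith
  then show ?thesis
    unfolding hellinger_dist_def by (intro real_le_lsqrt C(1)) 
qed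

lemma posterior_hellinger_lipschitz:
  "\<exists>C. \<forall>y y'. max (norm y) (norm y') \<le> r \<longrightarrow>
    (\<forall>\<nu>. sigma_finite_measure \<nu> \<and> sets \<nu> = sets borel \<and>
       absolutely_continuous \<nu> (posterior y) \<and> absolutely_continuous \<nu> (posterior y') \<longrightarrow>
       hellinger_dist \<nu> (posterior y) (posterior y') \<le> C * norm (y - y'))"
proof -
  obtain C where "C \<ge> 0" "\<And>y y' u. norm y \<le> r \<Longrightarrow> norm y' \<le> r \<Longrightarrow>
     \<bar>sqrt (1 / normaliser y * weight y u) - sqrt (1 / normaliser y' * weight y' u)\<bar> \<le> C * norm (y - y')"
    using sqrt_density_lipschitz[of r] by blast
  then show ?thesis
    by (intro exI[of _ C] allI impI hellinger_dist_posterior_le) auto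
qed

text \<open>Given u, the variable Y has density g (y - L u) = h y * weight y u, in which h depends
  on y alone. Integrating over u first, by Tonelli, produces the normaliser times the
  posterior.\<close>

lemma posterior_conditional_distribution:
  fixes M :: "'w measure" and U :: "'w \<Rightarrow> 'a" and \<eta> Y :: "'w \<Rightarrow> 'b" and k :: real
  assumes M: "prob_space M" and U: "distr M borel U = \<mu>"
    and \<eta>: "distributed M lborel \<eta> (\<lambda>z. ennreal (k * exp (- (norm (R z))\<^sup>2 / 2)))"
    and ind: "independent_variables M U \<eta>"
    and Y: "\<And>\<omega>. \<omega> \<in> space M \<Longrightarrow> Y \<omega> = L (U \<omega>) + \<eta> \<omega>"
  shows "Y \<in> borel_measurable M" "conditional_distribution M U Y posterior"
proof -
  interpret M: prob_space M by (rule M)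
  have U_m [measurable]: "U \<in> borel_measurable M" and \<eta>_m [measurable]: "\<eta> \<in> borel_measurable M"
    using ind by (auto simp: independent_variables_def)
  note L_measurable [measurable]
  have "(\<lambda>\<omega>. L (U \<omega>) + \<eta> \<omega>) \<in> borel_measurable M" by measurable
  then show Y_m [measurable]: "Y \<in> borel_measurable M"
    by (subst measurable_cong[OF Y])
  have R_m [measurable]: "R \<in> borel_measurable borel"
    by (intro borel_measurable_continuous_onI linear_continuous_on R_linear)
  define g where "g z = ennreal (k * exp (- (norm (R z))\<^sup>2 / 2))" for z
  have g_m [measurable]: "g \<in> borel_measurable borel" unfolding g_def by measurable
  define N where "N = distr M borel \<eta>"
  have N: "N = density lborel g"
  proof -
    have "N = distr M lborel \<eta>" unfolding N_def by (rule distr_cong) auto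
    also have "\<dots> = density lborel g" using \<eta> unfolding distributed_def g_def by blast
    finally show ?thesis .
  qed
  interpret N: prob_space N unfolding N_def by (rule M.prob_space_distr) simp
  interpret pair_sigma_finite \<mu> lborel ..
  \<comment> \<open>The density enters through \<open>ennreal\<close>, which truncates negative
    numbers to 0; a negative k would give the noise total mass 0.\<close>
  have k: "0 \<le> k"
  proof (rule ccontr)
    assume "\<not> 0 \<le> k"
    then have "g z = 0" for z by (simp add: g_def ennreal_neg mult_nonpos_nonneg)
    then have "emeasure N (space N) = 0" by (simp add: N emeasure_density)
    then show False using N.emeasure_space_1 by simp
  qed
  have joint: "\<mu> \<Otimes>\<^sub>M N = distr M (borel \<Otimes>\<^sub>M borel) (\<lambda>\<omega>. (U \<omega>, \<eta> \<omega>))"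
  proof (rule pair_measure_eqI)
    show "sigma_finite_measure \<mu>" "sigma_finite_measure N" by unfold_locales
    show "sets (\<mu> \<Otimes>\<^sub>M N) = sets (distr M (borel \<Otimes>\<^sub>M borel) (\<lambda>\<omega>. (U \<omega>, \<eta> \<omega>)))"
      by (simp add: sets_\<mu> N_def cong: sets_pair_measure_cong)
    fix A B assume "A \<in> sets \<mu>" "B \<in> sets N"
    then have A [measurable]: "A \<in> sets borel" and B [measurable]: "B \<in> sets borel" by (simp_all add: sets_\<mu> N_def)
    have "M.prob ((U -` A \<inter> space M) \<inter> (\<eta> -` B \<inter> space M)) = M.prob (U -` A \<inter> space M) * M.prob (\<eta> -` B \<inter> space M)"
      using ind unfolding independent_variables_def by (intro M.indep_setD) (use A B in auto)
    moreover have "(\<lambda>\<omega>. (U \<omega>, \<eta> \<omega>)) -` (A \<times> B) \<inter> space M = (U -` A \<inter> space M) \<inter> (\<eta> -` B \<inter> space M)"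
      by auto
    ultimately show "emeasure \<mu> A * emeasure N B = emeasure (distr M (borel \<Otimes>\<^sub>M borel) (\<lambda>\<omega>. (U \<omega>, \<eta> \<omega>))) (A \<times> B)"
      unfolding U[symmetric] N_def
      by (simp add: emeasure_distr M.emeasure_eq_measure ennreal_mult)
  qed
  define h where "h y = ennreal (k * exp (- (norm (R y))\<^sup>2 / 2))" for y
  have h_m [measurable]: "h \<in> borel_measurable borel" unfolding h_def by measurable
  \<comment> \<open>The summand -|R y|^2 / 2 of the potential splits off the noise density at y
    itself.\<close>
  have g_shift: "g (y - L u) = h y * ennreal (weight y u)" for y u
    unfolding g_def h_def weight_def using k
    by (simp add: mult.assoc flip: ennreal_mult exp_add)
  have key: "emeasure M {\<omega> \<in> space M. U \<omega> \<in> A \<and> Y \<omega> \<in> B} =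
      (\<integral>\<^sup>+y\<in>B. (h y * ennreal (normaliser y)) * emeasure (posterior y) A \<partial>lborel)"
    if A: "A \<in> sets borel" and B: "B \<in> sets borel" for A B
  proof -
    have [measurable]: "A \<in> sets borel" "B \<in> sets borel" "A \<in> sets \<mu>" using A B by (simp_all add: sets_\<mu>)
    have Lmu [measurable]: "L \<in> borel_measurable \<mu>"
      using L_measurable by (simp add: measurable_cong_sets[OF sets_\<mu> refl])
    have "emeasure M {\<omega> \<in> space M. U \<omega> \<in> A \<and> Y \<omega> \<in> B} =
        (\<integral>\<^sup>+\<omega>. indicator A (U \<omega>) * indicator B (L (U \<omega>) + \<eta> \<omega>) \<partial>M)"
    proof -
      have [measurable]: "{\<omega> \<in> space M. U \<omega> \<in> A \<and> Y \<omega> \<in> B} \<in> sets M" by measurable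
      have "emeasure M {\<omega> \<in> space M. U \<omega> \<in> A \<and> Y \<omega> \<in> B} =
          (\<integral>\<^sup>+\<omega>. indicator {\<omega> \<in> space M. U \<omega> \<in> A \<and> Y \<omega> \<in> B} \<omega> \<partial>M)"
        by simp
      also have "\<dots> = (\<integral>\<^sup>+\<omega>. indicator A (U \<omega>) * indicator B (L (U \<omega>) + \<eta> \<omega>) \<partial>M)"
        by (rule nn_integral_cong) (simp add: Y indicator_def)
      finally show ?thesis .
    qed
    also have "\<dots> = (\<integral>\<^sup>+p. indicator A (fst p) * indicator B (L (fst p) + snd p) \<partial>(\<mu> \<Otimes>\<^sub>M N))"
      unfolding joint by (subst nn_integral_distr) auto
    also have "\<dots> = (\<integral>\<^sup>+u. \<integral>\<^sup>+z. indicator A u * indicator B (L u + z) \<partial>N \<partial>\<mu>)"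
      by (subst N.nn_integral_fst[symmetric]) (auto simp: N)
    also have "\<dots> = (\<integral>\<^sup>+u. \<integral>\<^sup>+y. indicator A u * (indicator B y * g (y - L u)) \<partial>lborel \<partial>\<mu>)"
    proof (rule nn_integral_cong)
      fix u
      have "(\<integral>\<^sup>+y. indicator A u * (indicator B y * g (y - L u)) \<partial>lborel)
        = (\<integral>\<^sup>+y. indicator A u * (indicator B y * g (y - L u)) \<partial>distr lborel borel ((+) (L u)))"
        by (simp add: lborel_distr_plus)
      also have "\<dots> = (\<integral>\<^sup>+z. indicator A u * (indicator B (L u + z) * g z) \<partial>lborel)"
        by (subst nn_integral_distr) auto
      also have "\<dots> = (\<integral>\<^sup>+z. g z * (indicator A u * indicator B (L u + z)) \<partial>lborel)"
        by (simp add: mult_ac)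
      also have "\<dots> = (\<integral>\<^sup>+z. indicator A u * indicator B (L u + z) \<partial>N)"
        unfolding N by (rule nn_integral_density[symmetric]) auto
      finally show "(\<integral>\<^sup>+z. indicator A u * indicator B (L u + z) \<partial>N) =
        (\<integral>\<^sup>+y. indicator A u * (indicator B y * g (y - L u)) \<partial>lborel)" ..
    qed
    also have "\<dots> = (\<integral>\<^sup>+y. \<integral>\<^sup>+u. indicator A u * (indicator B y * g (y - L u)) \<partial>\<mu> \<partial>lborel)"
      by (rule Fubini'[symmetric]) measurable
    also have "\<dots> = (\<integral>\<^sup>+y\<in>B. (h y * ennreal (normaliser y)) * emeasure (posterior y) A \<partial>lborel)"
    proof (rule nn_integral_cong)
      fix y
      have "(\<integral>\<^sup>+u. indicator A u * (indicator B y * g (y - L u)) \<partial>\<mu>) =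
         (\<integral>\<^sup>+u. (h y * indicator B y) * (ennreal (weight y u) * indicator A u) \<partial>\<mu>)"
        unfolding g_shift by (simp add: mult_ac)
      also have "\<dots> = (h y * indicator B y) * (\<integral>\<^sup>+u\<in>A. ennreal (weight y u) \<partial>\<mu>)"
        by (rule nn_integral_cmult) measurable
      also have "(\<integral>\<^sup>+u\<in>A. ennreal (weight y u) \<partial>\<mu>) = ennreal (normaliser y) * emeasure (posterior y) A"
        unfolding emeasure_posterior[OF A] mult.assoc[symmetric]
        using normaliser_pos[of y] by (simp flip: ennreal_mult)
      finally show "(\<integral>\<^sup>+u. indicator A u * (indicator B y * g (y - L u)) \<partial>\<mu>) =
        (h y * ennreal (normaliser y)) * emeasure (posterior y) A * indicator B y"
        by (simp add: mult_ac)
    qed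
    finally show ?thesis .
  qed
  \<comment> \<open>The case A = UNIV of \<open>key\<close> identifies the law of Y, so that the
    factor h y * normaliser y in \<open>key\<close> is exactly its density.\<close>
  have distr_Y: "distr M borel Y = density lborel (\<lambda>y. h y * ennreal (normaliser y))"
  proof (rule measure_eqI)
    fix B assume "B \<in> sets (distr M borel Y)"
    then have B: "B \<in> sets borel" by simp
    have "emeasure (posterior y) UNIV = 1" for y
      using prob_space.emeasure_space_1[OF prob_space_posterior[of y]] by (simp add: posterior_def space_\<mu>)
    then show "emeasure (distr M borel Y) B = emeasure (density lborel (\<lambda>y. h y * ennreal (normaliser y))) B"
      using key[of UNIV B] B by (simp add: emeasure_distr emeasure_density vimage_def Int_def conj_commute)
  qed simp
  show "conditional_distribution M U Y posterior"
    unfolding conditional_distribution_def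
  proof (intro conjI ballI measurable_posterior)
    fix A :: "'a set" and B :: "'b set" assume A: "A \<in> sets borel" and B: "B \<in> sets borel"
    have [measurable]: "(\<lambda>y. emeasure (posterior y) A) \<in> borel_measurable borel"
      using measurable_compose[OF measurable_prob_algebraD[OF measurable_posterior] measurable_emeasure_subprob_algebra[OF A]] .
    show "emeasure M {\<omega> \<in> space M. U \<omega> \<in> A \<and> Y \<omega> \<in> B} = (\<integral>\<^sup>+y\<in>B. emeasure (posterior y) A \<partial>distr M borel Y)"
      unfolding key[OF A B] distr_Y using B by (subst nn_integral_density) (auto simp: mult_ac)
  qed
qed

end

theorem theorem6p3:
  fixes \<alpha> \<beta> \<delta> :: real
    and s q t :: "real ^ 'n::finite \<Rightarrow> real"
    and \<psi>F \<psi>M :: "real \<Rightarrow> real"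
    and x :: "'k::finite \<Rightarrow> real ^ 'n"
    and S :: "real ^ 'k ^ 'k"
    and M :: "'w measure"
    and U :: "'w \<Rightarrow> 'n torus_L2"
    and \<eta> Y :: "'w \<Rightarrow> real ^ 'k"
    and \<mu>\<^sub>0 :: "'n torus_L2 measure"
  assumes dim: "CARD('n) \<le> 3"
    and alpha: "0 < \<alpha>" "\<alpha> \<le> 1"
    and beta: "real CARD('n) / 4 < \<beta>" "\<beta> \<le> 1"
    and s: "C_log_loc s" "torus_Linf s"
    and q: "P_log q"
    and s_lower: "(INF z. s z) > real CARD('n) / ess_sup q"
    and delta: "\<delta> > 4"
    and t: "C_log_loc t" "torus_Linf t"
    and t_range: "real CARD('n) / ess_inf q - real CARD('n) / 2 < ess_inf t"
      "ess_inf t \<le> ess_sup t" "ess_sup t < ess_inf s - real CARD('n) / ess_sup q"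
    and wavelets: "admissible_wavelets s t \<psi>F \<psi>M"
    and prior: "is_besov_measure \<delta> s q \<psi>F \<psi>M \<mu>\<^sub>0"
    and covariance: "pos_def_matrix S"
    and prob: "prob_space M"
    and U_law: "distr M borel U = \<mu>\<^sub>0"
    and noise: "distributed M lborel \<eta> (\<lambda>z. ennreal (gaussian_density S z))"
    and indep: "independent_variables M U \<eta>"
    and data: "\<And>\<omega>. \<omega> \<in> space M \<Longrightarrow> Y \<omega> = point_values x (forward_map \<alpha> \<beta> (U \<omega>)) + \<eta> \<omega>"
  shows "(\<forall>(u :: 'n torus_L2) v. frac_diffusion_solution \<alpha> \<beta> u v \<longrightarrow> v 1 = forward_map \<alpha> \<beta> u) \<and>
    (\<exists>\<mu>. conditional_distribution M U Y \<mu> \<and>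
      (\<forall>\<kappa>. conditional_distribution M U Y \<kappa> \<longrightarrow> (AE y in distr M borel Y. \<kappa> y = \<mu> y)) \<and>
      (\<forall>y. absolutely_continuous \<mu>\<^sub>0 (\<mu> y) \<and>
        (AE u in \<mu>\<^sub>0. RN_deriv \<mu>\<^sub>0 (\<mu> y) u =
          ennreal (1 / evidence \<alpha> \<beta> x S \<mu>\<^sub>0 y * exp (- potential \<alpha> \<beta> x S u y)))) \<and>
      (\<forall>r. \<exists>C. \<forall>y y'. max (norm y) (norm y') \<le> r \<longrightarrow>
        (\<forall>\<nu>. sigma_finite_measure \<nu> \<and> sets \<nu> = sets borel \<and>
           absolutely_continuous \<nu> (\<mu> y) \<and> absolutely_continuous \<nu> (\<mu> y') \<longrightarrow>
           hellinger_dist \<nu> (\<mu> y) (\<mu> y') \<le> C * norm (y - y'))))"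
proof (intro conjI allI impI)
  fix u :: "'n torus_L2" and v
  assume "frac_diffusion_solution \<alpha> \<beta> u v"
  then show "v 1 = forward_map \<alpha> \<beta> u" by (rule frac_diffusion_solution_at_1[OF alpha])
next
  define L where "L u = point_values x (forward_map \<alpha> \<beta> u)" for u
  define R where "R = (*v) (matrix_inv_sqrt S)"
  have U [measurable]: "U \<in> borel_measurable M"
    using indep by (simp add: independent_variables_def)
  have L: "L \<in> borel_measurable borel"
    unfolding L_def[abs_def] by (rule measurable_forward_observation[OF alpha beta])
  interpret gaussian_observation \<mu>\<^sub>0 L R
  proof (intro gaussian_observation.intro gaussian_observation_axioms.intro L)
    show "prob_space \<mu>\<^sub>0" unfolding U_law[symmetric] by (rule prob_space.prob_space_distr[OF prob U])
    show "sets \<mu>\<^sub>0 = sets borel" unfolding U_law[symmetric] by simp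
    show "bounded_linear R" unfolding R_def by (rule matrix_vector_mul_bounded_linear)
  qed
  have weight: "weight y u = exp (- potential \<alpha> \<beta> x S u y)" for y u
    unfolding weight_def unfolding potential_def L_def R_def by (rule refl)
  have evidence: "normaliser y = evidence \<alpha> \<beta> x S \<mu>\<^sub>0 y" for y
    unfolding normaliser_def weight_def unfolding evidence_def L_def R_def by simp
  \<comment> \<open>Brings the noise density into the form k * exp (- |R z|^2 / 2), with k the
    Gaussian normalising constant.\<close>
  have "gaussian_density S z = 1 / sqrt ((2 * pi) ^ CARD('k) * det S) * exp (- (norm (R z))\<^sup>2 / 2)" for z
    by (simp add: gaussian_density_def matrix_inv_sqrt_quadratic_form[OF covariance] R_def)
  note density = noise[unfolded this]
  note posterior_is_conditional =
    posterior_conditional_distribution[OF prob U_law density indep data[folded L_def]]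
  show "\<exists>\<mu>. conditional_distribution M U Y \<mu> \<and>
      (\<forall>\<kappa>. conditional_distribution M U Y \<kappa> \<longrightarrow> (AE y in distr M borel Y. \<kappa> y = \<mu> y)) \<and>
      (\<forall>y. absolutely_continuous \<mu>\<^sub>0 (\<mu> y) \<and>
        (AE u in \<mu>\<^sub>0. RN_deriv \<mu>\<^sub>0 (\<mu> y) u =
          ennreal (1 / evidence \<alpha> \<beta> x S \<mu>\<^sub>0 y * exp (- potential \<alpha> \<beta> x S u y)))) \<and>
      (\<forall>r. \<exists>C. \<forall>y y'. max (norm y) (norm y') \<le> r \<longrightarrow>
        (\<forall>\<nu>. sigma_finite_measure \<nu> \<and> sets \<nu> = sets borel \<and>
           absolutely_continuous \<nu> (\<mu> y) \<and> absolutely_continuous \<nu> (\<mu> y') \<longrightarrow>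
           hellinger_dist \<nu> (\<mu> y) (\<mu> y') \<le> C * norm (y - y')))"
  proof (intro exI[of _ posterior] conjI allI)
    show "conditional_distribution M U Y posterior" by (rule posterior_is_conditional(2))
    show "conditional_distribution M U Y \<kappa> \<longrightarrow> (AE y in distr M borel Y. \<kappa> y = posterior y)" for \<kappa>
      using conditional_distribution_unique[OF prob posterior_is_conditional(1) _ posterior_is_conditional(2)] by blast
    show "absolutely_continuous \<mu>\<^sub>0 (posterior y)" for y by (rule posterior_RN_deriv(1))
    show "AE u in \<mu>\<^sub>0. RN_deriv \<mu>\<^sub>0 (posterior y) u =
        ennreal (1 / evidence \<alpha> \<beta> x S \<mu>\<^sub>0 y * exp (- potential \<alpha> \<beta> x S u y))" for y
      using posterior_RN_deriv(2)[of y] unfolding weight evidence .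
  qed (rule posterior_hellinger_lipschitz)
qed

end
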